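(* Let $m\in\mathbb{N}_+$ and $V\in L^\infty(\mathbb{R};\mathbb{R})$. Suppose $u\in C([0,1];L^2(\mathbb{R}))$ satisfies $$u(t)=e^{-it(D_x^{2m}+V)}u(0),\quad t\in[0,1].$$ Then there exists a constant $\tilde\gamma>0$, depending only on $m$, such that if $\gamma>\tilde\gamma$ and $$e^{\gamma|x|^{\frac{2m}{2m-1}}}u(0,x)\in L^2(\mathbb{R}),\qquad e^{\gamma|x|^{\frac{2m}{2m-1}}}u(1,x)\in L^2(\mathbb{R}),$$ then $u\equiv 0$ in $[0,1]\times\mathbb{R}$.
   Context: $D_x=i^{-1}\partial_x$. The operator $D_x^{2m}+V$ (with $V$ acting by multiplication) is self-adjoint on $L^2(\mathbb{R})$ with domain $H^{2m}(\mathbb{R})$, and $e^{-it(D_x^{2m}+V)}$, $t\in\mathbb{R}$, is the associated unitary group defined by the spectral calculus. No spatial regularity of $u$ is assumed. *)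

theory Defs
  imports "HOL-Analysis.Analysis"
begin

text \<open>Elements of L2(R) are represented by measurable square-integrable functions
  real => complex; equality in L2 is equality almost everywhere.\<close>

definition L2 :: "(real \<Rightarrow> complex) \<Rightarrow> bool" where
  "L2 f \<longleftrightarrow> f \<in> borel_measurable lborel \<and> integrable lborel (\<lambda>x. (cmod (f x))^2)"

definition ae_eq :: "(real \<Rightarrow> complex) \<Rightarrow> (real \<Rightarrow> complex) \<Rightarrow> bool" where
  "ae_eq f g \<longleftrightarrow> (AE x in lborel. f x = g x)"

definition L2norm :: "(real \<Rightarrow> complex) \<Rightarrow> real" where
  "L2norm f = sqrt (LINT x|lborel. (cmod (f x))^2)"

definition Linf_real :: "(real \<Rightarrow> real) \<Rightarrow> bool" where
  "Linf_real V \<longleftrightarrow> V \<in> borel_measurable lborel \<and> (\<exists>C. AE x in lborel. \<bar>V x\<bar> \<le> C)"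

definition test_fun :: "(real \<Rightarrow> real) \<Rightarrow> bool" where
  "test_fun \<phi> \<longleftrightarrow> (\<forall>k x. ((deriv ^^ k) \<phi>) differentiable (at x)) \<and> bounded {x. \<phi> x \<noteq> 0}"

definition weak_deriv :: "nat \<Rightarrow> (real \<Rightarrow> complex) \<Rightarrow> (real \<Rightarrow> complex) \<Rightarrow> bool" where
  "weak_deriv k f g \<longleftrightarrow> (\<forall>\<phi>. test_fun \<phi> \<longrightarrow>
     (LINT x|lborel. g x * complex_of_real (\<phi> x)) =
     (-1)^k * (LINT x|lborel. f x * complex_of_real ((deriv ^^ k) \<phi> x)))"

definition sobolev :: "nat \<Rightarrow> (real \<Rightarrow> complex) \<Rightarrow> bool" where
  "sobolev n f \<longleftrightarrow> L2 f \<and> (\<forall>k\<le>n. \<exists>g. L2 g \<and> weak_deriv k f g)"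

text \<open>h equals (D_x^(2m) + V) f (a.e.), where D_x = i^(-1) d/dx, so D_x^(2m) = (-1)^m d^(2m)/dx^(2m).\<close>
definition H_op :: "nat \<Rightarrow> (real \<Rightarrow> real) \<Rightarrow> (real \<Rightarrow> complex) \<Rightarrow> (real \<Rightarrow> complex) \<Rightarrow> bool" where
  "H_op m V f h \<longleftrightarrow> (\<exists>w. L2 w \<and> weak_deriv (2*m) f w \<and>
      ae_eq h (\<lambda>x. (-1)^m * w x + complex_of_real (V x) * f x))"

text \<open>U is the unitary group e^(-it(D_x^(2m)+V)), t in R: a strongly continuous
  one-parameter group of unitary operators on L2(R) whose generator is
  -i(D_x^(2m)+V) with domain H^(2m)(R).  By Stone's theorem this characterises
  the group given by the spectral calculus uniquely.\<close>
definition schr_group :: "nat \<Rightarrow> (real \<Rightarrow> real) \<Rightarrow> (real \<Rightarrow> (real \<Rightarrow> complex) \<Rightarrow> (real \<Rightarrow> complex)) \<Rightarrow> bool" where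
  "schr_group m V U \<longleftrightarrow>
     (\<forall>t f. L2 f \<longrightarrow> L2 (U t f)) \<and>
     (\<forall>t f g. L2 f \<longrightarrow> L2 g \<longrightarrow> ae_eq f g \<longrightarrow> ae_eq (U t f) (U t g)) \<and>
     (\<forall>t f g a b. L2 f \<longrightarrow> L2 g \<longrightarrow>
        ae_eq (U t (\<lambda>x. a * f x + b * g x)) (\<lambda>x. a * U t f x + b * U t g x)) \<and>
     (\<forall>f. L2 f \<longrightarrow> ae_eq (U 0 f) f) \<and>
     (\<forall>s t f. L2 f \<longrightarrow> ae_eq (U (s + t) f) (U s (U t f))) \<and>
     (\<forall>t f. L2 f \<longrightarrow> L2norm (U t f) = L2norm f) \<and>
     (\<forall>f t0. L2 f \<longrightarrow> ((\<lambda>t. L2norm (\<lambda>x. U t f x - U t0 f x)) \<longlongrightarrow> 0) (at t0)) \<and>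
     (\<forall>f. L2 f \<longrightarrow>
        ((\<exists>g. L2 g \<and> ((\<lambda>t. L2norm (\<lambda>x. (U t f x - f x) / complex_of_real t - g x)) \<longlongrightarrow> 0) (at 0))
          \<longleftrightarrow> sobolev (2*m) f)) \<and>
     (\<forall>f g. L2 f \<longrightarrow> L2 g \<longrightarrow>
        ((\<lambda>t. L2norm (\<lambda>x. (U t f x - f x) / complex_of_real t - g x)) \<longlongrightarrow> 0) (at 0) \<longrightarrow>
        (\<exists>h. H_op m V f h \<and> ae_eq g (\<lambda>x. - \<i> * h x)))"

definition C01_L2 :: "(real \<Rightarrow> real \<Rightarrow> complex) \<Rightarrow> bool" where
  "C01_L2 u \<longleftrightarrow> (\<forall>t\<in>{0..1}. L2 (u t)) \<and>
     (\<forall>t0\<in>{0..1}. ((\<lambda>t. L2norm (\<lambda>x. u t x - u t0 x)) \<longlongrightarrow> 0) (at t0 within {0..1}))"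

end

theory Submission
  imports Defs "HOL-Complex_Analysis.Complex_Analysis" "HOL-Computational_Algebra.Fundamental_Theorem_Algebra"
begin

text \<open>
  Write \<open>H = D\<^sup>2\<^sup>m + V\<close> and let \<open>\<langle>f, g\<rangle>\<close> be the bilinear \<open>L\<^sup>2\<close> pairing.  For a bounded
  \<open>\<eta>\<close> with compact support let \<open>\<phi>\<^sub>0 = \<eta>\<close> and let \<open>\<phi>\<^sub>j\<^sub>+\<^sub>1\<close> be the solution of
  \<open>H \<phi>\<^sub>j\<^sub>+\<^sub>1 = \<phi>\<^sub>j\<close> that decays towards \<open>-\<infinity>\<close>.  It grows exponentially towards \<open>+\<infinity>\<close>, but for
  every large \<open>r\<close> it is at most a constant times \<open>r\<^sup>-\<^sup>j exp ((2r)\<^sup>1\<^sup>/\<^sup>2\<^sup>m x)\<close>.  Formally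
  \<open>\<langle>u(t), \<phi>\<^sub>j\<rangle> = i d/dt \<langle>u(t), \<phi>\<^sub>j\<^sub>+\<^sub>1\<rangle>\<close>, so integrating by parts against a polynomial \<open>p\<close>
  expresses \<open>\<integral> p(t) \<langle>u(t), \<eta>\<rangle> dt\<close> over \<open>[0,1]\<close> by the numbers \<open>\<langle>u(0), \<phi>\<^sub>j\<rangle>\<close>, \<open>\<langle>u(1), \<phi>\<^sub>j\<rangle>\<close>
  and the derivatives of \<open>p\<close> at \<open>0\<close> and \<open>1\<close>.  Optimising in \<open>r\<close>, the decay of \<open>u(0)\<close> and
  \<open>u(1)\<close> bounds these numbers by a constant times \<open>\<epsilon>\<^sup>j / j!\<close>, where \<open>\<epsilon>\<close> is small for large
  \<open>\<gamma>\<close> and does not depend on \<open>V\<close>.  For \<open>p(t) = (1 - (t - 1/2)\<^sup>2)\<^sup>N\<close>, which is exponentially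
  small on complex discs around \<open>0\<close> and \<open>1\<close> but peaks at \<open>1/2\<close>, this forces
  \<open>\<langle>u(1/2), \<eta>\<rangle> = 0\<close> as \<open>N\<close> tends to infinity; hence \<open>u(1/2) = 0\<close>, and \<open>u = 0\<close> by unitarity.

  The integration by parts needs decay at intermediate times.  For \<open>\<zeta>\<close> concentrated near \<open>R\<close>,
  \<open>G(E) = \<integral> exp(itE) \<langle>u(t), \<zeta>\<rangle> dt\<close> is entire of exponential type.  If \<open>E\<close> is large and lies off
  a sector around the positive real axis, then \<open>(H - E)\<^sup>-\<^sup>1 \<zeta>\<close> decays exponentially away from \<open>R\<close>,
  and \<open>G(E) = i (exp(iE) \<langle>u(1), (H - E)\<^sup>-\<^sup>1 \<zeta>\<rangle> - \<langle>u(0), (H - E)\<^sup>-\<^sup>1 \<zeta>\<rangle>)\<close> is exponentially small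
  in \<open>R\<close>.  The maximum principle in the sector carries this over to \<open>E\<close> near \<open>0\<close>, that is, to
  all moments \<open>\<integral> t\<^sup>n \<langle>u(t), \<zeta>\<rangle> dt\<close>.
\<close>

section \<open>Smooth functions and test functions\<close>

definition smooth :: "(real \<Rightarrow> real) \<Rightarrow> bool" where
  "smooth f \<longleftrightarrow> (\<forall>k x. (deriv ^^ k) f differentiable (at x))"

text \<open>Smoothness speaks of all iterates of \<open>deriv\<close>, for which closed formulas are
  rarely at hand. A set closed under differentiation that contains \<open>f\<close> contains all of
  them, so exhibiting such a set is enough.\<close>

lemma smooth_coinduct:
  assumes "f \<in> A" "\<And>g. g \<in> A \<Longrightarrow> \<exists>g'\<in>A. \<forall>x. (g has_real_derivative g' x) (at x)"
  shows "smooth f"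
proof -
  have "(deriv ^^ k) f \<in> A" for k
  proof (induction k)
    case 0 then show ?case using assms(1) by simp
  next
    case (Suc k)
    then obtain g' where g': "g' \<in> A" "\<forall>x. ((deriv ^^ k) f has_real_derivative g' x) (at x)"
      using assms(2) by blast
    have "deriv ((deriv ^^ k) f) = g'" using g'(2) by (auto intro: DERIV_imp_deriv)
    then show ?case using g'(1) by simp
  qed
  then show ?thesis unfolding smooth_def
    using assms(2) real_differentiable_def by blast
qed

lemma smooth_deriv: "smooth f \<Longrightarrow> smooth (deriv f)"
  unfolding smooth_def by (metis funpow_Suc_right o_apply)

lemma smooth_higher_deriv: "smooth f \<Longrightarrow> smooth ((deriv ^^ k) f)"
  by (induction k) (auto intro: smooth_deriv)

lemma smooth_DERIV: "smooth f \<Longrightarrow> (f has_real_derivative deriv f x) (at x)"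
  unfolding smooth_def by (metis DERIV_deriv_iff_real_differentiable funpow_0)

lemma smooth_continuous_on: "smooth f \<Longrightarrow> continuous_on S f"
  by (meson DERIV_continuous_on smooth_DERIV has_field_derivative_at_within)

lemma smooth_measurable: "smooth f \<Longrightarrow> f \<in> borel_measurable borel"
  by (intro borel_measurable_continuous_onI smooth_continuous_on)

lemma smooth_mult:
  assumes "smooth f" "smooth g"
  shows "smooth (\<lambda>x. f x * g x)"
proof -
  \<comment> \<open>Single products are not closed under differentiation, but by Leibniz' rule
    finite sums of products of smooth functions are.\<close>
  define A where "A = {h. \<exists>n p q. (\<forall>i<n. smooth (p i) \<and> smooth (q i)) \<and> h = (\<lambda>x. \<Sum>i<n::nat. p i x * q i x)}"
  show ?thesis
  proof (rule smooth_coinduct[where A=A])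
    show "(\<lambda>x. f x * g x) \<in> A" unfolding A_def
      using assms by (intro CollectI exI[of _ 1] exI[of _ "\<lambda>_. f"] exI[of _ "\<lambda>_. g"]) auto
  next
    fix h assume "h \<in> A"
    then obtain n :: nat and p q where h: "\<forall>i<n. smooth (p i) \<and> smooth (q i)" "h = (\<lambda>x. \<Sum>i<n. p i x * q i x)"
      unfolding A_def mem_Collect_eq by (elim exE conjE) (rule that)
    \<comment> \<open>Differentiation doubles the number of summands: the first \<open>n\<close>
      differentiate the left factor, the last \<open>n\<close> the right one.\<close>
    define p' where "p' i = (if i < n then deriv (p i) else p (i - n))" for i
    define q' where "q' i = (if i < n then q i else deriv (q (i - n)))" for i
    have s: "(\<Sum>i<n+n. p' i x * q' i x) = (\<Sum>i<n. deriv (p i) x * q i x + p i x * deriv (q i) x)" for x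
    proof -
      have "(\<Sum>i<n+k. r i) = (\<Sum>i<n. r i) + (\<Sum>i<k. r (n+i))" for k and r :: "nat \<Rightarrow> real"
        by (induction k) auto
      then show ?thesis by (simp add: p'_def q'_def sum.distrib)
    qed
    have "\<forall>i<n+n. smooth (p' i) \<and> smooth (q' i)"
      using h(1) by (auto simp: p'_def q'_def intro: smooth_deriv)
    then have "(\<lambda>x. \<Sum>i<n+n. p' i x * q' i x) \<in> A" unfolding A_def by blast
    moreover have "(h has_real_derivative (\<Sum>i<n+n. p' i x * q' i x)) (at x)" for x
      unfolding s h(2)
      by (rule DERIV_sum) (use h(1) in \<open>auto intro!: DERIV_mult' [THEN DERIV_cong] smooth_DERIV simp: algebra_simps\<close>)
    ultimately show "\<exists>g'\<in>A. \<forall>x. (h has_real_derivative g' x) (at x)"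
      by (intro bexI[where x="\<lambda>x. \<Sum>i<n+n. p' i x * q' i x"]) auto
  qed
qed

lemma smooth_affine:
  assumes "smooth f"
  shows "smooth (\<lambda>x. d * f (a + c * x))"
proof (rule smooth_coinduct[where A="{\<lambda>x. d * h (a + c * x) | d h. smooth h}"])
  fix g assume "g \<in> {\<lambda>x. d * h (a + c * x) | d h. smooth h}"
  then obtain d h where g: "g = (\<lambda>x. d * h (a + c * x))" "smooth h" by auto
  have "(g has_real_derivative (d * c) * deriv h (a + c * x)) (at x)" for x
    unfolding g(1) by (rule derivative_eq_intros DERIV_chain'[OF _ smooth_DERIV[OF g(2)]] refl | simp)+
  moreover have "(\<lambda>x. (d * c) * deriv h (a + c * x)) \<in> {\<lambda>x. d * h (a + c * x) | d h. smooth h}"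
    using smooth_deriv[OF g(2)] by blast
  ultimately show "\<exists>g'\<in>{\<lambda>x. d * h (a + c * x) | d h. smooth h}. \<forall>x. (g has_real_derivative g' x) (at x)"
    by (intro bexI[where x="\<lambda>x. (d * c) * deriv h (a + c * x)"]) auto
qed (use assms in auto)

lemma smooth_antideriv:
  assumes "\<And>x. (F has_real_derivative f x) (at x)" "smooth f"
  shows "smooth F"
proof (rule smooth_coinduct[where A="insert F {g. smooth g}"])
  fix g assume "g \<in> insert F {g. smooth g}"
  then show "\<exists>g'\<in>insert F {g. smooth g}. \<forall>x. (g has_real_derivative g' x) (at x)"
    using assms smooth_deriv smooth_DERIV by blast
qed auto

text \<open>With \<open>y = 1/x\<close> this is the decay of a polynomial against
  \<open>exp (- y)\<close>; it settles the right-hand difference quotient at 0 in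
  \<open>smooth_flat\<close>.\<close>

lemma poly_exp_decay_at_right_0: "((\<lambda>x. poly p (1/x) * exp (- (1/x))) \<longlongrightarrow> 0) (at_right (0::real))"
proof -
  have "((\<lambda>y. (\<Sum>i\<le>degree p. coeff p i * (y^i / exp y))) \<longlongrightarrow> (\<Sum>i\<le>degree p. coeff p i * 0)) at_top"
    by (intro tendsto_sum tendsto_mult tendsto_const tendsto_power_div_exp_0)
  then have "((\<lambda>y. poly p y * exp (- y)) \<longlongrightarrow> 0) at_top"
    by (simp add: poly_altdef sum_distrib_right exp_minus divide_inverse mult.assoc)
  moreover have "filterlim (\<lambda>x::real. 1/x) at_top (at_right 0)"
    using filterlim_inverse_at_top_right by (simp add: inverse_eq_divide)
  ultimately show ?thesis by (rule filterlim_compose)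
qed

section \<open>Bump functions\<close>

definition flat :: "real \<Rightarrow> real" where
  "flat x = (if 0 < x then exp (- (1/x)) else 0)"

lemma smooth_flat: "smooth flat"
proof -
  \<comment> \<open>The functions \<open>p(1/x) exp(-1/x)\<close>, extended by zero, are closed under differentiation.\<close>
  let ?F = "\<lambda>p x. if 0 < x then poly p (1/x) * exp (- (1/x)) else (0::real)"
  show ?thesis
  proof (rule smooth_coinduct[where A="range ?F"])
    show "flat \<in> range ?F" by (rule image_eqI[where x=1]) (auto simp: flat_def)
  next
    fix g assume "g \<in> range ?F"
    then obtain p where g: "g = ?F p" by auto
    \<comment> \<open>The derivative of \<open>p(1/x) exp(-1/x)\<close> is
      \<open>(1/x)^2 (p - p')(1/x) exp(-1/x)\<close>; the two \<open>pCons 0\<close> supply the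
      factor \<open>(1/x)^2\<close>.\<close>
    define q where "q = pCons 0 (pCons 0 (p - pderiv p))"
    have "(g has_real_derivative ?F q x) (at x)" for x
    proof (cases x "0::real" rule: linorder_cases)
      case less
      have "((\<lambda>x. 0) has_real_derivative 0) (at x)" by simp
      then have "(g has_real_derivative 0) (at x)"
        by (rule has_field_derivative_transform_within_open[where S="{..<0}"]) (use less g in auto)
      then show ?thesis using less by simp
    next
      case greater
      have "((\<lambda>x. poly p (1/x) * exp (- (1/x))) has_real_derivative
          (poly (pderiv p) (1/x) * (- (1/x^2))) * exp (- (1/x)) + poly p (1/x) * (exp (- (1/x)) * (1/x^2))) (at x)"
        using greater
        by (auto intro!: derivative_eq_intros DERIV_chain'[OF _ poly_DERIV] simp: field_simps power2_eq_square)
      also have "(poly (pderiv p) (1/x) * (- (1/x^2))) * exp (- (1/x)) + poly p (1/x) * (exp (- (1/x)) * (1/x^2)) = ?F q x"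
        using greater by (simp add: q_def field_simps power2_eq_square)
      finally show ?thesis
        by (rule has_field_derivative_transform_within_open[where S="{0<..}"]) (use greater g in auto)
    next
      case equal
      have r: "((\<lambda>h. (g (0 + h) - g 0) / h) \<longlongrightarrow> 0) (at_right 0)"
      proof (rule Lim_transform_eventually[OF poly_exp_decay_at_right_0[of "pCons 0 p"]])
        show "\<forall>\<^sub>F x in at_right 0. poly (pCons 0 p) (1 / x) * exp (- (1 / x)) = (g (0 + x) - g 0) / x"
          by (rule eventually_mono[OF eventually_at_right_less]) (simp add: g)
      qed
      have l: "((\<lambda>h. (g (0 + h) - g 0) / h) \<longlongrightarrow> 0) (at_left 0)"
        by (rule Lim_transform_eventually[OF tendsto_const])
           (auto simp: g eventually_at_left_field intro!: exI[of _ "-1"])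
      have "((\<lambda>h. (g (0 + h) - g 0) / h) \<longlongrightarrow> 0) (at 0)"
        using l r filterlim_split_at by blast
      then show ?thesis using equal by (simp add: DERIV_def)
    qed
    then show "\<exists>g'\<in>range ?F. \<forall>x. (g has_real_derivative g' x) (at x)"
      by (intro bexI[where x="?F q"]) auto
  qed
qed

lemma flat_bounds: "0 \<le> flat x" "flat x \<le> 1" "x \<le> 0 \<Longrightarrow> flat x = 0" "0 < x \<Longrightarrow> 0 < flat x"
  by (auto simp: flat_def)

text \<open>\<open>c\<close> is a steepness: as it grows, the bumps tend to the indicator of the
  open interval from \<open>a\<close> to \<open>b\<close>.\<close>

definition bump :: "real \<Rightarrow> real \<Rightarrow> real \<Rightarrow> real \<Rightarrow> real" where
  "bump c a b x = flat (c * (x - a)) * flat (c * (b - x))"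

lemma smooth_bump: "smooth (bump c a b)"
proof -
  have "smooth (\<lambda>x. (1 * flat (- c * a + c * x)) * (1 * flat (c * b + - c * x)))"
    by (intro smooth_mult smooth_affine smooth_flat)
  then show ?thesis by (simp add: bump_def[abs_def] algebra_simps)
qed

lemma bump_zero: "c \<ge> 0 \<Longrightarrow> x \<notin> {a<..<b} \<Longrightarrow> bump c a b x = 0"
  by (auto simp: bump_def flat_bounds mult_nonneg_nonpos not_less)

lemma bump_bounds: "0 \<le> bump c a b x" "bump c a b x \<le> 1"
  by (auto simp: bump_def flat_bounds mult_le_one)

lemma bump_pos: "c > 0 \<Longrightarrow> a < x \<Longrightarrow> x < b \<Longrightarrow> 0 < bump c a b x"
  by (simp add: bump_def flat_bounds)

lemma test_fun_iff: "test_fun \<phi> \<longleftrightarrow> smooth \<phi> \<and> bounded {x. \<phi> x \<noteq> 0}"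
  by (auto simp: test_fun_def smooth_def)

lemma test_fun_bump: "c \<ge> 0 \<Longrightarrow> test_fun (bump c a b)"
proof -
  assume c: "c \<ge> 0"
  have "{x. bump c a b x \<noteq> 0} \<subseteq> {a<..<b}" using bump_zero[OF c] by blast
  then show ?thesis using smooth_bump test_fun_iff bounded_subset[OF bounded_box[of a b]] by (auto simp: box_real)
qed

lemma test_fun_support: "test_fun \<phi> \<Longrightarrow> \<exists>L>0. \<forall>x. \<bar>x\<bar> > L \<longrightarrow> \<phi> x = 0"
proof -
  assume "test_fun \<phi>"
  then obtain B where "\<forall>x\<in>{x. \<phi> x \<noteq> 0}. norm x \<le> B" unfolding test_fun_iff bounded_iff by auto
  then show ?thesis by (intro exI[of _ "max 1 B"]) (auto simp: not_le[symmetric])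
qed

lemma deriv_zero_outside:
  fixes f :: "real \<Rightarrow> real"
  assumes "\<And>x. x \<in> S \<Longrightarrow> f x = c" "open S" "x \<in> S"
  shows "deriv f x = 0"
proof -
  have "((\<lambda>x. c) has_real_derivative 0) (at x)" by simp
  then have "(f has_real_derivative 0) (at x)"
    by (rule has_field_derivative_transform_within_open[where S=S]) (use assms in auto)
  then show ?thesis by (rule DERIV_imp_deriv)
qed

lemma test_fun_deriv: "test_fun \<phi> \<Longrightarrow> test_fun (deriv \<phi>)"
proof -
  assume t: "test_fun \<phi>"
  then obtain L where L: "L > 0" "\<forall>x. \<bar>x\<bar> > L \<longrightarrow> \<phi> x = 0" using test_fun_support by blast
  have o: "open {x::real. \<bar>x\<bar> > L}" by (intro open_Collect_less continuous_intros)
  have "deriv \<phi> x = 0" if "\<bar>x\<bar> > L" for x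
    using deriv_zero_outside[OF _ o, of \<phi> 0 x] L that by auto
  then have "bounded {x. deriv \<phi> x \<noteq> 0}"
    unfolding bounded_iff by (intro exI[of _ L]) (auto simp: not_le[symmetric])
  then show ?thesis using t smooth_deriv by (auto simp: test_fun_iff)
qed

lemma test_fun_higher_deriv: "test_fun \<phi> \<Longrightarrow> test_fun ((deriv ^^ k) \<phi>)"
  by (induction k) (auto intro: test_fun_deriv)

lemma test_fun_mult: "smooth w \<Longrightarrow> test_fun \<phi> \<Longrightarrow> test_fun (\<lambda>x. w x * \<phi> x)"
  unfolding test_fun_iff by (auto intro!: smooth_mult elim: bounded_subset)

lemma continuous_on_Icc_bounded:
  fixes f :: "real \<Rightarrow> real"
  assumes "continuous_on {a..b} f"
  obtains C where "\<forall>x\<in>{a..b}. \<bar>f x\<bar> \<le> C"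
proof -
  have "bounded (f ` {a..b})" using assms by (intro compact_imp_bounded compact_continuous_image) auto
  then show ?thesis using that by (auto simp: bounded_iff)
qed

lemma test_fun_bounded:
  assumes "test_fun \<phi>"
  obtains B where "\<And>x. \<bar>\<phi> x\<bar> \<le> B"
proof -
  obtain L where L: "L > 0" "\<forall>x. \<bar>x\<bar> > L \<longrightarrow> \<phi> x = 0" using test_fun_support[OF assms] by blast
  obtain B where B: "\<forall>x\<in>{-L..L}. \<bar>\<phi> x\<bar> \<le> B"
    using assms test_fun_iff smooth_continuous_on by (blast intro: continuous_on_Icc_bounded)
  have "\<bar>\<phi> x\<bar> \<le> max B 0" for x
    using B[rule_format, of x] L(2) by (cases "\<bar>x\<bar> \<le> L") (auto simp: le_max_iff_disj abs_le_iff)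
  then show ?thesis using that by blast
qed

text \<open>The half-lines form an intersection-stable generator of the Borel sets, so by Dynkin's
  argument the integral of \<open>f\<close> vanishes over every Borel set, and uniqueness of
  densities gives the claim.\<close>

lemma integral_zero_atMost_imp_AE_zero:
  fixes f :: "real \<Rightarrow> real"
  assumes f: "integrable lborel f" and z: "\<And>a. (LINT x:{..a}|lborel. f x) = 0"
  shows "AE x in lborel. f x = 0"
proof (rule density_unique_real[OF f, of "\<lambda>_. 0"])
  \<comment> \<open>The integral over the whole line is a limit over growing half-lines; the
    complement step of the induction needs it.\<close>
  have tot: "(LINT x|lborel. f x) = 0"
  proof -
    have "(\<lambda>n. LINT x:{..real n}|lborel. f x) \<longlonglongrightarrow> (LINT x|lborel. f x)"
      unfolding set_lebesgue_integral_def
    proof (rule integral_dominated_convergence[where w="\<lambda>x. norm (f x)"])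
      show "AE x in lborel. (\<lambda>n. indicator {..real n} x *\<^sub>R f x) \<longlonglongrightarrow> f x"
      proof (rule AE_I2)
        fix x :: real
        obtain N :: nat where "x \<le> N" using real_arch_simple by blast
        then have "eventually (\<lambda>n. f x = indicator {..real n} x *\<^sub>R f x) sequentially"
          by (intro eventually_sequentiallyI[of N]) (auto simp: indicator_def)
        then show "(\<lambda>n. indicator {..real n} x *\<^sub>R f x) \<longlonglongrightarrow> f x"
          by (rule Lim_transform_eventually[OF tendsto_const])
      qed
    qed (use f in \<open>auto simp: indicator_def intro!: AE_I2\<close>)
    then show ?thesis using z by (simp add: LIMSEQ_const_iff)
  qed
  fix A :: "real set" assume "A \<in> sets lborel"
  then have A: "A \<in> sigma_sets UNIV (range atMost)"
    by (simp add: borel_eq_atMost)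
  have si: "set_integrable lborel B f" if "B \<in> sets borel" for B
    using f that unfolding set_integrable_def by (intro integrable_mult_indicator) auto
  have "Int_stable (range (atMost :: real \<Rightarrow> _))" by (auto simp: Int_stable_def)
  from this subset_UNIV[of "range (atMost :: real \<Rightarrow> _)", unfolded Pow_UNIV[symmetric]] A
  have "(LINT x:A|lborel. f x) = 0"
  proof (induct A rule: sigma_sets_induct_disjoint)
    case (basic A) then show ?case using z by auto
  next
    case (compl A)
    then have A: "A \<in> sets borel" by (simp add: borel_eq_atMost)
    have "(LINT x:A \<union> (UNIV - A)|lborel. f x) = (LINT x:A|lborel. f x) + (LINT x:UNIV-A|lborel. f x)"
      by (rule set_integral_Un) (use A si in auto)
    then show ?case using compl tot by (simp add: set_lebesgue_integral_def)
  next
    case (union A)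
    then have A: "\<And>i. A i \<in> sets borel" by (auto simp: borel_eq_atMost)
    have "(LINT x:(\<Union>i. A i)|lborel. f x) = (\<Sum>i. LINT x:A i|lborel. f x)"
      by (rule lebesgue_integral_countable_add) (use A union si in \<open>auto simp: disjoint_family_on_def\<close>)
    then show ?case using union by simp
  qed (auto simp: set_lebesgue_integral_def)
  then show "(LINT x:A|lborel. f x) = (LINT x:A|lborel. 0)" by (simp add: set_lebesgue_integral_def)
qed auto

section \<open>Square-integrable functions and weak derivatives\<close>

lemma L2_measurable [measurable_dest]: "L2 f \<Longrightarrow> f \<in> borel_measurable borel"
  by (simp add: L2_def)

lemma borel_measurable_compose_cnj: "f \<in> borel_measurable M \<Longrightarrow> (\<lambda>x. cnj (f x)) \<in> borel_measurable M"
  by (rule measurable_compose[OF _ borel_measurable_continuous_onI]) (auto intro: continuous_intros)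

lemma L2_square_integrable: "L2 f \<Longrightarrow> integrable lborel (\<lambda>x. (cmod (f x))^2)"
  by (simp add: L2_def)

lemma L2_dominated:
  assumes f: "f \<in> borel_measurable borel" and g: "integrable lborel g" and le: "\<And>x. (cmod (f x))^2 \<le> g x"
  shows "L2 f"
  unfolding L2_def
proof
  show "integrable lborel (\<lambda>x. (cmod (f x))\<^sup>2)"
    by (rule Bochner_Integration.integrable_bound[OF g])
       (use f le in \<open>auto intro!: AE_I2 order_trans[OF le]\<close>)
qed (use f in auto)

lemma L2_lincomb:
  assumes "L2 f" "L2 g" shows "L2 (\<lambda>x. a * f x + b * g x)"
proof (rule L2_dominated)
  note [measurable] = L2_measurable[OF assms(1)] L2_measurable[OF assms(2)]
  show "(\<lambda>x. a * f x + b * g x) \<in> borel_measurable borel" by measurable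
  show "integrable lborel (\<lambda>x. 2 * (cmod a)^2 * (cmod (f x))^2 + 2 * (cmod b)^2 * (cmod (g x))^2)"
    using assms by (auto intro!: L2_square_integrable)
  fix x
  have "cmod (a * f x + b * g x) \<le> cmod a * cmod (f x) + cmod b * cmod (g x)"
    using norm_triangle_ineq[of "a * f x" "b * g x"] by (simp add: norm_mult)
  then have "(cmod (a * f x + b * g x))^2 \<le> (cmod a * cmod (f x) + cmod b * cmod (g x))^2"
    by (intro power_mono) auto
  also have "\<dots> \<le> 2 * (cmod a * cmod (f x))^2 + 2 * (cmod b * cmod (g x))^2"
    using sum_squares_bound[of "cmod a * cmod (f x)" "cmod b * cmod (g x)"] by (simp add: power2_sum)
  finally show "(cmod (a * f x + b * g x))^2 \<le> 2 * (cmod a)^2 * (cmod (f x))^2 + 2 * (cmod b)^2 * (cmod (g x))^2"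
    by (simp add: power_mult_distrib)
qed

lemma L2_zero [simp]: "L2 (\<lambda>x. 0)"
  by (simp add: L2_def)

lemma L2_add: "L2 f \<Longrightarrow> L2 g \<Longrightarrow> L2 (\<lambda>x. f x + g x)"
  using L2_lincomb[of f g 1 1] by simp

lemma L2_diff: "L2 f \<Longrightarrow> L2 g \<Longrightarrow> L2 (\<lambda>x. f x - g x)"
  using L2_lincomb[of f g 1 "-1"] by simp

lemma L2_cmult: "L2 f \<Longrightarrow> L2 (\<lambda>x. a * f x)"
  using L2_lincomb[of f f a 0] by simp

lemma L2_cnj: "L2 f \<Longrightarrow> L2 (\<lambda>x. cnj (f x))"
  by (auto simp: L2_def intro: borel_measurable_compose_cnj)

lemma L2_mult_integrable:
  assumes "L2 f" "L2 g" shows "integrable lborel (\<lambda>x. f x * g x)"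
proof (rule Bochner_Integration.integrable_bound)
  note [measurable] = L2_measurable[OF assms(1)] L2_measurable[OF assms(2)]
  show "integrable lborel (\<lambda>x. (cmod (f x))^2 + (cmod (g x))^2)"
    using assms by (auto intro!: L2_square_integrable)
  show "(\<lambda>x. f x * g x) \<in> borel_measurable lborel" by measurable
  have "cmod (f x * g x) \<le> norm ((cmod (f x))^2 + (cmod (g x))^2)" for x
    using sum_squares_bound[of "cmod (f x)" "cmod (g x)"] mult_nonneg_nonneg[OF norm_ge_zero[of "f x"] norm_ge_zero[of "g x"]]
    unfolding norm_mult
    by (simp add: norm_mult del: mult_nonneg_nonneg)
  then show "AE x in lborel. cmod (f x * g x) \<le> norm ((cmod (f x))^2 + (cmod (g x))^2)" by simp
qed

lemma L2norm_nonneg: "0 \<le> L2norm f"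
  by (simp add: L2norm_def)

lemma L2norm_sq: "(L2norm f)^2 = (LINT x|lborel. (cmod (f x))^2)"
  by (simp add: L2norm_def)

lemma L2_Cauchy_Schwarz:
  assumes "L2 f" "L2 g"
  shows "cmod (LINT x|lborel. f x * g x) \<le> L2norm f * L2norm g"
proof -
  let ?I = "LINT x|lborel. cmod (f x * g x)"
  have int: "integrable lborel (\<lambda>x. cmod (f x * g x))" using L2_mult_integrable[OF assms] by simp
  \<comment> \<open>Integrate the pointwise inequality
    \<open>0 \<le> (s |f| - |g|)^2\<close>.\<close>
  have key: "2 * s * ?I \<le> s^2 * (L2norm f)^2 + (L2norm g)^2" for s
  proof -
    have "(LINT x|lborel. 2 * s * cmod (f x * g x)) \<le> (LINT x|lborel. s^2 * (cmod (f x))^2 + (cmod (g x))^2)"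
    proof (rule integral_mono)
      fix x show "2 * s * cmod (f x * g x) \<le> s^2 * (cmod (f x))^2 + (cmod (g x))^2"
        using sum_squares_bound[of "s * cmod (f x)" "cmod (g x)"] by (simp add: norm_mult power_mult_distrib algebra_simps)
    qed (use int assms in \<open>auto intro!: L2_square_integrable\<close>)
    then show ?thesis using assms by (simp add: L2norm_sq L2_square_integrable)
  qed
  \<comment> \<open>The optimal \<open>s\<close> is the quotient of the two norms; \<open>e\<close>
    is added to both to avoid division by zero and is sent to 0 afterwards.\<close>
  have eps: "?I \<le> (L2norm f + e) * (L2norm g + e)" if e: "e > 0" for e
  proof -
    define F G where "F = L2norm f + e" and "G = L2norm g + e"
    have FG: "L2norm f \<le> F" "L2norm g \<le> G" "0 < F" "0 < G"
      using e L2norm_nonneg[of f] L2norm_nonneg[of g] by (auto simp: F_def G_def)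
    have "2 * (G / F) * ?I \<le> (G / F)^2 * (L2norm f)^2 + (L2norm g)^2" by (rule key)
    also have "\<dots> \<le> (G / F)^2 * F^2 + G^2"
      using FG L2norm_nonneg by (intro add_mono mult_left_mono power_mono) auto
    finally have "?I \<le> F * G" using FG by (simp add: power2_eq_square field_simps)
    then show ?thesis by (simp only: F_def G_def)
  qed
  have "((\<lambda>e. (L2norm f + e) * (L2norm g + e)) \<longlongrightarrow> (L2norm f + 0) * (L2norm g + 0)) (at_right 0)"
    by (intro tendsto_intros)
  then have "?I \<le> (L2norm f + 0) * (L2norm g + 0)"
    by (rule tendsto_lowerbound) (auto intro!: eps eventually_mono[OF eventually_at_right_less])
  moreover have "cmod (LINT x|lborel. f x * g x) \<le> ?I" by (rule integral_norm_bound)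
  ultimately show ?thesis unfolding add_0_right by (rule order_trans[rotated])
qed

lemma L2norm_cong_ae: "L2 f \<Longrightarrow> L2 g \<Longrightarrow> ae_eq f g \<Longrightarrow> L2norm f = L2norm g"
  unfolding L2norm_def ae_eq_def
  by (intro arg_cong[where f=sqrt] integral_cong_AE) (auto dest: L2_measurable)

lemma L2norm_zero_AE: "L2 f \<Longrightarrow> L2norm f = 0 \<Longrightarrow> AE x in lborel. f x = 0"
  using integral_nonneg_eq_0_iff_AE[of lborel "\<lambda>x. (cmod (f x))^2"]
  by (auto simp: L2norm_def L2_square_integrable)

lemma integrable_indicator_Icc: "integrable lborel (indicator {a..b::real} :: real \<Rightarrow> real)"
  by (rule integrable_real_indicator) (auto simp: emeasure_lborel_Icc_eq)

lemma L2_bounded_compact: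
  assumes "f \<in> borel_measurable borel" "\<And>x. cmod (f x) \<le> B * indicator {-L..L} x"
  shows "L2 f"
proof (rule L2_dominated[OF assms(1)])
  show "integrable lborel (\<lambda>x. B^2 * indicator {-L..L::real} x)" by (simp add: integrable_indicator_Icc)
  fix x show "(cmod (f x))^2 \<le> B^2 * indicator {-L..L} x"
    using assms(2)[of x] power_mono[OF assms(2)[of x], of 2] by (auto simp: indicator_def split: if_splits)
qed

section \<open>The fundamental lemma of the calculus of variations\<close>

lemma bump_tendsto_indicator: "(\<lambda>n. bump (real n) a b x) \<longlonglongrightarrow> indicator {a<..<b} x"
proof -
  have f: "(\<lambda>n. flat (real n * y)) \<longlonglongrightarrow> 1" if "y > 0" for y
  proof -
    have "(\<lambda>n. exp (- ((1/y) * (1 / real n)))) \<longlonglongrightarrow> exp (- ((1/y) * 0))"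
      by (intro tendsto_intros lim_1_over_n)
    then have "(\<lambda>n. exp (- (1 / (real n * y)))) \<longlonglongrightarrow> 1" by (simp add: mult.commute)
    moreover have "eventually (\<lambda>n. exp (- (1 / (real n * y))) = flat (real n * y)) sequentially"
      using eventually_gt_at_top[of 0] by eventually_elim (use that in \<open>simp add: flat_def\<close>)
    ultimately show ?thesis by (rule Lim_transform_eventually)
  qed
  show ?thesis
  proof (cases "x \<in> {a<..<b}")
    case True
    then have "(\<lambda>n. flat (real n * (x - a)) * flat (real n * (b - x))) \<longlonglongrightarrow> 1 * 1"
      by (intro tendsto_mult f) auto
    then show ?thesis using True by (simp add: bump_def)
  next
    case False then show ?thesis by (simp add: bump_zero)
  qed
qed

text \<open>Steep bumps converge boundedly to the indicator of an interval, so all integrals of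
  \<open>f\<close> over bounded open intervals vanish. Restricted to \<open>]-n, n[\<close>,
  \<open>f\<close> is integrable, and its integrals over half-lines are of this form.\<close>

lemma fundamental_lemma_real:
  fixes f :: "real \<Rightarrow> real"
  assumes [measurable]: "f \<in> borel_measurable borel"
    and int: "\<And>a b. integrable lborel (\<lambda>x. indicator {a<..<b} x * f x)"
    and z: "\<And>\<phi>. test_fun \<phi> \<Longrightarrow> (LINT x|lborel. f x * \<phi> x) = 0"
  shows "AE x in lborel. f x = 0"
proof -
  have zi: "(LINT x|lborel. indicator {a<..<b} x * f x) = 0" for a b
  proof -
    have "(\<lambda>n. LINT x|lborel. f x * bump (real n) a b x) \<longlonglongrightarrow> (LINT x|lborel. indicator {a<..<b} x * f x)"
    proof (rule integral_dominated_convergence[where w="\<lambda>x. norm (indicator {a<..<b} x * f x)"])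
      show "AE x in lborel. (\<lambda>n. f x * bump (real n) a b x) \<longlonglongrightarrow> indicator {a<..<b} x * f x"
        using tendsto_mult[OF tendsto_const bump_tendsto_indicator] by (subst mult.commute) auto
      show "AE x in lborel. norm (f x * bump (real n) a b x) \<le> norm (indicator {a<..<b} x * f x)" for n
      proof (rule AE_I2)
        fix x show "norm (f x * bump (real n) a b x) \<le> norm (indicator {a<..<b} x * f x)"
          using bump_bounds[of "real n" a b x] bump_zero[of "real n" x a b]
          by (cases "x \<in> {a<..<b}") (auto simp: abs_mult mult_left_le)
      qed
      show "(\<lambda>x. f x * bump (real n) a b x) \<in> borel_measurable lborel" for n
        using smooth_measurable[OF smooth_bump, of "real n" a b] by measurable
    qed (use int in auto)
    then show ?thesis using z test_fun_bump by (simp add: LIMSEQ_const_iff)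
  qed
  have "AE x in lborel. indicator {-real n<..<real n} x * f x = 0" for n
  proof (rule integral_zero_atMost_imp_AE_zero[OF int])
    fix a
    have "AE x in lborel. indicator {..a} x *\<^sub>R (indicator {-real n<..<real n} x * f x) = indicator {-real n<..<min a (real n)} x * f x"
      using AE_lborel_singleton[of a] by eventually_elim (auto simp: indicator_def)
    then have "(LINT x:{..a}|lborel. indicator {-real n<..<real n} x * f x) = (LINT x|lborel. indicator {-real n<..<min a (real n)} x * f x)"
      unfolding set_lebesgue_integral_def by (intro integral_cong_AE) auto
    then show "(LINT x:{..a}|lborel. indicator {-real n<..<real n} x * f x) = 0" using zi by simp
  qed
  then have "AE x in lborel. \<forall>n. indicator {-real n<..<real n} x * f x = 0"
    unfolding AE_all_countable by blast
  then show ?thesis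
  proof eventually_elim
    case (elim x)
    obtain n :: nat where "\<bar>x\<bar> < n" using reals_Archimedean2 by blast
    then show ?case using elim[rule_format, of n] by (auto simp: indicator_def abs_less_iff split: if_splits)
  qed
qed

lemma L2_indicator: "L2 (indicator {a<..<b})"
  by (rule L2_bounded_compact[where B=1 and L="max \<bar>a\<bar> \<bar>b\<bar>"]) (auto simp: indicator_def)

lemma L2_test_fun: "test_fun \<phi> \<Longrightarrow> L2 (\<lambda>x. complex_of_real (\<phi> x))"
proof -
  assume t: "test_fun \<phi>"
  obtain L where L: "L > 0" "\<forall>x. \<bar>x\<bar> > L \<longrightarrow> \<phi> x = 0" using test_fun_support[OF t] by blast
  obtain B where B: "\<And>x. \<bar>\<phi> x\<bar> \<le> B" using test_fun_bounded[OF t] by blast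
  have m: "(\<lambda>x. complex_of_real (\<phi> x)) \<in> borel_measurable borel"
    using t smooth_measurable by (auto simp: test_fun_iff)
  show ?thesis
    by (rule L2_bounded_compact[where B=B and L=L, OF m])
       (use B L in \<open>auto simp: indicator_def not_le\<close>)
qed

lemma fundamental_lemma:
  assumes "L2 f" and z: "\<And>\<phi>. test_fun \<phi> \<Longrightarrow> (LINT x|lborel. f x * complex_of_real (\<phi> x)) = 0"
  shows "AE x in lborel. f x = 0"
proof -
  note [measurable] = L2_measurable[OF assms(1)]
  have i: "integrable lborel (\<lambda>x. f x * indicator {a<..<b} x)" for a b
    by (rule L2_mult_integrable[OF assms(1) L2_indicator])
  have it: "integrable lborel (\<lambda>x. f x * complex_of_real (\<phi> x))" if "test_fun \<phi>" for \<phi>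
    by (rule L2_mult_integrable[OF assms(1) L2_test_fun[OF that]])
  have "AE x in lborel. Re (f x) = 0"
  proof (rule fundamental_lemma_real)
    show "integrable lborel (\<lambda>x. indicator {a<..<b} x * Re (f x))" for a b
      using integrable_Re[OF i[of a b]]
      by (rule Bochner_Integration.integrable_cong[THEN iffD1, rotated -1]) (auto simp: indicator_def)
    show "(LINT x|lborel. Re (f x) * \<phi> x) = 0" if "test_fun \<phi>" for \<phi>
      using integral_Re[OF it[OF that]] z[OF that] by simp
  qed auto
  moreover have "AE x in lborel. Im (f x) = 0"
  proof (rule fundamental_lemma_real)
    show "integrable lborel (\<lambda>x. indicator {a<..<b} x * Im (f x))" for a b
      using integrable_Im[OF i[of a b]]
      by (rule Bochner_Integration.integrable_cong[THEN iffD1, rotated -1]) (auto simp: indicator_def)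
    show "(LINT x|lborel. Im (f x) * \<phi> x) = 0" if "test_fun \<phi>" for \<phi>
      using integral_Im[OF it[OF that]] z[OF that] by simp
  qed auto
  ultimately show ?thesis by eventually_elim (simp add: complex_eq_iff)
qed

section \<open>Calculus of weak derivatives\<close>

lemma weak_deriv_unique:
  assumes "L2 g" "L2 g'" "weak_deriv k f g" "weak_deriv k f g'"
  shows "ae_eq g g'"
proof -
  have "AE x in lborel. g x - g' x = 0"
  proof (rule fundamental_lemma[OF L2_diff[OF assms(1,2)]])
    fix \<phi> assume t: "test_fun \<phi>"
    have "(LINT x|lborel. g x * \<phi> x - g' x * \<phi> x) = (LINT x|lborel. g x * \<phi> x) - (LINT x|lborel. g' x * \<phi> x)"
      by (rule Bochner_Integration.integral_diff) (auto intro!: L2_mult_integrable assms L2_test_fun t)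
    then show "(LINT x|lborel. (g x - g' x) * complex_of_real (\<phi> x)) = 0"
      using assms(3,4) t by (simp add: weak_deriv_def left_diff_distrib)
  qed
  then show ?thesis by (simp add: ae_eq_def)
qed

lemma weak_deriv_0: "weak_deriv 0 f f"
  by (simp add: weak_deriv_def)

lemma weak_deriv_Suc:
  assumes "weak_deriv 1 f g" "weak_deriv n g h"
  shows "weak_deriv (Suc n) f h"
  unfolding weak_deriv_def
proof (intro allI impI)
  fix \<phi> assume t: "test_fun \<phi>"
  have "(LINT x|lborel. h x * \<phi> x) = (-1)^n * (LINT x|lborel. g x * (deriv ^^ n) \<phi> x)"
    using assms(2) t by (simp add: weak_deriv_def)
  also have "(LINT x|lborel. g x * (deriv ^^ n) \<phi> x) = - (LINT x|lborel. f x * (deriv ^^ Suc n) \<phi> x)"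
    using assms(1) test_fun_higher_deriv[OF t, of n] by (simp add: weak_deriv_def)
  finally show "(LINT x|lborel. h x * \<phi> x) = (-1)^Suc n * (LINT x|lborel. f x * (deriv ^^ Suc n) \<phi> x)" by simp
qed

lemma weak_deriv_chain:
  assumes "\<And>l. l < n \<Longrightarrow> weak_deriv 1 (d l) (d (Suc l))"
  shows "weak_deriv n (d 0) (d n)"
  using assms
proof (induction n arbitrary: d)
  case 0 then show ?case by (simp add: weak_deriv_0)
next
  case (Suc n)
  show ?case using weak_deriv_Suc[OF Suc.prems[of 0]] Suc.IH[of "\<lambda>l. d (Suc l)"] Suc.prems by simp
qed

lemma weak_deriv_cnj: 
  assumes "weak_deriv k f g" shows "weak_deriv k (\<lambda>x. cnj (f x)) (\<lambda>x. cnj (g x))"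
  unfolding weak_deriv_def
proof (intro allI impI)
  fix \<phi> assume t: "test_fun \<phi>"
  have e: "(LINT x|lborel. cnj (h x) * complex_of_real (\<psi> x)) = cnj (LINT x|lborel. h x * complex_of_real (\<psi> x))" for h and \<psi> :: "real \<Rightarrow> real"
    using Bochner_Integration.integral_cnj[of lborel "\<lambda>x. h x * complex_of_real (\<psi> x)"] by simp
  show "(LINT x|lborel. cnj (g x) * \<phi> x) = (-1)^k * (LINT x|lborel. cnj (f x) * (deriv ^^ k) \<phi> x)"
    unfolding e using assms t by (simp add: weak_deriv_def)
qed

text \<open>Local boundedness. Solutions that grow exponentially need not be in \<open>L2\<close>,
  but they can still be paired with test functions, and sums and smooth multiples stay in this
  class.\<close>

definition lbd :: "(real \<Rightarrow> complex) \<Rightarrow> bool" where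
  "lbd f \<longleftrightarrow> f \<in> borel_measurable borel \<and> (\<forall>L. \<exists>B. \<forall>x. \<bar>x\<bar> \<le> L \<longrightarrow> cmod (f x) \<le> B)"

lemma lbd_test_integrable:
  assumes "lbd f" "test_fun \<phi>"
  shows "integrable lborel (\<lambda>x. f x * complex_of_real (\<phi> x))"
proof -
  obtain L where L: "L > 0" "\<forall>x. \<bar>x\<bar> > L \<longrightarrow> \<phi> x = 0" using test_fun_support[OF assms(2)] by blast
  obtain C where C: "\<And>x. \<bar>\<phi> x\<bar> \<le> C" using test_fun_bounded[OF assms(2)] by blast
  obtain B where B: "\<forall>x. \<bar>x\<bar> \<le> L \<longrightarrow> cmod (f x) \<le> B" using assms(1) unfolding lbd_def by blast
  note [measurable] = L2_measurable[OF L2_test_fun[OF assms(2)]]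
  have [measurable]: "f \<in> borel_measurable borel" using assms(1) lbd_def by blast
  show ?thesis
  proof (rule Bochner_Integration.integrable_bound)
    show "integrable lborel (\<lambda>x. (max B 0 * C) * indicator {-L..L} x)" by (simp add: integrable_indicator_Icc)
    have "norm (f x * complex_of_real (\<phi> x)) \<le> norm ((max B 0 * C) * indicator {-L..L} x)" for x
    proof (cases "\<bar>x\<bar> \<le> L")
      case True
      then have "norm (f x * complex_of_real (\<phi> x)) \<le> max B 0 * C"
        unfolding norm_mult norm_of_real using B C[of x] by (intro mult_mono) (auto simp: le_max_iff_disj)
      then show ?thesis using True by (auto simp: indicator_def abs_le_iff)
    next
      case False then show ?thesis using L by simp
    qed
    then show "AE x in lborel. norm (f x * complex_of_real (\<phi> x)) \<le> norm ((max B 0 * C) * indicator {-L..L} x)" by (simp add: integrable_indicator_Icc)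
  qed simp
qed

lemma lbd_smooth_mult:
  assumes "lbd f" "smooth w" shows "lbd (\<lambda>x. complex_of_real (w x) * f x)"
  unfolding lbd_def
proof (intro conjI allI)
  have [measurable]: "f \<in> borel_measurable borel" "w \<in> borel_measurable borel"
    using assms smooth_measurable lbd_def by auto
  show "(\<lambda>x. complex_of_real (w x) * f x) \<in> borel_measurable borel" by measurable
  fix L
  obtain C where C: "\<forall>x\<in>{-L..L}. \<bar>w x\<bar> \<le> C"
    by (rule continuous_on_Icc_bounded[OF smooth_continuous_on[OF assms(2)]])
  obtain B where B: "\<forall>x. \<bar>x\<bar> \<le> L \<longrightarrow> cmod (f x) \<le> B" using assms(1) unfolding lbd_def by blast
  have "cmod (complex_of_real (w x) * f x) \<le> max C 0 * max B 0" if "\<bar>x\<bar> \<le> L" for x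
    unfolding norm_mult norm_of_real using that B C[rule_format, of x] by (intro mult_mono) (auto simp: le_max_iff_disj abs_le_iff)
  then show "\<exists>B. \<forall>x. \<bar>x\<bar> \<le> L \<longrightarrow> cmod (complex_of_real (w x) * f x) \<le> B" by blast
qed

lemma lbd_lincomb:
  assumes "lbd f" "lbd g" shows "lbd (\<lambda>x. a * f x + b * g x)"
  unfolding lbd_def
proof (intro conjI allI)
  have [measurable]: "f \<in> borel_measurable borel" "g \<in> borel_measurable borel"
    using assms lbd_def by auto
  show "(\<lambda>x. a * f x + b * g x) \<in> borel_measurable borel" by measurable
  fix L
  obtain B where B: "\<forall>x. \<bar>x\<bar> \<le> L \<longrightarrow> cmod (f x) \<le> B" using assms(1) unfolding lbd_def by blast
  obtain C where C: "\<forall>x. \<bar>x\<bar> \<le> L \<longrightarrow> cmod (g x) \<le> C" using assms(2) unfolding lbd_def by blast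
  have "cmod (a * f x + b * g x) \<le> cmod a * B + cmod b * C" if "\<bar>x\<bar> \<le> L" for x
    using that B C by (intro order_trans[OF norm_triangle_ineq] add_mono) (auto simp: norm_mult intro!: mult_left_mono)
  then show "\<exists>B. \<forall>x. \<bar>x\<bar> \<le> L \<longrightarrow> cmod (a * f x + b * g x) \<le> B" by blast
qed

lemma weak_deriv_add:
  assumes "weak_deriv k f g" "weak_deriv k f' g'" "lbd f" "lbd f'" "lbd g" "lbd g'"
  shows "weak_deriv k (\<lambda>x. f x + f' x) (\<lambda>x. g x + g' x)"
  unfolding weak_deriv_def
proof (intro allI impI)
  fix \<phi> assume t: "test_fun \<phi>"
  note i = lbd_test_integrable[OF _ t] and j = lbd_test_integrable[OF _ test_fun_higher_deriv[OF t, of k]]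
  show "(LINT x|lborel. (g x + g' x) * \<phi> x) = (-1)^k * (LINT x|lborel. (f x + f' x) * (deriv ^^ k) \<phi> x)"
    using assms(1,2) t i[OF assms(5)] i[OF assms(6)] j[OF assms(3)] j[OF assms(4)]
    by (simp add: distrib_right weak_deriv_def distrib_left)
qed

text \<open>Test the weak derivative of \<open>f\<close> against \<open>w \<phi>\<close>, which is
  again a test function, and split the derivative of this product.\<close>

lemma weak_deriv_smooth_mult:
  assumes fg: "weak_deriv 1 f g" and "lbd f" "lbd g" "smooth w"
  shows "weak_deriv 1 (\<lambda>x. complex_of_real (w x) * f x) (\<lambda>x. complex_of_real (w x) * g x + complex_of_real (deriv w x) * f x)"
  unfolding weak_deriv_def
proof (intro allI impI)
  fix \<phi> assume t: "test_fun \<phi>"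
  have tw: "test_fun (\<lambda>x. w x * \<phi> x)" by (rule test_fun_mult[OF assms(4) t])
  have dw: "deriv (\<lambda>x. w x * \<phi> x) x = deriv w x * \<phi> x + w x * deriv \<phi> x" for x
    by (rule DERIV_imp_deriv)
       (use smooth_DERIV[OF assms(4)] smooth_DERIV[of \<phi>] t test_fun_iff in \<open>auto intro!: DERIV_mult'[THEN DERIV_cong] simp: algebra_simps\<close>)
  have i1: "integrable lborel (\<lambda>x. g x * complex_of_real (w x * \<phi> x))" by (rule lbd_test_integrable[OF assms(3) tw])
  have i2: "integrable lborel (\<lambda>x. f x * complex_of_real (deriv w x * \<phi> x))"
    by (rule lbd_test_integrable[OF assms(2) test_fun_mult[OF smooth_deriv[OF assms(4)] t]])
  have i3: "integrable lborel (\<lambda>x. f x * complex_of_real (w x * deriv \<phi> x))"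
    by (rule lbd_test_integrable[OF assms(2) test_fun_mult[OF assms(4) test_fun_deriv[OF t]]])
  have "(LINT x|lborel. (w x * g x + deriv w x * f x) * \<phi> x)
      = (LINT x|lborel. g x * complex_of_real (w x * \<phi> x) + f x * complex_of_real (deriv w x * \<phi> x))"
    by (rule Bochner_Integration.integral_cong) (auto simp: algebra_simps)
  also have "\<dots> = (LINT x|lborel. g x * complex_of_real (w x * \<phi> x)) + (LINT x|lborel. f x * complex_of_real (deriv w x * \<phi> x))"
    by (rule Bochner_Integration.integral_add[OF i1 i2])
  also have "(LINT x|lborel. g x * complex_of_real (w x * \<phi> x)) = - (LINT x|lborel. f x * complex_of_real (deriv w x * \<phi> x + w x * deriv \<phi> x))"
    using fg[unfolded weak_deriv_def, rule_format, OF tw] by (simp add: dw)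
  also have "(LINT x|lborel. f x * complex_of_real (deriv w x * \<phi> x + w x * deriv \<phi> x)) =
      (LINT x|lborel. f x * complex_of_real (deriv w x * \<phi> x)) + (LINT x|lborel. f x * complex_of_real (w x * deriv \<phi> x))"
    unfolding of_real_add distrib_left by (rule Bochner_Integration.integral_add[OF i2 i3])
  also have "(LINT x|lborel. f x * complex_of_real (w x * deriv \<phi> x)) = (LINT x|lborel. (w x * f x) * deriv \<phi> x)"
    by (rule Bochner_Integration.integral_cong) (auto simp: algebra_simps)
  finally show "(LINT x|lborel. (w x * g x + deriv w x * f x) * \<phi> x) =
      (-1)^1 * (LINT x|lborel. (w x * f x) * (deriv ^^ 1) \<phi> x)" by simp
qed

text \<open>The error \<open>e\<close> collects the Leibniz terms that contain a derivative of
  \<open>w\<close>, so it lives in \<open>S\<close>. Its bound obeys the recursion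
  \<open>b (n + 1) = 2 b n + M B\<close> with \<open>b 0 = 0\<close>, which is solved by
  \<open>(2^n - 1) M B\<close>.\<close>

lemma weak_deriv_cutoff:
  assumes "smooth w" "\<And>l x. l \<le> n \<Longrightarrow> \<bar>(deriv ^^ l) w x\<bar> \<le> M" "\<And>x. x \<notin> S \<Longrightarrow> deriv w x = 0" "open (- S)"
    "\<And>l. l \<le> n \<Longrightarrow> lbd (d l)" "\<And>l x. l \<le> n \<Longrightarrow> x \<in> S \<Longrightarrow> cmod (d l x) \<le> B"
    "\<And>l. l < n \<Longrightarrow> weak_deriv 1 (d l) (d (Suc l))" "0 \<le> B" "0 \<le> M"
  shows "\<exists>e. lbd e \<and> weak_deriv n (\<lambda>x. complex_of_real (w x) * d 0 x) (\<lambda>x. complex_of_real (w x) * d n x + e x) \<and>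
     (\<forall>x. cmod (e x) \<le> (2^n - 1) * (M * B)) \<and> (\<forall>x. x \<notin> S \<longrightarrow> e x = 0)"
  using assms
proof (induction n arbitrary: w d)
  case 0
  then show ?case by (intro exI[of _ "\<lambda>_. 0"]) (auto simp: weak_deriv_0 lbd_def intro: exI[of _ 0])
next
  case (Suc n)
  have dw0: "deriv (deriv w) x = 0" if "x \<notin> S" for x
    using deriv_zero_outside[of "- S" "deriv w" 0 x] Suc.prems(3,4) that by auto
  have lw: "(deriv ^^ l) (deriv w) = (deriv ^^ Suc l) w" for l by (simp add: funpow_Suc_right del: funpow.simps)
  \<comment> \<open>One derivative turns \<open>w d_0\<close> into \<open>w d_1 + w' d_0\<close>.
    The induction hypothesis treats the first term with the shifted chain and the second with
    \<open>w'\<close> as the cut-off.\<close>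
  obtain e1 where e1: "lbd e1" "weak_deriv n (\<lambda>x. complex_of_real (w x) * d 1 x) (\<lambda>x. complex_of_real (w x) * d (Suc n) x + e1 x)"
      "\<forall>x. cmod (e1 x) \<le> (2^n - 1) * (M * B)" "\<forall>x. x \<notin> S \<longrightarrow> e1 x = 0"
    using Suc.IH[of w "\<lambda>l. d (Suc l)"] Suc.prems by auto
  obtain e2 where e2: "lbd e2" "weak_deriv n (\<lambda>x. complex_of_real (deriv w x) * d 0 x) (\<lambda>x. complex_of_real (deriv w x) * d n x + e2 x)"
      "\<forall>x. cmod (e2 x) \<le> (2^n - 1) * (M * B)" "\<forall>x. x \<notin> S \<longrightarrow> e2 x = 0"
    using Suc.IH[of "deriv w" d] Suc.prems dw0 smooth_deriv[OF Suc.prems(1)] by (auto simp: lw simp del: funpow.simps)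
  define e where "e x = e1 x + (complex_of_real (deriv w x) * d n x + e2 x)" for x
  note L = lbd_lincomb[where a=1 and b=1, simplified]
  have ld: "lbd (\<lambda>x. complex_of_real (w x) * d l x)" "lbd (\<lambda>x. complex_of_real (deriv w x) * d l x)" if "l \<le> Suc n" for l
    using that Suc.prems(1,5) by (auto intro!: lbd_smooth_mult smooth_deriv)
  have "weak_deriv n (\<lambda>x. complex_of_real (w x) * d 1 x + complex_of_real (deriv w x) * d 0 x)
     (\<lambda>x. (complex_of_real (w x) * d (Suc n) x + e1 x) + (complex_of_real (deriv w x) * d n x + e2 x))"
    by (intro weak_deriv_add e1 e2 L ld) auto
  then have wd: "weak_deriv n (\<lambda>x. complex_of_real (w x) * d 1 x + complex_of_real (deriv w x) * d 0 x)
     (\<lambda>x. complex_of_real (w x) * d (Suc n) x + e x)" by (simp add: e_def add.assoc)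
  have w1: "weak_deriv 1 (\<lambda>x. complex_of_real (w x) * d 0 x) (\<lambda>x. complex_of_real (w x) * d 1 x + complex_of_real (deriv w x) * d 0 x)"
    using Suc.prems by (intro weak_deriv_smooth_mult) auto
  have "cmod (e x) \<le> (2^Suc n - 1) * (M * B)" for x
  proof -
    have "cmod (complex_of_real (deriv w x) * d n x) \<le> M * B"
    proof (cases "x \<in> S")
      case True
      then show ?thesis unfolding norm_mult norm_of_real using Suc.prems(2)[of 1 x] Suc.prems(6)[of n x] Suc.prems(9)
        by (intro mult_mono) auto
    qed (use Suc.prems in auto)
    moreover have "cmod (e x) \<le> cmod (e1 x) + (cmod (complex_of_real (deriv w x) * d n x) + cmod (e2 x))"
      unfolding e_def by (rule order_trans[OF norm_triangle_ineq add_left_mono[OF norm_triangle_ineq]])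
    ultimately have "cmod (e x) \<le> (2^n - 1) * (M * B) + (M * B + (2^n - 1) * (M * B))"
      using e1(3) e2(3) by (smt (verit))
    then show ?thesis by (simp add: algebra_simps)
  qed
  moreover have "lbd e" unfolding e_def by (intro L ld e1 e2) auto
  moreover have "e x = 0" if "x \<notin> S" for x using that e1 e2 Suc.prems(3) by (simp add: e_def)
  ultimately show ?case using weak_deriv_Suc[OF w1 wd] by blast
qed

section \<open>The unitary group\<close>

text \<open>There is no conjugation, so complex spectral parameters and coefficients pass through
  either argument unchanged; \<open>D\<^sup>2\<^sup>m + V\<close> has real coefficients and even
  order and is formally symmetric for this pairing too.\<close>

definition bil :: "(real \<Rightarrow> complex) \<Rightarrow> (real \<Rightarrow> complex) \<Rightarrow> complex" where
  "bil f g = (LINT x|lborel. f x * g x)"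

lemma bil_commute: "bil f g = bil g f"
  by (simp add: bil_def mult.commute)

lemma bil_bound: "L2 f \<Longrightarrow> L2 g \<Longrightarrow> cmod (bil f g) \<le> L2norm f * L2norm g"
  unfolding bil_def by (rule L2_Cauchy_Schwarz)

lemma bil_lincomb:
  assumes "L2 f" "L2 g" "L2 h"
  shows "bil f (\<lambda>x. a * g x + b * h x) = a * bil f g + b * bil f h"
proof -
  have "bil f (\<lambda>x. a * g x + b * h x) = (LINT x|lborel. a * (f x * g x) + b * (f x * h x))"
    unfolding bil_def by (rule Bochner_Integration.integral_cong) (auto simp: algebra_simps)
  also have "\<dots> = a * bil f g + b * bil f h" unfolding bil_def
    using L2_mult_integrable[OF assms(1,2)] L2_mult_integrable[OF assms(1,3)] by simp
  finally show ?thesis .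
qed

lemma bil_lincomb_left:
  assumes "L2 f" "L2 g" "L2 h"
  shows "bil (\<lambda>x. a * g x + b * h x) f = a * bil g f + b * bil h f"
  using bil_lincomb[OF assms] by (simp add: bil_commute[of f])

lemma bil_cong_ae:
  assumes "L2 f" "L2 g" "L2 f'" "L2 g'" "ae_eq f f'" "ae_eq g g'"
  shows "bil f g = bil f' g'"
  unfolding bil_def
proof (rule integral_cong_AE)
  note [measurable] = assms(1-4)[THEN L2_measurable]
  show "(\<lambda>x. f x * g x) \<in> borel_measurable lborel" "(\<lambda>x. f' x * g' x) \<in> borel_measurable lborel" by measurable
  show "AE x in lborel. f x * g x = f' x * g' x"
    using assms(5,6) unfolding ae_eq_def by eventually_elim simp
qed

lemma ae_eq_refl: "ae_eq f f" and ae_eq_sym: "ae_eq f g \<Longrightarrow> ae_eq g f"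
  by (auto simp: ae_eq_def)

lemma ae_eq_trans: "ae_eq f g \<Longrightarrow> ae_eq g h \<Longrightarrow> ae_eq f h"
  unfolding ae_eq_def by (elim AE_mp) auto

lemma L2norm_sq_bil: "complex_of_real ((L2norm f)^2) = bil f (\<lambda>x. cnj (f x))"
  unfolding L2norm_sq bil_def complex_norm_square[symmetric] 
  by (rule integral_complex_of_real[symmetric])

lemma L2norm_sq_add:
  assumes "L2 f" "L2 g"
  shows "(L2norm (\<lambda>x. 1 * f x + c * g x))^2 = (L2norm f)^2 + (cmod c)^2 * (L2norm g)^2 + 2 * Re (cnj c * bil f (\<lambda>x. cnj (g x)))"
proof -
  note L = assms L2_cnj[OF assms(1)] L2_cnj[OF assms(2)]
  have sw: "bil g (\<lambda>x. cnj (f x)) = cnj (bil f (\<lambda>x. cnj (g x)))"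
    unfolding bil_def by (subst Bochner_Integration.integral_cnj[symmetric]) (simp add: mult.commute)
  have "complex_of_real ((L2norm (\<lambda>x. 1 * f x + c * g x))^2) = bil (\<lambda>x. 1 * f x + c * g x) (\<lambda>x. 1 * cnj (f x) + cnj c * cnj (g x))"
    unfolding L2norm_sq_bil by simp
  also have "\<dots> = bil f (\<lambda>x. cnj (f x)) + c * bil g (\<lambda>x. cnj (f x)) + cnj c * bil f (\<lambda>x. cnj (g x)) + c * cnj c * bil g (\<lambda>x. cnj (g x))"
    by (simp only: bil_lincomb[OF L2_lincomb[OF L(1,2)] L(3,4)] bil_lincomb_left[OF L(3) L(1,2)] bil_lincomb_left[OF L(4) L(1,2)])
       (simp add: algebra_simps)
  also have "\<dots> = complex_of_real ((L2norm f)^2 + (cmod c)^2 * (L2norm g)^2) + (cnj c * bil f (\<lambda>x. cnj (g x)) + cnj (cnj c * bil f (\<lambda>x. cnj (g x))))"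
    by (simp only: complex_norm_square[symmetric, of c] L2norm_sq_bil[symmetric] sw of_real_add of_real_mult complex_cnj_mult complex_cnj_cnj ac_simps)
  also have "\<dots> = complex_of_real ((L2norm f)^2 + (cmod c)^2 * (L2norm g)^2 + 2 * Re (cnj c * bil f (\<lambda>x. cnj (g x))))"
    by (subst complex_add_cnj) simp
  finally show ?thesis by (simp only: of_real_eq_iff)
qed

context
  fixes m :: nat and V :: "real \<Rightarrow> real" and U
  assumes grp: "schr_group m V U"
begin

lemma U_L2: "L2 f \<Longrightarrow> L2 (U t f)"
  by (rule grp[unfolded schr_group_def, THEN conjunct1, rule_format])

lemma U_lincomb: "L2 f \<Longrightarrow> L2 g \<Longrightarrow> ae_eq (U t (\<lambda>x. a * f x + b * g x)) (\<lambda>x. a * U t f x + b * U t g x)"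
  by (rule grp[unfolded schr_group_def, THEN conjunct2, THEN conjunct2, THEN conjunct1, rule_format])

lemma U_0: "L2 f \<Longrightarrow> ae_eq (U 0 f) f"
  by (rule grp[unfolded schr_group_def, THEN conjunct2, THEN conjunct2, THEN conjunct2, THEN conjunct1, rule_format])

lemma U_add: "L2 f \<Longrightarrow> ae_eq (U (s + t) f) (U s (U t f))"
  by (rule grp[unfolded schr_group_def, THEN conjunct2, THEN conjunct2, THEN conjunct2, THEN conjunct2, THEN conjunct1, rule_format])

lemma U_norm: "L2 f \<Longrightarrow> L2norm (U t f) = L2norm f"
  by (rule grp[unfolded schr_group_def, THEN conjunct2, THEN conjunct2, THEN conjunct2, THEN conjunct2, THEN conjunct2, THEN conjunct1, rule_format])

lemma U_continuous: "L2 f \<Longrightarrow> ((\<lambda>t. L2norm (\<lambda>x. U t f x - U t0 f x)) \<longlongrightarrow> 0) (at t0)"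
  by (rule grp[unfolded schr_group_def, THEN conjunct2, THEN conjunct2, THEN conjunct2, THEN conjunct2, THEN conjunct2, THEN conjunct2, THEN conjunct1, rule_format])

lemma U_domain: "L2 f \<Longrightarrow> sobolev (2*m) f \<Longrightarrow>
    \<exists>g. L2 g \<and> ((\<lambda>t. L2norm (\<lambda>x. (U t f x - f x) / complex_of_real t - g x)) \<longlongrightarrow> 0) (at 0)"
  by (rule grp[unfolded schr_group_def, THEN conjunct2, THEN conjunct2, THEN conjunct2, THEN conjunct2, THEN conjunct2, THEN conjunct2, THEN conjunct2, THEN conjunct1, rule_format, THEN iffD2])

lemma U_generator: "L2 f \<Longrightarrow> L2 g \<Longrightarrow>
    ((\<lambda>t. L2norm (\<lambda>x. (U t f x - f x) / complex_of_real t - g x)) \<longlongrightarrow> 0) (at 0) \<Longrightarrow>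
    \<exists>h. H_op m V f h \<and> ae_eq g (\<lambda>x. - \<i> * h x)"
  by (rule grp[unfolded schr_group_def, THEN conjunct2, THEN conjunct2, THEN conjunct2, THEN conjunct2, THEN conjunct2, THEN conjunct2, THEN conjunct2, THEN conjunct2, rule_format])

text \<open>Polarisation: the norm of \<open>f + c g\<close> is preserved, and \<open>c = 1\<close>
  and \<open>c = \<i>\<close> recover the real and the imaginary part of the inner product.\<close>

lemma U_unitary:
  assumes "L2 f" "L2 g"
  shows "bil (U t f) (\<lambda>x. cnj (U t g x)) = bil f (\<lambda>x. cnj (g x))"
proof -
  have *: "Re (cnj c * bil (U t f) (\<lambda>x. cnj (U t g x))) = Re (cnj c * bil f (\<lambda>x. cnj (g x)))" for c
  proof -
    have "L2norm (\<lambda>x. 1 * U t f x + c * U t g x) = L2norm (U t (\<lambda>x. 1 * f x + c * g x))"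
      by (rule L2norm_cong_ae[OF L2_lincomb[OF U_L2 U_L2] U_L2[OF L2_lincomb] ae_eq_sym[OF U_lincomb]]; rule assms)
    also have "\<dots> = L2norm (\<lambda>x. 1 * f x + c * g x)" by (intro U_norm L2_lincomb assms)
    finally show ?thesis
      using L2norm_sq_add[OF assms, of c] L2norm_sq_add[OF U_L2[OF assms(1), of t] U_L2[OF assms(2), of t], of c]
      by (simp add: U_norm assms)
  qed
  show ?thesis using *[of 1] *[of "\<i>"] by (simp add: complex_eq_iff)
qed

text \<open>The adjoint of \<open>U t\<close> is \<open>U (-t)\<close>; the conjugations translate
  this from the inner product to the bilinear pairing.\<close>

lemma bil_U_shift:
  assumes "L2 f" "L2 \<phi>"
  shows "bil (U t f) \<phi> = bil f (\<lambda>x. cnj (U (-t) (\<lambda>x. cnj (\<phi> x)) x))"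
proof -
  let ?p = "\<lambda>x. cnj (\<phi> x)"
  note p = L2_cnj[OF assms(2)]
  have "ae_eq (U t (U (-t) ?p)) (U (t + -t) ?p)" by (rule ae_eq_sym[OF U_add[OF p]])
  then have "ae_eq (U t (U (-t) ?p)) ?p" using U_0[OF p] ae_eq_trans by simp
  then have "ae_eq (\<lambda>x. cnj (U t (U (-t) ?p) x)) \<phi>"
    unfolding ae_eq_def by (elim AE_mp) auto
  then have "bil (U t f) (\<lambda>x. cnj (U t (U (-t) ?p) x)) = bil (U t f) \<phi>"
    by (intro bil_cong_ae U_L2 L2_cnj assms p ae_eq_refl)
  then show ?thesis using U_unitary[OF assms(1) U_L2[OF p], of t "-t"] by simp
qed

lemma bil_U_continuous:
  assumes "L2 f" "L2 \<phi>"
  shows "continuous_on S (\<lambda>t. bil (U t f) \<phi>)"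
proof -
  have "isCont (\<lambda>t. bil (U t f) \<phi>) t0" for t0
    unfolding isCont_def
  proof (rule Lim_null[THEN iffD2], rule tendsto_norm_zero_cancel, rule tendsto_sandwich[where f="\<lambda>_. 0"])
    show "((\<lambda>t. L2norm (\<lambda>x. U t f x - U t0 f x) * L2norm \<phi>) \<longlongrightarrow> 0) (at t0)"
      by (intro tendsto_mult_left_zero U_continuous assms)
    have "bil (U t f) \<phi> - bil (U t0 f) \<phi> = bil (\<lambda>x. U t f x - U t0 f x) \<phi>" for t
      using bil_lincomb_left[OF assms(2) U_L2[OF assms(1), of t] U_L2[OF assms(1), of t0], of 1 "-1"] by simp
    then show "\<forall>\<^sub>F t in at t0. norm (bil (U t f) \<phi> - bil (U t0 f) \<phi>) \<le> L2norm (\<lambda>x. U t f x - U t0 f x) * L2norm \<phi>"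
      by (auto intro!: always_eventually bil_bound L2_diff U_L2 assms)
  qed auto
  then show ?thesis by (simp add: continuous_at_imp_continuous_on)
qed

text \<open>Only \<open>L2 f\<close> is available, so the group is moved onto the conjugate of
  \<open>\<phi>\<close>, which lies in the domain of the generator, and the difference quotient is
  taken there.\<close>

lemma bil_U_derivative:
  assumes f: "L2 f" and \<phi>: "sobolev (2*m) \<phi>" and w: "L2 w" "weak_deriv (2*m) \<phi> w"
    and H: "ae_eq H (\<lambda>x. (-1)^m * w x + complex_of_real (V x) * \<phi> x)" and H2: "L2 H"
  shows "((\<lambda>t. bil (U t f) \<phi>) has_vector_derivative - \<i> * bil (U t f) H) (at t)"
proof -
  let ?p = "\<lambda>x. cnj (\<phi> x)"
  have \<phi>2: "L2 \<phi>" using \<phi> by (simp add: sobolev_def)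
  note p = L2_cnj[OF \<phi>2]
  have "sobolev (2*m) ?p" unfolding sobolev_def
  proof (intro conjI allI impI p)
    fix k assume "k \<le> 2*m"
    then obtain g where "L2 g" "weak_deriv k \<phi> g" using \<phi> unfolding sobolev_def by blast
    then show "\<exists>g. L2 g \<and> weak_deriv k ?p g" by (intro exI[of _ "\<lambda>x. cnj (g x)"] conjI L2_cnj weak_deriv_cnj)
  qed
  then obtain g where g: "L2 g" "((\<lambda>t. L2norm (\<lambda>x. (U t ?p x - ?p x) / complex_of_real t - g x)) \<longlongrightarrow> 0) (at 0)"
    using U_domain p by blast
  then obtain h where h: "H_op m V ?p h" "ae_eq g (\<lambda>x. - \<i> * h x)" using U_generator p by blast
  obtain w' where w': "L2 w'" "weak_deriv (2*m) ?p w'" "ae_eq h (\<lambda>x. (-1)^m * w' x + complex_of_real (V x) * ?p x)"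
    using h(1) unfolding H_op_def by blast
  \<comment> \<open>\<open>H_op\<close> yields some weak derivative; uniqueness identifies it with
    the conjugate of the given \<open>w\<close>. As \<open>V\<close> is real, \<open>cnj g\<close>
    then equals \<open>\<i> H\<close>.\<close>
  have "ae_eq w' (\<lambda>x. cnj (w x))"
    by (rule weak_deriv_unique[OF w'(1) L2_cnj[OF w(1)] w'(2) weak_deriv_cnj[OF w(2)]])
  then have gH: "ae_eq (\<lambda>x. cnj (g x)) (\<lambda>x. \<i> * H x)"
    using h(2) w'(3) H unfolding ae_eq_def by eventually_elim simp
  define F where "F = U t f"
  have F: "L2 F" unfolding F_def by (rule U_L2[OF f])
  define q where "q r = (\<lambda>x. (U r ?p x - ?p x) / complex_of_real r)" for r
  have q: "L2 (q r)" for r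
    using L2_lincomb[OF U_L2[OF p, of r] p, of "1 / complex_of_real r" "- 1 / complex_of_real r"]
    by (simp add: q_def diff_divide_distrib)
  have Hb: "bil F (\<lambda>x. cnj (g x)) = \<i> * bil F H"
  proof -
    have "bil F (\<lambda>x. cnj (g x)) = bil F (\<lambda>x. \<i> * H x)"
      by (intro bil_cong_ae F L2_cnj g L2_cmult H2 ae_eq_refl gH)
    then show ?thesis using bil_lincomb[OF F H2 H2, of "\<i>" 0] by simp
  qed
  \<comment> \<open>The remainder of the linear approximation is a pairing with the error of the
    generator's difference quotient at \<open>-s\<close>, so the Cauchy-Schwarz inequality controls
    it.\<close>
  have diff: "bil (U (t + s) f) \<phi> - bil F \<phi> - s *\<^sub>R (- \<i> * bil F H) = - complex_of_real s * bil F (\<lambda>x. cnj (q (-s) x - g x))" 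
    if "s \<noteq> 0" for s
  proof -
    have "bil (U (t + s) f) \<phi> = bil (U s F) \<phi>"
      unfolding F_def using U_add[OF f, of s t] by (intro bil_cong_ae U_L2 f \<phi>2 ae_eq_refl) (simp add: add.commute)
    also have "\<dots> = bil F (\<lambda>x. cnj (U (-s) ?p x))" by (rule bil_U_shift[OF F \<phi>2])
    finally have 1: "bil (U (t + s) f) \<phi> - bil F \<phi> = bil F (\<lambda>x. cnj (U (-s) ?p x)) - bil F \<phi>" by simp
    have "bil F (\<lambda>x. cnj (q (-s) x - g x)) = bil F (\<lambda>x. cnj (q (-s) x)) - bil F (\<lambda>x. cnj (g x))"
      using bil_lincomb[OF F L2_cnj[OF q[of "-s"]] L2_cnj[OF g(1)], of 1 "-1"] by simp
    moreover have "bil F (\<lambda>x. cnj (q (-s) x)) = (-1/complex_of_real s) * (bil F (\<lambda>x. cnj (U (-s) ?p x)) - bil F \<phi>)"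
    proof -
      have "(\<lambda>x. cnj (q (-s) x)) = (\<lambda>x. (-1/complex_of_real s) * cnj (U (-s) ?p x) + (1/complex_of_real s) * \<phi> x)"
        by (auto simp: q_def divide_simps)
      then show ?thesis
        by (simp only: bil_lincomb[OF F L2_cnj[OF U_L2[OF p]] \<phi>2]) (simp add: right_diff_distrib diff_divide_distrib)
    qed
    ultimately show ?thesis using that unfolding 1 Hb by (simp add: field_simps scaleR_conv_of_real)
  qed
  show ?thesis
    unfolding has_vector_derivative_def has_derivative_at F_def[symmetric]
  proof
    show "bounded_linear (\<lambda>s. s *\<^sub>R (- \<i> * bil F H))" by (rule bounded_linear_scaleR_left)
    have lim: "((\<lambda>s. L2norm (\<lambda>x. q (-s) x - g x)) \<longlongrightarrow> 0) (at 0)"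
    proof -
      have "filterlim uminus (at (0::real)) (at 0)"
        by (simp add: filterlim_def filtermap_at_minus)
      then show ?thesis using filterlim_compose[OF g(2), of uminus "at 0"] by (simp add: q_def)
    qed
    show "((\<lambda>s. norm (bil (U (t + s) f) \<phi> - bil F \<phi> - s *\<^sub>R (- \<i> * bil F H)) / norm s) \<longlongrightarrow> 0) (at 0)"
    proof (rule tendsto_sandwich[where f="\<lambda>_. 0"])
      show "((\<lambda>s. L2norm F * L2norm (\<lambda>x. q (-s) x - g x)) \<longlongrightarrow> 0) (at 0)"
        by (rule tendsto_mult_right_zero[OF lim])
      have n: "L2norm (\<lambda>x. cnj (h x)) = L2norm h" for h by (simp add: L2norm_def)
      have "norm (bil (U (t + s) f) \<phi> - bil F \<phi> - s *\<^sub>R (- \<i> * bil F H)) / norm s \<le> L2norm F * L2norm (\<lambda>x. q (-s) x - g x)" if "s \<noteq> 0" for s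
        unfolding diff[OF that] norm_mult
        using bil_bound[OF F L2_cnj[OF L2_diff[OF q[of "-s"] g(1)]]] that n[of "\<lambda>x. q (-s) x - g x"] by simp
      then show "\<forall>\<^sub>F s in at 0. norm (bil (U (t + s) f) \<phi> - bil F \<phi> - s *\<^sub>R (- \<i> * bil F H)) / norm s \<le> L2norm F * L2norm (\<lambda>x. q (-s) x - g x)"
        by (auto simp: eventually_at_filter intro!: always_eventually)
    qed auto
  qed
qed

end

section \<open>Inverting first-order factors\<close>

text \<open>
  \<open>ker True k\<close> and \<open>ker False k\<close> are the fundamental solutions of \<open>D - k\<close> supported on the positive
  and on the negative half-line; the first decays if \<open>Im k > 0\<close>, the second if \<open>Im k < 0\<close>.
\<close>

definition ker :: "bool \<Rightarrow> complex \<Rightarrow> real \<Rightarrow> complex" where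
  "ker b k s = (if b then (if 0 \<le> s then \<i> * exp (\<i> * k * complex_of_real s) else 0)
                else (if s \<le> 0 then - \<i> * exp (\<i> * k * complex_of_real s) else 0))"

lemma ker_measurable [measurable]: "ker b k \<in> borel_measurable borel"
  unfolding ker_def by (cases b) (auto intro!: measurable_If borel_measurable_continuous_onI continuous_intros)

lemma norm_ker: "cmod (ker b k s) = (if b then (if 0 \<le> s then exp (- Im k * s) else 0) else (if s \<le> 0 then exp (- Im k * s) else 0))"
  by (simp add: ker_def norm_mult)

text \<open>The ball of radius \<open>N\<close> in a weighted sup norm. The bound is pointwise
  rather than almost everywhere, so that limits of such functions can be taken at every
  point.\<close>

definition wbd :: "(real \<Rightarrow> real) \<Rightarrow> real \<Rightarrow> (real \<Rightarrow> complex) \<Rightarrow> bool" where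
  "wbd \<omega> N h \<longleftrightarrow> h \<in> borel_measurable borel \<and> (\<forall>x. cmod (h x) \<le> N * \<omega> x)"

lemma wbd_measurable: "wbd \<omega> N h \<Longrightarrow> h \<in> borel_measurable borel"
  and wbd_le: "wbd \<omega> N h \<Longrightarrow> cmod (h x) \<le> N * \<omega> x"
  by (auto simp: wbd_def)

lemma wbd_nonneg: "wbd \<omega> N h \<Longrightarrow> \<omega> x > 0 \<Longrightarrow> 0 \<le> N"
  using wbd_le[of \<omega> N h x] norm_ge_zero[of "h x"] by (smt (verit) mult_neg_pos)

lemma wbd_mono: "wbd \<omega> N h \<Longrightarrow> N \<le> N' \<Longrightarrow> (\<And>x. \<omega> x > 0) \<Longrightarrow> wbd \<omega> N' h"
  unfolding wbd_def by (meson less_imp_le mult_right_mono order_trans)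

lemma wbd_lincomb:
  assumes "wbd \<omega> N f" "wbd \<omega> N' g"
  shows "wbd \<omega> (cmod a * N + cmod b * N') (\<lambda>x. a * f x + b * g x)"
  unfolding wbd_def
proof (intro conjI allI)
  note [measurable] = assms[THEN wbd_measurable]
  show "(\<lambda>x. a * f x + b * g x) \<in> borel_measurable borel" by measurable
  fix x
  have "cmod (a * f x + b * g x) \<le> cmod a * (N * \<omega> x) + cmod b * (N' * \<omega> x)"
    using assms by (intro order_trans[OF norm_triangle_ineq] add_mono) (auto simp: norm_mult wbd_le intro!: mult_left_mono)
  then show "cmod (a * f x + b * g x) \<le> (cmod a * N + cmod b * N') * \<omega> x" by (simp add: algebra_simps)
qed

lemma wbd_lbd:
  assumes "wbd \<omega> N f" "continuous_on UNIV \<omega>" shows "lbd f"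
  unfolding lbd_def
proof (intro conjI allI)
  fix L
  obtain C where C: "\<forall>x\<in>{-L..L}. \<bar>\<omega> x\<bar> \<le> C"
    by (rule continuous_on_Icc_bounded[OF continuous_on_subset[OF assms(2)]]) auto
  have "cmod (f x) \<le> \<bar>N\<bar> * C" if "\<bar>x\<bar> \<le> L" for x
  proof -
    have "cmod (f x) \<le> \<bar>N\<bar> * \<bar>\<omega> x\<bar>" using wbd_le[OF assms(1), of x] abs_ge_self[of "N * \<omega> x"] by (simp add: abs_mult)
    also have "\<dots> \<le> \<bar>N\<bar> * C" using C that by (intro mult_left_mono) (auto simp: abs_le_iff)
    finally show ?thesis .
  qed
  then show "\<exists>B. \<forall>x. \<bar>x\<bar> \<le> L \<longrightarrow> cmod (f x) \<le> B" by blast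
qed (rule wbd_measurable[OF assms(1)])

text \<open>The Schur test: convolution with the kernel has norm at most \<open>M\<close> in the sup norm weighted by \<open>\<omega>\<close>.\<close>

definition adm :: "(real \<Rightarrow> real) \<Rightarrow> real \<Rightarrow> bool \<Rightarrow> complex \<Rightarrow> bool" where
  "adm \<omega> M b k \<longleftrightarrow> (\<forall>x. integrable lborel (\<lambda>y. cmod (ker b k (x - y)) * \<omega> y) \<and>
     (LINT y|lborel. cmod (ker b k (x - y)) * \<omega> y) \<le> M * \<omega> x)"

definition cv :: "bool \<Rightarrow> complex \<Rightarrow> (real \<Rightarrow> complex) \<Rightarrow> real \<Rightarrow> complex" where
  "cv b k h x = (LINT y|lborel. ker b k (x - y) * h y)"

lemma cv_integrable:
  assumes h: "wbd \<omega> N h" and a: "adm \<omega> M b k"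
  shows "integrable lborel (\<lambda>y. ker b k (x - y) * h y)"
proof (rule Bochner_Integration.integrable_bound)
  note [measurable] = wbd_measurable[OF h]
  show "integrable lborel (\<lambda>y. N * (cmod (ker b k (x - y)) * \<omega> y))" using a by (auto simp: adm_def)
  show "(\<lambda>y. ker b k (x - y) * h y) \<in> borel_measurable lborel" by measurable
  have "norm (ker b k (x - y) * h y) \<le> norm (N * (cmod (ker b k (x - y)) * \<omega> y))" for y
  proof -
    have "norm (ker b k (x - y) * h y) \<le> cmod (ker b k (x - y)) * (N * \<omega> y)"
      unfolding norm_mult by (intro mult_left_mono wbd_le[OF h]) auto
    then show ?thesis by (simp add: mult_ac)
  qed
  then show "AE y in lborel. norm (ker b k (x - y) * h y) \<le> norm (N * (cmod (ker b k (x - y)) * \<omega> y))" by simp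
qed

lemma cv_norm_integral:
  assumes h: "wbd \<omega> N h" and a: "adm \<omega> M b k" and N: "0 \<le> N"
  shows "(LINT y|lborel. cmod (ker b k (x - y) * h y)) \<le> N * M * \<omega> x"
proof -
  have "(LINT y|lborel. cmod (ker b k (x - y) * h y)) \<le> (LINT y|lborel. N * (cmod (ker b k (x - y)) * \<omega> y))"
  proof (rule integral_mono)
    show "integrable lborel (\<lambda>y. cmod (ker b k (x - y) * h y))" using cv_integrable[OF h a] by simp
    show "integrable lborel (\<lambda>y. N * (cmod (ker b k (x - y)) * \<omega> y))" using a by (auto simp: adm_def)
    fix y
    have "norm (ker b k (x - y) * h y) \<le> cmod (ker b k (x - y)) * (N * \<omega> y)"
      unfolding norm_mult by (intro mult_left_mono wbd_le[OF h]) auto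
    then show "norm (ker b k (x - y) * h y) \<le> N * (cmod (ker b k (x - y)) * \<omega> y)" by (simp add: mult_ac)
  qed
  also have "\<dots> = N * (LINT y|lborel. cmod (ker b k (x - y)) * \<omega> y)" by simp
  also have "\<dots> \<le> N * (M * \<omega> x)" using a N by (intro mult_left_mono) (auto simp: adm_def)
  finally show ?thesis by (simp add: mult_ac)
qed

lemma cv_wbd:
  assumes h: "wbd \<omega> N h" and a: "adm \<omega> M b k" and N: "0 \<le> N"
  shows "wbd \<omega> (N * M) (cv b k h)"
  unfolding wbd_def
proof (intro conjI allI)
  note [measurable] = wbd_measurable[OF h]
  show "cv b k h \<in> borel_measurable borel" unfolding cv_def by measurable
  fix x
  show "cmod (cv b k h x) \<le> N * M * \<omega> x"
    unfolding cv_def by (rule order_trans[OF integral_norm_bound cv_norm_integral[OF h a N]])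
qed

lemma cv_diff:
  assumes "wbd \<omega> N f" "wbd \<omega> N' g" "adm \<omega> M b k"
  shows "cv b k (\<lambda>x. f x - g x) x = cv b k f x - cv b k g x"
  unfolding cv_def using cv_integrable[OF assms(1,3)] cv_integrable[OF assms(2,3)]
  by (simp add: right_diff_distrib)

lemma lbd_ker: "lbd (\<lambda>x. ker b k (x - y))"
  unfolding lbd_def
proof (intro conjI allI)
  show "(\<lambda>x. ker b k (x - y)) \<in> borel_measurable borel" by measurable
  fix L
  have "cmod (ker b k (x - y)) \<le> exp (\<bar>Im k\<bar> * (L + \<bar>y\<bar>))" if "\<bar>x\<bar> \<le> L" for x
  proof -
    have "- Im k * (x - y) \<le> \<bar>Im k\<bar> * \<bar>x - y\<bar>" using abs_ge_self[of "- Im k * (x - y)"] by (simp add: abs_mult)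
    also have "\<dots> \<le> \<bar>Im k\<bar> * (L + \<bar>y\<bar>)" using that by (intro mult_left_mono) auto
    finally have "- Im k * (x - y) \<le> \<bar>Im k\<bar> * (L + \<bar>y\<bar>)" .
    then have "exp (- Im k * (x - y)) \<le> exp (\<bar>Im k\<bar> * (L + \<bar>y\<bar>))" by (simp only: exp_le_cancel_iff)
    then show ?thesis unfolding norm_ker by auto
  qed
  then show "\<exists>B. \<forall>x. \<bar>x\<bar> \<le> L \<longrightarrow> cmod (ker b k (x - y)) \<le> B" by blast
qed

text \<open>This is \<open>(D - k) ker = \<delta>\<close>, shifted to \<open>y\<close> and tested
  against \<open>\<phi>\<close>: integration by parts on the half-line bounded by \<open>y\<close>
  leaves the boundary value at \<open>y\<close>.\<close>

lemma ker_test_identity: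
  assumes t: "test_fun \<phi>"
  shows "(LINT x|lborel. ker b k (x - y) * complex_of_real (deriv \<phi> x)) =
     - \<i> * complex_of_real (\<phi> y) - \<i> * k * (LINT x|lborel. ker b k (x - y) * complex_of_real (\<phi> x))"
proof -
  have t': "test_fun (deriv \<phi>)" by (rule test_fun_deriv[OF t])
  obtain L where L: "L > 0" "\<forall>x. \<bar>x\<bar> > L \<longrightarrow> \<phi> x = 0" using test_fun_support[OF t] by blast
  obtain L' where L': "L' > 0" "\<forall>x. \<bar>x\<bar> > L' \<longrightarrow> deriv \<phi> x = 0" using test_fun_support[OF t'] by blast
  \<comment> \<open>Beyond \<open>R\<close> both \<open>\<phi>\<close> and its derivative vanish, so
    the interval from \<open>p\<close> to \<open>q\<close> covers the part of the half-line that
    matters, and its outer end gives no boundary term.\<close>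
  define R where "R = L + L' + \<bar>y\<bar>"
  define c where "c = (if b then \<i> else - \<i>)"
  define F where "F x = c * exp (\<i> * k * complex_of_real (x - y)) * complex_of_real (\<phi> x)" for x
  define f where "f x = c * exp (\<i> * k * complex_of_real (x - y)) * (complex_of_real (deriv \<phi> x) + \<i> * k * complex_of_real (\<phi> x))" for x
  define p where "p = (if b then y else - R - 1)"
  define q where "q = (if b then R + 1 else y)"
  have sm: "smooth \<phi>" using t test_fun_iff by blast
  have pq: "p \<le> q" using L(1) L'(1) by (cases b; simp add: p_def q_def R_def; linarith)
  have "(LINT x|lborel. indicator {p..q} x *\<^sub>R f x) = F q - F p"
  proof (rule integral_FTC_atLeastAtMost[OF pq])
    fix x
    have e: "((\<lambda>x. c * exp (\<i> * k * complex_of_real (x - y))) has_vector_derivative c * (\<i> * k * exp (\<i> * k * complex_of_real (x - y)))) (at x within {p..q})"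
    proof -
      have "((\<lambda>z. c * exp (\<i> * k * (z - complex_of_real y))) has_field_derivative c * (\<i> * k * exp (\<i> * k * (complex_of_real x - complex_of_real y)))) (at (complex_of_real x))"
        by (auto intro!: derivative_eq_intros)
      from has_vector_derivative_real_field[OF this] show ?thesis by simp
    qed
    have d: "((\<lambda>x. complex_of_real (\<phi> x)) has_vector_derivative complex_of_real (deriv \<phi> x)) (at x within {p..q})"
      by (rule has_vector_derivative_of_real[OF has_field_derivative_at_within[OF smooth_DERIV[OF sm]]])
    show "(F has_vector_derivative f x) (at x within {p..q})"
      unfolding F_def f_def using has_vector_derivative_mult[OF e d] by (simp add: algebra_simps)
  next
    show "continuous_on {p..q} f" unfolding f_def
      by (intro continuous_intros smooth_continuous_on sm smooth_deriv)
  qed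
  also have "F q - F p = - \<i> * complex_of_real (\<phi> y)"
  proof -
    have "\<phi> (R + 1) = 0" using L(2)[rule_format, of "R + 1"] L(1) L'(1) by (simp add: R_def)
    moreover have "\<phi> (- R - 1) = 0" using L(2)[rule_format, of "- R - 1"] L(1) L'(1) by (simp add: R_def)
    ultimately show ?thesis by (cases b) (simp_all add: F_def p_def q_def c_def)
  qed
  finally have 1: "(LINT x|lborel. indicator {p..q} x *\<^sub>R f x) = - \<i> * complex_of_real (\<phi> y)" .
  have "(LINT x|lborel. indicator {p..q} x *\<^sub>R f x) =
     (LINT x|lborel. ker b k (x - y) * complex_of_real (deriv \<phi> x) + \<i> * k * (ker b k (x - y) * complex_of_real (\<phi> x)))"
  proof (rule Bochner_Integration.integral_cong[OF refl])
    fix x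
    have z: "deriv \<phi> x = 0 \<and> \<phi> x = 0" if "\<bar>x\<bar> > R"
      using that L(2)[rule_format, of x] L'(2)[rule_format, of x] L(1) L'(1) by (simp add: R_def)
    show "indicator {p..q} x *\<^sub>R f x = ker b k (x - y) * complex_of_real (deriv \<phi> x) + \<i> * k * (ker b k (x - y) * complex_of_real (\<phi> x))"
    proof (cases "\<bar>x\<bar> > R")
      case True then show ?thesis using z by (simp add: f_def)
    next
      case False
      then have iff: "x \<in> {p..q} \<longleftrightarrow> (if b then 0 \<le> x - y else x - y \<le> 0)" by (auto simp: p_def q_def)
      have "ker b k (x - y) = indicator {p..q} x * (c * exp (\<i> * k * complex_of_real (x - y)))"
        using iff by (cases b) (simp_all add: ker_def c_def indicator_def)
      then show ?thesis unfolding f_def by (cases "x \<in> {p..q}") (simp_all add: distrib_left)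
    qed
  qed
  also have "\<dots> = (LINT x|lborel. ker b k (x - y) * complex_of_real (deriv \<phi> x)) + \<i> * k * (LINT x|lborel. ker b k (x - y) * complex_of_real (\<phi> x))"
    using lbd_test_integrable[OF lbd_ker t, of b k y] lbd_test_integrable[OF lbd_ker t', of b k y] by simp
  finally have "(LINT x|lborel. ker b k (x - y) * complex_of_real (deriv \<phi> x)) + \<i> * k * (LINT x|lborel. ker b k (x - y) * complex_of_real (\<phi> x)) = - \<i> * complex_of_real (\<phi> y)"
    unfolding 1 by (rule sym)
  then show ?thesis by (rule eq_diff_eq[THEN iffD2])
qed

text \<open>Absolute integrability holds because the inner integral of the modulus is at most
  \<open>N M \<omega> x\<close>, which is continuous and hence integrable against a test function.
  The kernel can then be tested in place of the convolution.\<close>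

lemma cv_test_Fubini:
  assumes h: "wbd \<omega> N h" and a: "adm \<omega> M b k" and N: "0 \<le> N" and t: "test_fun \<phi>" and c: "continuous_on UNIV \<omega>"
  shows "(LINT x|lborel. cv b k h x * complex_of_real (\<phi> x)) = (LINT y|lborel. h y * (LINT x|lborel. ker b k (x - y) * complex_of_real (\<phi> x)))"
    "integrable lborel (\<lambda>y. h y * (LINT x|lborel. ker b k (x - y) * complex_of_real (\<phi> x)))"
proof -
  note [measurable] = wbd_measurable[OF h] L2_measurable[OF L2_test_fun[OF t]]
  define f where "f x y = ker b k (x - y) * h y * complex_of_real (\<phi> x)" for x y
  have m: "case_prod f \<in> borel_measurable (lborel \<Otimes>\<^sub>M lborel)" unfolding f_def by measurable
  have l: "lbd (\<lambda>x. complex_of_real (N * M * \<omega> x))"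
    by (rule wbd_lbd[where N=1 and \<omega>="\<lambda>x. \<bar>N * M * \<omega> x\<bar>"])
       (auto simp: wbd_def norm_mult abs_mult simp del: of_real_mult intro!: borel_measurable_continuous_onI continuous_intros continuous_on_of_real c)
  have int: "integrable (lborel \<Otimes>\<^sub>M lborel) (case_prod f)"
  proof (rule lborel_pair.Fubini_integrable[OF m])
    have i: "integrable lborel (\<lambda>y. f x y)" for x
      unfolding f_def using cv_integrable[OF h a] by (intro integrable_mult_left) auto
    then show "AE x in lborel. integrable lborel (\<lambda>y. case_prod f (x, y))" by simp
    show "integrable lborel (\<lambda>x. LINT y|lborel. norm (case_prod f (x, y)))"
    proof (rule Bochner_Integration.integrable_bound)
      show "integrable lborel (\<lambda>x. complex_of_real (N * M * \<omega> x) * complex_of_real (\<phi> x))"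
        by (rule lbd_test_integrable[OF l t])
      show "(\<lambda>x. LINT y|lborel. norm (case_prod f (x, y))) \<in> borel_measurable lborel"
        using m by measurable
      have "norm (LINT y|lborel. norm (case_prod f (x, y))) \<le> norm (complex_of_real (N * M * \<omega> x) * complex_of_real (\<phi> x))" for x
      proof -
        have "(LINT y|lborel. norm (case_prod f (x, y))) = (LINT y|lborel. cmod (ker b k (x - y) * h y)) * \<bar>\<phi> x\<bar>"
          by (simp add: f_def norm_mult)
        also have "\<dots> \<le> N * M * \<omega> x * \<bar>\<phi> x\<bar>" by (intro mult_right_mono cv_norm_integral[OF h a N]) auto
        finally have "(LINT y|lborel. norm (case_prod f (x, y))) \<le> \<bar>N * M * \<omega> x * \<bar>\<phi> x\<bar>\<bar>" by (meson abs_ge_self order_trans)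
        moreover have "0 \<le> (LINT y|lborel. norm (case_prod f (x, y)))" by simp
        ultimately show ?thesis by (simp add: norm_mult abs_mult)
      qed
      then show "AE x in lborel. norm (LINT y|lborel. norm (case_prod f (x, y))) \<le> norm (complex_of_real (N * M * \<omega> x) * complex_of_real (\<phi> x))" by simp
    qed
  qed
  have e1: "(LINT x|lborel. f x y) = h y * (LINT x|lborel. ker b k (x - y) * complex_of_real (\<phi> x))" for y
  proof -
    have "(LINT x|lborel. f x y) = (LINT x|lborel. h y * (ker b k (x - y) * complex_of_real (\<phi> x)))"
      by (rule Bochner_Integration.integral_cong) (auto simp: f_def)
    then show ?thesis by simp
  qed
  have e2: "(LINT y|lborel. f x y) = cv b k h x * complex_of_real (\<phi> x)" for x
    unfolding f_def cv_def by (rule Bochner_Integration.integral_mult_left_zero)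
  show "(LINT x|lborel. cv b k h x * complex_of_real (\<phi> x)) = (LINT y|lborel. h y * (LINT x|lborel. ker b k (x - y) * complex_of_real (\<phi> x)))"
    using lborel_pair.Fubini_integral[OF int] by (simp add: e1 e2)
  show "integrable lborel (\<lambda>y. h y * (LINT x|lborel. ker b k (x - y) * complex_of_real (\<phi> x)))"
    using lborel_pair.integrable_snd[OF int] by (simp add: e1)
qed

text \<open>By Fubini the identity for the kernel carries over to
  \<open>(D - k) (cv b k h) = h\<close>.\<close>

lemma cv_weak_deriv:
  assumes h: "wbd \<omega> N h" and a: "adm \<omega> M b k" and N: "0 \<le> N" and c: "continuous_on UNIV \<omega>"
  shows "weak_deriv 1 (cv b k h) (\<lambda>x. \<i> * (k * cv b k h x + h x))"
  unfolding weak_deriv_def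
proof (intro allI impI)
  fix \<phi> assume t: "test_fun \<phi>"
  have t': "test_fun (deriv \<phi>)" by (rule test_fun_deriv[OF t])
  note F = cv_test_Fubini[OF h a N t c] and F' = cv_test_Fubini[OF h a N t' c]
  have lh: "integrable lborel (\<lambda>x. h x * complex_of_real (\<phi> x))" by (rule lbd_test_integrable[OF wbd_lbd[OF h c] t])
  have lc: "integrable lborel (\<lambda>x. cv b k h x * complex_of_real (\<phi> x))"
    by (rule lbd_test_integrable[OF wbd_lbd[OF cv_wbd[OF h a N] c] t])
  have "(LINT x|lborel. cv b k h x * complex_of_real (deriv \<phi> x)) =
      (LINT y|lborel. (- \<i>) * (h y * complex_of_real (\<phi> y)) + (- \<i> * k) * (h y * (LINT x|lborel. ker b k (x - y) * complex_of_real (\<phi> x))))"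
    unfolding F'(1) ker_test_identity[OF t] by (simp add: right_diff_distrib mult_ac)
  also have "\<dots> = - \<i> * (LINT y|lborel. h y * complex_of_real (\<phi> y)) + (- \<i> * k) * (LINT x|lborel. cv b k h x * complex_of_real (\<phi> x))"
    unfolding F(1) using lh F(2) by simp
  also have "\<dots> = - (LINT x|lborel. \<i> * k * (cv b k h x * complex_of_real (\<phi> x)) + \<i> * (h x * complex_of_real (\<phi> x)))"
    using lh lc by simp
  also have "(LINT x|lborel. \<i> * k * (cv b k h x * complex_of_real (\<phi> x)) + \<i> * (h x * complex_of_real (\<phi> x))) = (LINT x|lborel. \<i> * (k * cv b k h x + h x) * complex_of_real (\<phi> x))"
    by (rule Bochner_Integration.integral_cong) (auto simp: algebra_simps)
  finally show "(LINT x|lborel. \<i> * (k * cv b k h x + h x) * complex_of_real (\<phi> x)) = (-1)^1 * (LINT x|lborel. cv b k h x * complex_of_real ((deriv ^^ 1) \<phi> x))" by simp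
qed

section \<open>Products of first-order factors and the Neumann series\<close>

text \<open>An inverse of the product of the operators \<open>D - snd p\<close>; the flag
  \<open>fst p\<close> selects the fundamental solution of each factor.\<close>

fun cvs :: "(bool \<times> complex) list \<Rightarrow> (real \<Rightarrow> complex) \<Rightarrow> real \<Rightarrow> complex" where
  "cvs [] h = h"
| "cvs (p # ks) h = cv (fst p) (snd p) (cvs ks h)"

definition char_poly :: "(bool \<times> complex) list \<Rightarrow> complex poly" where
  "char_poly ks = prod_list (map (\<lambda>p. [:- snd p, 1:]) ks)"

lemma degree_char_poly: "degree (char_poly ks) = length ks"
proof (induction ks)
  case (Cons p ks)
  have "char_poly ks \<noteq> 0" unfolding char_poly_def by (auto simp: prod_list_zero_iff)
  then have "degree ([:- snd p, 1:] * char_poly ks) = Suc (length ks)" using Cons by (subst degree_mult_eq) auto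
  then show ?case by (simp only: char_poly_def list.map prod_list.Cons list.size)
qed (simp add: char_poly_def)

lemma weak_deriv_lincomb:
  assumes "weak_deriv k f g" "weak_deriv k f' g'" "lbd f" "lbd f'" "lbd g" "lbd g'"
  shows "weak_deriv k (\<lambda>x. a * f x + b * f' x) (\<lambda>x. a * g x + b * g' x)"
proof -
  have z: "lbd (\<lambda>x. c * h x)" if "lbd h" for c h using lbd_lincomb[OF that that, of c 0] by simp
  have s: "weak_deriv k (\<lambda>x. c * h x) (\<lambda>x. c * h' x)" if "weak_deriv k h h'" for c h h'
    using that unfolding weak_deriv_def by (auto simp: mult.assoc)
  show ?thesis by (intro weak_deriv_add s z assms)
qed

text \<open>
  Iteration for \<open>h = \<zeta> - V (cvs ks h)\<close>.  The limit is taken pointwise so that it does not depend on a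
  weight: the same solution then obeys the bounds for all admissible weights at once.
\<close>

definition nit :: "(bool \<times> complex) list \<Rightarrow> (real \<Rightarrow> real) \<Rightarrow> (real \<Rightarrow> complex) \<Rightarrow> nat \<Rightarrow> real \<Rightarrow> complex" where
  "nit ks V \<zeta> n = ((\<lambda>h x. \<zeta> x - complex_of_real (V x) * cvs ks h x) ^^ n) \<zeta>"

definition neu :: "(bool \<times> complex) list \<Rightarrow> (real \<Rightarrow> real) \<Rightarrow> (real \<Rightarrow> complex) \<Rightarrow> real \<Rightarrow> complex" where
  "neu ks V \<zeta> x = lim (\<lambda>n. nit ks V \<zeta> n x)"

text \<open>
  \<open>d 0\<close> solves \<open>(D\<^sup>2\<^sup>m + V - E) (d 0) = \<zeta>\<close>, and \<open>d l\<close> is its \<open>l\<close>-th weak derivative for \<open>l \<le> 2m\<close>.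
\<close>

definition weak_sol :: "nat \<Rightarrow> (real \<Rightarrow> real) \<Rightarrow> complex \<Rightarrow> (real \<Rightarrow> real) \<Rightarrow> (real \<Rightarrow> complex) \<Rightarrow> (nat \<Rightarrow> real \<Rightarrow> complex) \<Rightarrow> bool" where
  "weak_sol m V E \<omega> \<zeta> d \<longleftrightarrow> (\<forall>l. \<exists>N. wbd \<omega> N (d l)) \<and> (\<forall>l<2*m. weak_deriv 1 (d l) (d (Suc l))) \<and>
     (\<forall>x. (-1)^m * d (2*m) x + complex_of_real (V x) * d 0 x = \<zeta> x + E * d 0 x)"

lemma nit_0 [simp]: "nit ks V \<zeta> 0 = \<zeta>" and
  nit_Suc: "nit ks V \<zeta> (Suc n) = (\<lambda>x. \<zeta> x - complex_of_real (V x) * cvs ks (nit ks V \<zeta> n) x)"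
  by (simp_all add: nit_def)

context
  fixes \<omega> :: "real \<Rightarrow> real" and M :: real and ks :: "(bool \<times> complex) list"
  assumes pos: "\<And>x. \<omega> x > 0" and cont: "continuous_on UNIV \<omega>" and M: "0 \<le> M"
    and adm: "\<And>p. p \<in> set ks \<Longrightarrow> adm \<omega> M (fst p) (snd p)"
begin

lemma cvs_wbd: "wbd \<omega> N h \<Longrightarrow> wbd \<omega> (N * M ^ length ks) (cvs ks h)"
  using adm
proof (induction ks)
  case (Cons p ks)
  have N: "0 \<le> N" using wbd_nonneg[OF Cons.prems(1) pos] .
  have "wbd \<omega> (N * M ^ length ks * M) (cv (fst p) (snd p) (cvs ks h))"
    by (rule cv_wbd) (use Cons N M in auto)
  then show ?case by (simp add: mult_ac)
qed simp

lemma cvs_diff: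
  "wbd \<omega> N f \<Longrightarrow> wbd \<omega> N' g \<Longrightarrow> cvs ks (\<lambda>x. f x - g x) = (\<lambda>x. cvs ks f x - cvs ks g x)"
  using adm
proof (induction ks)
  case (Cons p ks)
  have w: "\<exists>N. wbd \<omega> N (cvs ks h)" if "wbd \<omega> N h" for N h
    using that Cons.prems(3)
  proof (induction ks)
    case (Cons q ks)
    then obtain N' where N': "wbd \<omega> N' (cvs ks h)" by auto
    have "wbd \<omega> (N' * M) (cv (fst q) (snd q) (cvs ks h))"
      by (rule cv_wbd[OF N' _ wbd_nonneg[OF N' pos]]) (use Cons.prems(2) in auto)
    then show ?case by auto
  qed auto
  obtain N1 N2 where "wbd \<omega> N1 (cvs ks f)" "wbd \<omega> N2 (cvs ks g)" using w Cons.prems by blast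
  then show ?case using Cons cv_diff[OF _ _ Cons.prems(3)[of p]] by auto
qed simp

text \<open>For \<open>l \<le> length ks\<close>, \<open>d l\<close> is the \<open>l\<close>-th weak
  derivative of \<open>cvs ks h\<close>. The last equation applies the polynomial
  \<open>char_poly ks\<close> to \<open>D\<close>, since \<open>D\<^sup>l\<close> is
  \<open>(-\<i>)\<^sup>l\<close> times the \<open>l\<close>-th derivative.\<close>

lemma cvs_chain:
  assumes "wbd \<omega> N h"
  shows "\<exists>d. d 0 = cvs ks h \<and> (\<forall>l. \<exists>N. wbd \<omega> N (d l)) \<and> (\<forall>l<length ks. weak_deriv 1 (d l) (d (Suc l))) \<and>
     (\<forall>x. (\<Sum>l\<le>length ks. coeff (char_poly ks) l * (- \<i>)^l * d l x) = h x)"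
  using assms adm
proof (induction ks)
  case Nil
  then show ?case by (intro exI[of _ "\<lambda>_. h"]) (auto simp: char_poly_def)
next
  case (Cons p ks)
  then obtain d where d: "d 0 = cvs ks h" "\<And>l. \<exists>N. wbd \<omega> N (d l)" "\<And>l. l < length ks \<Longrightarrow> weak_deriv 1 (d l) (d (Suc l))"
     "\<And>x. (\<Sum>l\<le>length ks. coeff (char_poly ks) l * (- \<i>)^l * d l x) = h x" by auto
  define k where "k = snd p"
  \<comment> \<open>Inverting \<open>D - k\<close> on \<open>d 0\<close> means that the derivative
    of \<open>e 0\<close> is \<open>\<i> (k e 0 + d 0)\<close>; the same recursion gives the higher
    derivatives.\<close>
  define e where "e = rec_nat (cv (fst p) k (d 0)) (\<lambda>l el x. \<i> * (k * el x + d l x))"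
  have e0: "e 0 = cv (fst p) k (d 0)" and eS: "e (Suc l) = (\<lambda>x. \<i> * (k * e l x + d l x))" for l
    by (simp_all add: e_def)
  have ap: "adm \<omega> M (fst p) k" using Cons.prems(2)[of p] by (simp add: k_def)
  obtain N0 where N0: "wbd \<omega> N0 (d 0)" using d(2) by blast
  have N0': "0 \<le> N0" by (rule wbd_nonneg[OF N0 pos])
  have ew: "\<exists>N. wbd \<omega> N (e l)" for l
  proof (induction l)
    case 0 then show ?case using cv_wbd[OF N0 ap N0'] e0 by auto
  next
    case (Suc l)
    then obtain A B where "wbd \<omega> A (e l)" "wbd \<omega> B (d l)" using d(2) by blast
    from wbd_lincomb[OF this, of "\<i> * k" "\<i>"] show ?case unfolding eS by (auto simp: algebra_simps)
  qed
  have le: "lbd (e l)" "lbd (d l)" for l using ew d(2) wbd_lbd[OF _ cont] by blast+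
  have ewd: "weak_deriv 1 (e l) (e (Suc l))" if "l < Suc (length ks)" for l
    using that
  proof (induction l)
    case 0 show ?case unfolding eS unfolding e0 by (rule cv_weak_deriv[OF N0 ap N0' cont])
  next
    case (Suc l)
    then have "weak_deriv 1 (\<lambda>x. (\<i> * k) * e l x + \<i> * d l x) (\<lambda>x. (\<i> * k) * e (Suc l) x + \<i> * d (Suc l) x)"
      by (intro weak_deriv_lincomb le d(3)) auto
    then show ?case unfolding eS[of l] eS[of "Suc l"] by (simp add: algebra_simps)
  qed
  let ?q = "char_poly ks" and ?n = "length ks"
  have cp: "char_poly (p # ks) = pCons 0 ?q - smult k ?q" by (simp add: char_poly_def k_def)
  have "(\<Sum>l\<le>Suc ?n. coeff (char_poly (p # ks)) l * (- \<i>)^l * e l x) = h x" for x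
  proof -
    have "(\<Sum>l\<le>Suc ?n. coeff (char_poly (p # ks)) l * (- \<i>)^l * e l x) =
       (\<Sum>l\<le>Suc ?n. coeff (pCons 0 ?q) l * (- \<i>)^l * e l x) - (\<Sum>l\<le>Suc ?n. k * coeff ?q l * (- \<i>)^l * e l x)"
      unfolding cp by (simp add: left_diff_distrib sum_subtractf del: sum.atMost_Suc)
    also have "(\<Sum>l\<le>Suc ?n. coeff (pCons 0 ?q) l * (- \<i>)^l * e l x) = (\<Sum>l\<le>?n. coeff ?q l * (- \<i>)^Suc l * e (Suc l) x)"
      by (subst sum.atMost_Suc_shift) simp
    also have "(\<Sum>l\<le>Suc ?n. k * coeff ?q l * (- \<i>)^l * e l x) = (\<Sum>l\<le>?n. k * coeff ?q l * (- \<i>)^l * e l x)"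
      by (simp add: coeff_eq_0 degree_char_poly)
    also have "(\<Sum>l\<le>?n. coeff ?q l * (- \<i>)^Suc l * e (Suc l) x) - (\<Sum>l\<le>?n. k * coeff ?q l * (- \<i>)^l * e l x)
       = (\<Sum>l\<le>?n. coeff ?q l * (- \<i>)^l * d l x)"
    proof -
      \<comment> \<open>The recursion says \<open>- \<i> e (Suc l) - k e l = d l\<close>, so the sum
        for \<open>(X - k) q\<close> collapses to the one for \<open>q\<close>.\<close>
      have s: "coeff ?q l * (- \<i>)^Suc l * e (Suc l) x - k * coeff ?q l * (- \<i>)^l * e l x = coeff ?q l * (- \<i>)^l * d l x" for l
      proof -
        have "(- \<i>)^Suc l * e (Suc l) x = (- \<i>)^l * (k * e l x + d l x)"
        proof -
          have "(- \<i>)^Suc l * e (Suc l) x = (- \<i>)^l * ((- \<i>) * (\<i> * (k * e l x + d l x)))"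
            unfolding eS by (simp only: power_Suc2 mult.assoc)
          then show ?thesis by simp
        qed
        then show ?thesis by (simp add: algebra_simps del: power_Suc)
      qed
      show ?thesis unfolding sum_subtractf[symmetric] s ..
    qed
    finally show ?thesis using d(4) by simp
  qed
  then show ?case using e0 d(1) ew ewd by (intro exI[of _ e]) (simp add: k_def del: sum.atMost_Suc)
qed

context
  fixes V :: "real \<Rightarrow> real" and v :: real
  assumes V: "V \<in> borel_measurable borel" "\<And>x. \<bar>V x\<bar> \<le> v" and vM: "v * M ^ length ks \<le> 1/2"
begin

lemma V_wbd: "wbd \<omega> N h \<Longrightarrow> wbd \<omega> (v * N) (\<lambda>x. complex_of_real (V x) * h x)"
proof -
  assume h: "wbd \<omega> N h"
  note [measurable] = wbd_measurable[OF h] V(1)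
  show ?thesis unfolding wbd_def
  proof (intro conjI allI)
    show "(\<lambda>x. complex_of_real (V x) * h x) \<in> borel_measurable borel" by measurable
    fix x
    have "\<bar>V x\<bar> * cmod (h x) \<le> v * (N * \<omega> x)"
      using V(2)[of x] wbd_le[OF h] by (intro mult_mono) (auto intro: order_trans[OF abs_ge_zero])
    then show "cmod (complex_of_real (V x) * h x) \<le> v * N * \<omega> x" by (simp add: norm_mult mult.assoc)
  qed
qed

context
  fixes \<zeta> :: "real \<Rightarrow> complex" and N :: real
  assumes \<zeta>: "wbd \<omega> N \<zeta>"
begin

text \<open>The iterated map is affine with linear part \<open>- V cvs\<close>, of weighted norm at
  most \<open>v M ^ length ks \<le> 1/2\<close>, so the differences of consecutive iterates halve at
  each step.\<close>

lemma nit_step: "(\<exists>N'. wbd \<omega> N' (nit ks V \<zeta> n)) \<and> wbd \<omega> (N / 2^Suc n) (\<lambda>x. nit ks V \<zeta> (Suc n) x - nit ks V \<zeta> n x)"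
proof (induction n)
  case 0
  have N: "0 \<le> N" by (rule wbd_nonneg[OF \<zeta> pos])
  have a: "wbd \<omega> (v * (N * M ^ length ks)) (\<lambda>x. complex_of_real (V x) * cvs ks \<zeta> x)"
    by (rule V_wbd[OF cvs_wbd[OF \<zeta>]])
  have "v * (N * M ^ length ks) \<le> N / 2" using mult_left_mono[OF vM N] by (simp add: mult_ac)
  from wbd_mono[OF wbd_lincomb[OF a a, of "-1" 0], of "N/2"] this pos
  show ?case using \<zeta> by (auto simp: nit_Suc)
next
  case (Suc n)
  let ?x = "nit ks V \<zeta>"
  obtain N' where N': "wbd \<omega> N' (?x n)" using Suc by blast
  have d: "wbd \<omega> (N / 2^Suc n) (\<lambda>x. ?x (Suc n) x - ?x n x)" using Suc by blast
  have N2: "0 \<le> N / 2^Suc n" by (rule wbd_nonneg[OF d pos])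
  have S: "wbd \<omega> (N / 2^Suc n + N') (?x (Suc n))" using wbd_lincomb[OF d N', of 1 1] by simp
  have a: "wbd \<omega> (v * (N / 2^Suc n * M ^ length ks)) (\<lambda>x. complex_of_real (V x) * cvs ks (\<lambda>x. ?x (Suc n) x - ?x n x) x)"
    by (rule V_wbd[OF cvs_wbd[OF d]])
  have le: "v * (N / 2^Suc n * M ^ length ks) \<le> N / 2^Suc (Suc n)" using mult_left_mono[OF vM N2] by (simp add: mult_ac)
  have e: "?x (Suc (Suc n)) x - ?x (Suc n) x = - (complex_of_real (V x) * cvs ks (\<lambda>x. ?x (Suc n) x - ?x n x) x)" for x
    unfolding cvs_diff[OF S N'] by (subst (1 2) nit_Suc) (simp add: algebra_simps)
  show ?case
    using S wbd_mono[OF wbd_lincomb[OF a a, of "-1" 0], of "N / 2^Suc (Suc n)"] le pos unfolding e by auto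
qed

lemma nit_diff_bound: "cmod (nit ks V \<zeta> (n + j) x - nit ks V \<zeta> n x) \<le> N * \<omega> x * (1 / 2^n - 1 / 2^(n + j))"
proof (induction j)
  case (Suc j)
  have "cmod (nit ks V \<zeta> (Suc (n + j)) x - nit ks V \<zeta> (n + j) x) \<le> N / 2^Suc (n + j) * \<omega> x"
    using nit_step wbd_le by blast
  moreover have "nit ks V \<zeta> (n + Suc j) x - nit ks V \<zeta> n x = (nit ks V \<zeta> (Suc (n + j)) x - nit ks V \<zeta> (n + j) x) + (nit ks V \<zeta> (n + j) x - nit ks V \<zeta> n x)" by simp
  ultimately have "cmod (nit ks V \<zeta> (n + Suc j) x - nit ks V \<zeta> n x) \<le> N / 2^Suc (n + j) * \<omega> x + N * \<omega> x * (1 / 2^n - 1 / 2^(n + j))"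
    using Suc norm_triangle_ineq order_trans by (smt (verit))
  also have "\<dots> = N * \<omega> x * (1 / 2^n - 1 / 2^(n + Suc j))" by (simp add: field_simps)
  finally show ?case .
qed simp

lemma nit_diff_bound': "cmod (nit ks V \<zeta> (n + j) x - nit ks V \<zeta> n x) \<le> N * \<omega> x / 2^n"
proof -
  have "0 \<le> N * \<omega> x" using wbd_nonneg[OF \<zeta> pos] pos[of x] by simp
  then have "N * \<omega> x * (1 / 2^n - 1 / 2^(n + j)) \<le> N * \<omega> x * (1 / 2^n)" by (intro mult_left_mono) auto
  then show ?thesis using nit_diff_bound[of n j x] by simp
qed

lemma pow_half_tendsto_0: "(\<lambda>n. C / 2^n) \<longlonglongrightarrow> (0::real)"
  using tendsto_mult[OF tendsto_const LIMSEQ_power_zero[of "1/2::real"], of C] by (simp add: power_divide)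

lemma neu_tendsto: "(\<lambda>n. nit ks V \<zeta> n x) \<longlonglongrightarrow> neu ks V \<zeta> x"
proof -
  have "Cauchy (\<lambda>n. nit ks V \<zeta> n x)"
  proof (rule CauchyI')
    fix e :: real assume e: "0 < e"
    have "eventually (\<lambda>n. N * \<omega> x / 2^n < e) sequentially"
      using order_tendstoD(2)[OF pow_half_tendsto_0 e] .
    then obtain n0 where n0: "\<And>n. n \<ge> n0 \<Longrightarrow> N * \<omega> x / 2^n < e" by (auto simp: eventually_sequentially)
    show "\<exists>M. \<forall>m\<ge>M. \<forall>n>m. dist (nit ks V \<zeta> m x) (nit ks V \<zeta> n x) < e"
    proof (intro exI[of _ n0] allI impI)
      fix m n assume mn: "n0 \<le> m" "m < n"
      then show "dist (nit ks V \<zeta> m x) (nit ks V \<zeta> n x) < e"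
        using nit_diff_bound'[of m "n - m" x] n0[of m] by (simp add: dist_norm norm_minus_commute)
    qed
  qed
  then have "convergent (\<lambda>n. nit ks V \<zeta> n x)" by (rule Cauchy_convergent)
  then show ?thesis unfolding neu_def by (simp add: convergent_LIMSEQ_iff)
qed

lemma neu_nit_wbd: "wbd \<omega> (N / 2^n) (\<lambda>x. neu ks V \<zeta> x - nit ks V \<zeta> n x)"
  unfolding wbd_def
proof (intro conjI allI)
  have [measurable]: "nit ks V \<zeta> n \<in> borel_measurable borel" for n using nit_step wbd_measurable by blast
  show "(\<lambda>x. neu ks V \<zeta> x - nit ks V \<zeta> n x) \<in> borel_measurable borel" unfolding neu_def by measurable
  fix x
  have "(\<lambda>j. cmod (nit ks V \<zeta> (n + j) x - nit ks V \<zeta> n x)) \<longlonglongrightarrow> cmod (neu ks V \<zeta> x - nit ks V \<zeta> n x)"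
    using LIMSEQ_ignore_initial_segment[OF neu_tendsto, of n x] by (intro tendsto_intros) (simp add: add.commute)
  then show "cmod (neu ks V \<zeta> x - nit ks V \<zeta> n x) \<le> N / 2^n * \<omega> x"
    by (rule Lim_bounded) (use nit_diff_bound' in \<open>simp add: mult_ac\<close>)
qed

lemma neu_wbd: "wbd \<omega> (2 * N) (neu ks V \<zeta>)"
  using wbd_lincomb[OF neu_nit_wbd[of 0] \<zeta>, of 1 1] by simp

text \<open>\<open>cvs\<close> is continuous for the weighted norm, so the recursion of the iterates
  passes to the limit.\<close>

lemma neu_eq: "neu ks V \<zeta> x = \<zeta> x - complex_of_real (V x) * cvs ks (neu ks V \<zeta>) x"
proof -
  have "(\<lambda>n. cvs ks (nit ks V \<zeta> n) x) \<longlonglongrightarrow> cvs ks (neu ks V \<zeta>) x"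
  proof -
    have "cmod (cvs ks (nit ks V \<zeta> n) x - cvs ks (neu ks V \<zeta>) x) \<le> (N * M ^ length ks * \<omega> x) / 2^n" for n
    proof -
      obtain N' where N': "wbd \<omega> N' (nit ks V \<zeta> n)" using nit_step by blast
      have "cmod (cvs ks (\<lambda>x. neu ks V \<zeta> x - nit ks V \<zeta> n x) x) \<le> N / 2^n * M ^ length ks * \<omega> x"
        by (rule wbd_le[OF cvs_wbd[OF neu_nit_wbd]])
      then show ?thesis unfolding cvs_diff[OF neu_wbd N'] by (simp add: norm_minus_commute)
    qed
    then have "\<forall>\<^sub>F n in sequentially. cmod (cvs ks (nit ks V \<zeta> n) x - cvs ks (neu ks V \<zeta>) x) \<le> (N * M ^ length ks * \<omega> x) / 2^n" by simp
    from Lim_null_comparison[OF this pow_half_tendsto_0] show ?thesis by (rule Lim_null[THEN iffD2])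
  qed
  then have "(\<lambda>n. nit ks V \<zeta> (Suc n) x) \<longlonglongrightarrow> \<zeta> x - complex_of_real (V x) * cvs ks (neu ks V \<zeta>) x"
    unfolding nit_Suc by (intro tendsto_intros)
  then show ?thesis using LIMSEQ_Suc[OF neu_tendsto] LIMSEQ_unique by blast
qed

text \<open>With \<open>h = neu ks V \<zeta>\<close>, the chain of derivatives gives
  \<open>(D\<^sup>2\<^sup>m - E) \<phi> = h\<close>, and the fixed point equation reads
  \<open>h = \<zeta> - V \<phi>\<close>.\<close>

lemma cvs_neu_solves:
  assumes m: "m \<ge> 1" and cp: "char_poly ks = monom 1 (2*m) - [:E:]"
  defines "\<phi> \<equiv> cvs ks (neu ks V \<zeta>)"
  shows "wbd \<omega> (2 * N * M ^ (2*m)) \<phi>"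
    "\<exists>d. d 0 = \<phi> \<and> weak_sol m V E \<omega> \<zeta> d"
proof -
  have c: "coeff (char_poly ks) l = (if l = 2*m then 1 else 0) - (if l = 0 then E else 0)" for l
    unfolding cp by (simp add: coeff_pCons split: nat.split)
  have "degree (char_poly ks) = 2*m"
  proof (rule antisym)
    show "degree (char_poly ks) \<le> 2*m" by (rule degree_le) (use m in \<open>auto simp: c\<close>)
    show "2*m \<le> degree (char_poly ks)" by (rule le_degree) (use m in \<open>auto simp: c\<close>)
  qed
  then have len: "length ks = 2*m" by (simp add: degree_char_poly)
  show "wbd \<omega> (2 * N * M ^ (2*m)) \<phi>" unfolding \<phi>_def using cvs_wbd[OF neu_wbd] by (simp add: len)
  obtain d where d: "d 0 = \<phi>" "\<forall>l. \<exists>N. wbd \<omega> N (d l)" "\<forall>l<2*m. weak_deriv 1 (d l) (d (Suc l))"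
     "\<And>x. (\<Sum>l\<le>2*m. coeff (char_poly ks) l * (- \<i>)^l * d l x) = neu ks V \<zeta> x"
    using cvs_chain[OF neu_wbd] unfolding \<phi>_def len by blast
  have "(-1)^m * d (2*m) x + complex_of_real (V x) * \<phi> x = \<zeta> x + E * \<phi> x" for x
  proof -
    have "(\<Sum>l\<le>2*m. coeff (char_poly ks) l * (- \<i>)^l * d l x) =
       (\<Sum>l\<le>2*m. (if l = 2*m then (- \<i>)^l * d l x else 0) - (if l = 0 then E * d l x else 0))"
      by (rule sum.cong) (auto simp: c left_diff_distrib)
    also have "\<dots> = (- \<i>)^(2*m) * d (2*m) x - E * d 0 x"
      by (simp add: sum_subtractf)
    also have "(- \<i>)^(2*m) = (-1)^m" by (simp add: power_mult)
    finally have "(-1)^m * d (2*m) x - E * \<phi> x = neu ks V \<zeta> x" using d(1,4) by simp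
    then show ?thesis using neu_eq[of x] by (simp add: \<phi>_def algebra_simps)
  qed
  then show "\<exists>d. d 0 = \<phi> \<and> weak_sol m V E \<omega> \<zeta> d"
    using d(1-3) by (auto simp: weak_sol_def)
qed

end
end
end

section \<open>The resolvent in exponentially weighted spaces\<close>

lemma exp_halfline:
  assumes c: "c > 0"
  shows "integrable lborel (\<lambda>s::real. indicator {0..} s * exp (- c * s))"
    "(LINT s|lborel. indicator {0..} s * exp (- c * s)) = 1 / c"
proof -
  have e: "(\<integral>\<^sup>+ x. ennreal (exp (- c * x)) * indicator {0..} x \<partial>lborel) = ennreal (0 - (- 1 / c * exp (- c * 0)))"
  proof (rule nn_integral_FTC_atLeast)
    show "((\<lambda>a. - 1 / c * exp (- c * a)) has_real_derivative exp (- c * x)) (at x)" for x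
      using c by (auto intro!: derivative_eq_intros)
    have "filterlim (\<lambda>x. - c * x) at_bot at_top"
      by (rule filterlim_tendsto_neg_mult_at_bot[OF tendsto_const _ filterlim_ident]) (use c in simp)
    then have "((\<lambda>a. exp (- c * a)) \<longlongrightarrow> 0) at_top" by (rule filterlim_compose[OF exp_at_bot])
    then show "((\<lambda>a. - 1 / c * exp (- c * a)) \<longlongrightarrow> 0) at_top" by (rule tendsto_mult_right_zero)
  qed auto
  have "has_bochner_integral lborel (\<lambda>s::real. indicator {0..} s * exp (- c * s)) (1 / c)"
  proof (rule has_bochner_integral_nn_integral)
    have "(\<integral>\<^sup>+ x. ennreal (indicator {0..} x * exp (- c * x)) \<partial>lborel) = (\<integral>\<^sup>+ x. ennreal (exp (- c * x)) * indicator {0..} x \<partial>lborel)"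
      by (rule nn_integral_cong) (auto simp: indicator_def)
    then show "(\<integral>\<^sup>+ x. ennreal (indicator {0..} x * exp (- c * x)) \<partial>lborel) = ennreal (1 / c)" using e by simp
  qed (use c in auto)
  then show "integrable lborel (\<lambda>s::real. indicator {0..} s * exp (- c * s))"
    "(LINT s|lborel. indicator {0..} s * exp (- c * s)) = 1 / c"
    by (auto simp: has_bochner_integral_iff)
qed

lemma exp_halfline_shift:
  assumes c: "c > 0"
  shows "integrable lborel (\<lambda>y::real. indicator {0..} (x - y) * exp (- c * (x - y)))"
    "(LINT y|lborel. indicator {0..} (x - y) * exp (- c * (x - y))) = 1 / c"
    "integrable lborel (\<lambda>y::real. indicator {0..} (y - x) * exp (- c * (y - x)))"
    "(LINT y|lborel. indicator {0..} (y - x) * exp (- c * (y - x))) = 1 / c"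
  using lborel_integrable_real_affine[OF exp_halfline(1)[OF c], of "-1" x]
    lborel_integral_real_affine[of "-1" "\<lambda>s::real. indicator {0..} s * exp (- c * s)" x]
    lborel_integrable_real_affine[OF exp_halfline(1)[OF c], of "1" "-x"]
    lborel_integral_real_affine[of "1" "\<lambda>s::real. indicator {0..} s * exp (- c * s)" "-x"]
    exp_halfline(2)[OF c]
  by (simp_all add: algebra_simps)

lemma exp_abs_integral:
  assumes c: "c > 0"
  shows "integrable lborel (\<lambda>y::real. exp (- c * \<bar>x - y\<bar>))" "(LINT y|lborel. exp (- c * \<bar>x - y\<bar>)) \<le> 2 / c"
proof -
  let ?f = "\<lambda>y. indicator {0..} (x - y) * exp (- c * (x - y)) + indicator {0..} (y - x) * exp (- c * (y - x))"
  have le: "exp (- c * \<bar>x - y\<bar>) \<le> ?f y" for y by (auto simp: indicator_def abs_if)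
  have i: "integrable lborel ?f" using exp_halfline_shift[OF c, of x] by (intro Bochner_Integration.integrable_add)
  show 1: "integrable lborel (\<lambda>y::real. exp (- c * \<bar>x - y\<bar>))"
    by (rule Bochner_Integration.integrable_bound[OF i]) (use le in \<open>auto intro!: AE_I2 order_trans[OF _ abs_ge_self]\<close>)
  have "(LINT y|lborel. exp (- c * \<bar>x - y\<bar>)) \<le> (LINT y|lborel. ?f y)" by (rule integral_mono[OF 1 i le])
  also have "\<dots> = 2 / c" using exp_halfline_shift[OF c, of x] by simp
  finally show "(LINT y|lborel. exp (- c * \<bar>x - y\<bar>)) \<le> 2 / c" .
qed

text \<open>For \<open>k = 0\<close> the convolution is, up to the factor \<open>\<i>\<close>,
  integration from \<open>-\<infinity>\<close>, and the integral of \<open>exp (\<kappa> y)\<close>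
  up to \<open>x\<close> is \<open>exp (\<kappa> x) / \<kappa>\<close>.\<close>

lemma adm_exp:
  assumes "\<kappa> > 0" shows "adm (\<lambda>x. exp (\<kappa> * x)) (1 / \<kappa>) True 0"
  unfolding adm_def
proof
  fix x
  have e: "cmod (ker True 0 (x - y)) * exp (\<kappa> * y) = exp (\<kappa> * x) * (indicator {0..} (x - y) * exp (- \<kappa> * (x - y)))" for y
  proof -
    have "exp (\<kappa> * y) = exp (\<kappa> * x) * exp (- \<kappa> * (x - y))"
      unfolding exp_add[symmetric] by (simp add: algebra_simps)
    then show ?thesis by (simp add: norm_ker indicator_def)
  qed
  show "integrable lborel (\<lambda>y. cmod (ker True 0 (x - y)) * exp (\<kappa> * y)) \<and>
         (LINT y|lborel. cmod (ker True 0 (x - y)) * exp (\<kappa> * y)) \<le> 1 / \<kappa> * exp (\<kappa> * x)"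
    unfolding e using exp_halfline_shift[OF assms, of x] by simp
qed

definition dw :: "real \<Rightarrow> real \<Rightarrow> real \<Rightarrow> real" where
  "dw \<nu> R x = exp (- \<nu> * \<bar>x - R\<bar>)"

lemma dw_pos: "dw \<nu> R x > 0" by (simp add: dw_def)

lemma dw_cont: "continuous_on UNIV (dw \<nu> R)"
  unfolding dw_def by (intro continuous_intros)

text \<open>The flag picks the fundamental solution that decays, at rate at least
  \<open>\<beta>\<close>, while the weight changes by a factor of at most
  \<open>exp (\<nu> |x - y|)\<close>. What remains decays at rate \<open>\<beta> - \<nu>\<close> and
  has integral at most \<open>2 / (\<beta> - \<nu>)\<close>.\<close>

lemma adm_dw:
  assumes "\<bar>Im k\<bar> \<ge> \<beta>" "\<beta> > \<nu>" "\<nu> \<ge> 0"  "2 / (\<beta> - \<nu>) \<le> M"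
  shows "adm (dw \<nu> R) M (Im k > 0) k"
  unfolding adm_def
proof
  fix x
  let ?f = "\<lambda>y. cmod (ker (Im k > 0) k (x - y)) * dw \<nu> R y" and ?g = "\<lambda>y. dw \<nu> R x * exp (- (\<beta> - \<nu>) * \<bar>x - y\<bar>)"
  have c: "\<beta> - \<nu> > 0" using assms by simp
  have le: "?f y \<le> ?g y" for y
  proof -
    have "cmod (ker (Im k > 0) k (x - y)) \<le> exp (- \<beta> * \<bar>x - y\<bar>)"
    proof -
      have "- \<bar>Im k\<bar> * \<bar>x - y\<bar> \<le> - \<beta> * \<bar>x - y\<bar>" using assms(1) by (intro mult_right_mono) auto
      then have "exp (- \<bar>Im k\<bar> * \<bar>x - y\<bar>) \<le> exp (- \<beta> * \<bar>x - y\<bar>)" by (simp only: exp_le_cancel_iff)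
      moreover have "cmod (ker (Im k > 0) k (x - y)) \<le> exp (- \<bar>Im k\<bar> * \<bar>x - y\<bar>)" by (cases "Im k > 0"; cases "0 \<le> x - y") (simp_all add: norm_ker abs_of_pos abs_of_nonpos abs_of_neg algebra_simps)
      ultimately show ?thesis by linarith
    qed
    moreover have "dw \<nu> R y \<le> dw \<nu> R x * exp (\<nu> * \<bar>x - y\<bar>)"
    proof -
      have "\<nu> * \<bar>x - R\<bar> \<le> \<nu> * (\<bar>y - R\<bar> + \<bar>x - y\<bar>)" using assms(3) by (intro mult_left_mono) auto
      then show ?thesis unfolding dw_def exp_add[symmetric] by (simp add: algebra_simps)
    qed
    ultimately have "?f y \<le> exp (- \<beta> * \<bar>x - y\<bar>) * (dw \<nu> R x * exp (\<nu> * \<bar>x - y\<bar>))"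
      by (intro mult_mono) (auto simp: dw_def)
    also have "\<dots> = ?g y" by (simp add: algebra_simps flip: exp_add)
    finally show ?thesis .
  qed
  have i: "integrable lborel ?g" using exp_abs_integral(1)[OF c, of x] by (rule integrable_mult_right)
  have [measurable]: "dw \<nu> R \<in> borel_measurable borel" by (rule borel_measurable_continuous_onI[OF dw_cont])
  have 1: "integrable lborel ?f"
    by (rule Bochner_Integration.integrable_bound[OF i]) (use le in \<open>auto intro!: AE_I2 order_trans[OF le] simp: abs_mult less_imp_le[OF dw_pos]\<close>)
  have "(LINT y|lborel. ?f y) \<le> (LINT y|lborel. ?g y)" by (rule integral_mono[OF 1 i le])
  also have "\<dots> = dw \<nu> R x * (LINT y|lborel. exp (- (\<beta> - \<nu>) * \<bar>x - y\<bar>))" by (rule Bochner_Integration.integral_mult_right_zero)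
  also have "\<dots> \<le> dw \<nu> R x * (2 / (\<beta> - \<nu>))" using exp_abs_integral(2)[OF c, of x] by (intro mult_left_mono) (auto simp: less_imp_le[OF dw_pos])
  also have "\<dots> \<le> dw \<nu> R x * M" using assms(4) by (intro mult_left_mono) (auto simp: less_imp_le[OF dw_pos])
  finally show "integrable lborel ?f \<and> (LINT y|lborel. ?f y) \<le> M * dw \<nu> R x" using 1 by (simp add: mult.commute)
qed

lemma dw_L2:
  assumes "\<nu> > 0" "wbd (dw \<nu> R) N f" shows "L2 f"
proof (rule L2_dominated[OF wbd_measurable[OF assms(2)]])
  have "integrable lborel (\<lambda>x. exp (- (2 * \<nu>) * \<bar>R - x\<bar>))" by (rule exp_abs_integral(1)) (use assms in simp)
  then show "integrable lborel (\<lambda>x. N^2 * exp (- (2 * \<nu>) * \<bar>R - x\<bar>))" by (rule integrable_mult_right)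
  fix x
  have "(cmod (f x))^2 \<le> (N * dw \<nu> R x)^2" by (intro power_mono wbd_le[OF assms(2)]) auto
  also have "\<dots> = N^2 * exp (- (2 * \<nu>) * \<bar>R - x\<bar>)"
    unfolding power_mult_distrib dw_def exp_double[symmetric] abs_minus_commute[of x R] by simp
  finally show "(cmod (f x))^2 \<le> N^2 * exp (- (2 * \<nu>) * \<bar>R - x\<bar>)" .
qed

text \<open>A root close to the real axis is close to \<open>\<plusminus>|k|\<close>, so its even power is close to \<open>|E|\<close>.\<close>

lemma root_Im_bound:
  fixes k E :: complex
  assumes m: "m \<ge> 1" and k: "k ^ (2*m) = E" and E: "Re E \<le> \<bar>Im E\<bar>"
  shows "\<bar>Im k\<bar> \<ge> cmod k / (16 * real m)"
proof (cases "k = 0")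
  case False
  define \<kappa> where "\<kappa> = cmod k"
  have kp: "\<kappa> > 0" using False by (simp add: \<kappa>_def)
  have nE: "cmod E = \<kappa> ^ (2*m)" unfolding k[symmetric] \<kappa>_def by (rule norm_power)
  \<comment> \<open>Off the sector \<open>Re E\<close> is at most \<open>|E|\<close> over the square
    root of 2, which is below \<open>3/4 |E|\<close>; hence \<open>E\<close> keeps the distance
    \<open>|E|/4\<close> from \<open>|E|\<close>.\<close>
  have "4 * Re E \<le> 3 * cmod E"
  proof (cases "Re E \<le> 0")
    case False
    have "(4 * Re E)^2 \<le> 8 * ((Re E)^2 + (Im E)^2)"
    proof -
      have "(Re E)^2 \<le> (Im E)^2" using power_mono[OF E, of 2] False by simp
      then show ?thesis by (simp add: power_mult_distrib)
    qed
    also have "\<dots> \<le> (3 * cmod E)^2" by (simp add: power_mult_distrib cmod_power2)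
    finally show ?thesis by (rule power2_le_imp_le) simp
  qed (use norm_ge_zero[of E] in linarith)
  then have far: "cmod (E - complex_of_real (cmod E)) \<ge> cmod E / 4"
    using abs_Re_le_cmod[of "E - complex_of_real (cmod E)"] by simp
  define \<sigma> where "\<sigma> = (if Re k \<ge> 0 then 1 else - 1 :: real)"
  have near: "cmod (k - complex_of_real (\<sigma> * \<kappa>)) \<le> 2 * \<bar>Im k\<bar>"
  proof -
    have "cmod (k - complex_of_real (\<sigma> * \<kappa>)) \<le> \<bar>Re k - \<sigma> * \<kappa>\<bar> + \<bar>Im k\<bar>"
      using cmod_le[of "k - complex_of_real (\<sigma> * \<kappa>)"] by simp
    moreover have "\<bar>Re k - \<sigma> * \<kappa>\<bar> = \<kappa> - \<bar>Re k\<bar>" using abs_Re_le_cmod[of k] by (auto simp: \<sigma>_def \<kappa>_def abs_if)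
    moreover have "\<kappa> \<le> \<bar>Re k\<bar> + \<bar>Im k\<bar>" using cmod_le[of k] by (simp add: \<kappa>_def)
    ultimately show ?thesis by linarith
  qed
  \<comment> \<open>Dividing by \<open>\<kappa>\<close> puts both points on the unit circle, where
    the power \<open>2m\<close> stretches distances by at most \<open>2m\<close>.\<close>
  define z where "z = k / complex_of_real \<kappa>"
  define w where "w = complex_of_real \<sigma>"
  have "cmod (z^(2*m) - w^(2*m)) \<le> real (2*m) * cmod (z - w)"
    by (rule norm_power_diff) (use kp in \<open>auto simp: z_def w_def \<sigma>_def norm_divide \<kappa>_def\<close>)
  moreover have "w^(2*m) = 1" by (auto simp: w_def \<sigma>_def power_mult)
  moreover have "z^(2*m) = E / complex_of_real (\<kappa>^(2*m))" unfolding z_def power_divide k by simp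
  moreover have "cmod (z - w) = cmod (k - complex_of_real (\<sigma> * \<kappa>)) / \<kappa>"
  proof -
    have "z - w = (k - complex_of_real (\<sigma> * \<kappa>)) / complex_of_real \<kappa>" using kp by (simp add: z_def w_def field_simps)
    then show ?thesis using kp by (simp add: norm_divide)
  qed
  moreover have "cmod (E / complex_of_real (\<kappa>^(2*m)) - 1) = cmod (E - complex_of_real (cmod E)) / cmod E"
  proof -
    have "E / complex_of_real (\<kappa>^(2*m)) - 1 = (E - complex_of_real (cmod E)) / complex_of_real (cmod E)"
      unfolding nE using kp by (simp add: diff_divide_distrib)
    then show ?thesis by (simp add: norm_divide)
  qed
  ultimately have "cmod (E - complex_of_real (cmod E)) / cmod E \<le> real (2*m) * (2 * \<bar>Im k\<bar> / \<kappa>)"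
    using near kp by (smt (verit) divide_right_mono mult_left_mono of_nat_0_le_iff)
  moreover have "1 / 4 \<le> cmod (E - complex_of_real (cmod E)) / cmod E"
  proof -
    have "cmod E > 0" unfolding nE using kp by simp
    then show ?thesis using far by (simp add: field_simps)
  qed
  ultimately have "1 / 4 \<le> real (2*m) * (2 * \<bar>Im k\<bar> / \<kappa>)" by linarith
  then show ?thesis using kp m by (simp add: \<kappa>_def field_simps)
qed simp

lemma char_poly_factor:
  assumes "m \<ge> 1"
  obtains ks where "char_poly (map (\<lambda>k. (b k, k)) ks) = monom 1 (2*m) - [:E:]" "\<And>k. k \<in> set ks \<Longrightarrow> k ^ (2*m) = E"
    "length ks = 2*m"
proof -
  let ?p = "monom 1 (2*m) - [:E:] :: complex poly"
  have d: "degree ?p = 2*m"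
  proof (rule antisym)
    show "degree ?p \<le> 2*m" by (rule degree_le) (use assms in \<open>auto simp: coeff_pCons split: nat.split\<close>)
    show "2*m \<le> degree ?p" by (rule le_degree) (use assms in \<open>auto simp: coeff_pCons split: nat.split\<close>)
  qed
  then have l: "lead_coeff ?p = 1" using assms by (auto simp: coeff_pCons split: nat.split)
  have "?p \<noteq> 0"
  proof
    assume "?p = 0"
    then have "lead_coeff ?p = 0" by (simp only: leading_coeff_0_iff)
    with l show False by (simp only: zero_neq_one)
  qed
  from alg_closed_imp_factorization[OF this] obtain A where A: "size A = degree ?p" "?p = smult (lead_coeff ?p) (\<Prod>x\<in>#A. [:-x, 1:])" by (elim exE conjE) (rule that)
  obtain ks where ks: "mset ks = A" using ex_mset by blast
  have p: "?p = prod_list (map (\<lambda>x. [:-x, 1:]) ks)"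
    using A(2) unfolding l smult_1_left ks[symmetric] mset_map[symmetric] prod_mset_prod_list .
  have len: "length ks = 2*m" using A(1) d by (simp flip: ks)
  have "char_poly (map (\<lambda>k. (b k, k)) ks) = ?p" unfolding p char_poly_def by (simp add: comp_def)
  moreover have "k ^ (2*m) = E" if "k \<in> set ks" for k
  proof -
    have "poly (prod_list (map (\<lambda>x. [:-x, 1:]) ks)) k = 0" using that
      by (induction ks) auto
    then have "poly ?p k = 0" using p by simp
    then show ?thesis by (simp add: poly_monom)
  qed
  ultimately show ?thesis using that len by blast
qed

text \<open>When \<open>|E|\<close> is large and \<open>E\<close> is off the sector, all roots of
  \<open>k\<^sup>2\<^sup>m = E\<close> lie far from the real axis, so the convolutions have small
  norm and the Neumann series converges. The threshold is uniform in \<open>R\<close> and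
  \<open>\<zeta>\<close>.\<close>

lemma resolvent_exists:
  fixes V :: "real \<Rightarrow> real" and v \<nu> :: real
  assumes m: "m \<ge> 1" and V: "V \<in> borel_measurable borel" "\<And>x. \<bar>V x\<bar> \<le> v" and lam: "\<nu> > 0"
  shows "\<exists>a0>0. \<forall>E R \<zeta>. cmod E \<ge> a0 \<longrightarrow> Re E \<le> \<bar>Im E\<bar> \<longrightarrow> wbd (dw \<nu> R) 1 \<zeta> \<longrightarrow>
    (\<exists>d. wbd (dw \<nu> R) 2 (d 0) \<and> weak_sol m V E (dw \<nu> R) \<zeta> d)"
proof -
  have v: "v \<ge> 0" using V(2)[of 0] by linarith
  \<comment> \<open>Roots with \<open>|k| \<ge> c\<close> have
    \<open>|Im k| \<ge> \<nu> + 2 (2 v + 1)\<close>, so each factor has norm at most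
    \<open>M = 1 / (2 v + 1)\<close>, and \<open>v M \<le> 1/2\<close>.\<close>
  define c where "c = 16 * real m * (\<nu> + 2 * (2 * v + 1))"
  have c: "c > 0" unfolding c_def using m lam v by (intro mult_pos_pos add_pos_nonneg) auto
  define M where "M = 1 / (2 * v + 1)"
  have M: "0 \<le> M" "M \<le> 1" using v by (auto simp: M_def)
  show ?thesis
  proof (intro exI[of _ "c ^ (2*m)"] conjI allI impI)
    show "c ^ (2*m) > 0" using c by simp
    fix E R \<zeta> assume E: "cmod E \<ge> c ^ (2*m)" "Re E \<le> \<bar>Im E\<bar>" and z: "wbd (dw \<nu> R) 1 \<zeta>"
    obtain rs where rs: "char_poly (map (\<lambda>k. (Im k > 0, k)) rs) = monom 1 (2*m) - [:E:]" "\<And>k. k \<in> set rs \<Longrightarrow> k ^ (2*m) = E" "length rs = 2*m"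
      by (rule char_poly_factor[OF m, of "\<lambda>k. Im k > 0" E]) (rule that)
    define ks where "ks = map (\<lambda>k. (Im k > 0, k)) rs"
    have adm: "adm (dw \<nu> R) M (fst p) (snd p)" if pk: "p \<in> set ks" for p
    proof -
      obtain k where p: "p = (Im k > 0, k)" "k \<in> set rs"
        using pk unfolding ks_def set_map by (rule imageE)
      have kE: "k ^ (2*m) = E" by (rule rs(2)[OF p(2)])
      have "c ^ (2*m) \<le> cmod k ^ (2*m)" using E(1) unfolding kE[symmetric] norm_power .
      then have "c \<le> cmod k" using c m by (subst (asm) power_mono_iff) auto
      then have "c / (16 * real m) \<le> cmod k / (16 * real m)" by (intro divide_right_mono) auto
      then have "\<nu> + 2 * (2 * v + 1) \<le> \<bar>Im k\<bar>" using root_Im_bound[OF m kE E(2)] m by (simp add: c_def)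
      then show ?thesis unfolding p(1) fst_conv snd_conv
        by (rule adm_dw) (use v lam in \<open>auto simp: M_def divide_simps\<close>)
    qed
    have len: "length ks = 2*m" using rs(3) by (simp add: ks_def)
    have Mle: "M ^ (2*m) \<le> M" using power_decreasing[of 1 "2*m" M] M m by simp
    have vM: "v * M ^ length ks \<le> 1/2"
    proof -
      have "v * M ^ length ks \<le> v * M" unfolding len using v Mle by (intro mult_left_mono)
      also have "\<dots> \<le> 1/2" using v by (simp add: M_def field_simps)
      finally show ?thesis .
    qed
    note S = cvs_neu_solves[OF dw_pos dw_cont M(1) adm V vM z m rs(1)[folded ks_def]]
    have S2: "\<exists>d. d 0 = cvs ks (neu ks V \<zeta>) \<and> weak_sol m V E (dw \<nu> R) \<zeta> d" by (rule S(2))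
    have "wbd (dw \<nu> R) 2 (cvs ks (neu ks V \<zeta>))"
      by (rule wbd_mono[OF S(1) _ dw_pos]) (use Mle M in auto)
    then show "\<exists>d. wbd (dw \<nu> R) 2 (d 0) \<and> weak_sol m V E (dw \<nu> R) \<zeta> d" 
      using S2 by metis
  qed
qed

section \<open>Exponential decay of time moments\<close>

text \<open>
  Multiplying by \<open>exp(-2(E + a))\<close> makes \<open>G\<close> decay at infinity in the sector \<open>|Im E| < Re E + a\<close>,
  so the bound on its two boundary rays controls the interior.
\<close>

lemma sector_maximum:
  fixes G :: "complex \<Rightarrow> complex" and a b B :: real
  assumes hol: "G holomorphic_on UNIV" and B: "\<And>E. cmod (G E) \<le> B * exp \<bar>Im E\<bar>"
    and b: "\<And>E. \<bar>Im E\<bar> = Re E + a \<Longrightarrow> cmod (G E) \<le> b * exp \<bar>Im E\<bar>" and b0: "0 \<le> b"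
    and E0: "\<bar>Im E0\<bar> < Re E0 + a"
  shows "cmod (G E0) \<le> b * exp (2 * (Re E0 + a))"
proof -
  define f where "f E = G E * exp (- 2 * (E + complex_of_real a))" for E
  have nf: "cmod (f E) = cmod (G E) * exp (- 2 * (Re E + a))" for E by (simp add: f_def norm_mult)
  have B0: "0 \<le> B" using order_trans[OF norm_ge_zero B[of 0]] by simp
  have "cmod (f E0) \<le> b + \<delta>" if d: "\<delta> > 0" for \<delta>
  proof -
    \<comment> \<open>The edge \<open>Re E = L\<close> truncates the sector to a bounded set.
      \<open>L\<close> exceeds \<open>Re E0\<close> and is so large that the a priori bound
      \<open>B exp (- (L + a))\<close> for \<open>f\<close> on this edge is at most
      \<open>\<delta>\<close>.\<close>
    define L where "L = max (Re E0 + 1) (B / \<delta> - a)"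
    define S where "S = {E. \<bar>Im E\<bar> < Re E + a \<and> Re E < L}"
    have oS: "open S" unfolding S_def by (intro open_Collect_conj open_Collect_less continuous_intros)
    have "closed {E. \<bar>Im E\<bar> \<le> Re E + a \<and> Re E \<le> L}"
      by (intro closed_Collect_conj closed_Collect_le continuous_intros)
    then have cl: "closure S \<subseteq> {E. \<bar>Im E\<bar> \<le> Re E + a \<and> Re E \<le> L}"
      by (intro closure_minimal) (auto simp: S_def)
    have bS: "bounded S"
    proof -
      have "cmod E \<le> \<bar>a\<bar> + \<bar>L\<bar> + (\<bar>L\<bar> + \<bar>a\<bar>)" if "E \<in> S" for E
        using that cmod_le[of E] unfolding S_def by (auto simp: abs_if split: if_splits)
      then show ?thesis unfolding bounded_iff by blast
    qed
    show ?thesis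
    proof (rule maximum_modulus_frontier[where S=S and f=f])
      show "f holomorphic_on interior S" unfolding f_def
        by (intro holomorphic_intros holomorphic_on_subset[OF hol]) auto
      show "continuous_on (closure S) f" unfolding f_def
        by (intro continuous_intros continuous_on_subset[OF holomorphic_on_imp_continuous_on[OF hol]]) auto
      show "E0 \<in> S" using E0 by (simp add: S_def L_def)
      fix z assume z: "z \<in> frontier S"
      then have z1: "\<bar>Im z\<bar> \<le> Re z + a" "Re z \<le> L" "z \<notin> S"
        using cl oS by (auto simp: frontier_def interior_open)
      then consider "\<bar>Im z\<bar> = Re z + a" | "Re z = L" by (auto simp: S_def)
      then show "cmod (f z) \<le> b + \<delta>"
      proof cases
        case 1
        have "cmod (f z) \<le> b * exp \<bar>Im z\<bar> * exp (- 2 * (Re z + a))" unfolding nf using b[OF 1] by (intro mult_right_mono) auto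
        also have "\<dots> = b * exp (- \<bar>Im z\<bar>)" unfolding 1[symmetric] by (simp add: mult.assoc flip: exp_add)
        also have "\<dots> \<le> b * 1" using b0 by (intro mult_left_mono) auto
        finally show ?thesis using d by simp
      next
        case 2
        have pos: "0 \<le> L + a" using z1(1) 2 by linarith
        have "cmod (f z) \<le> B * exp \<bar>Im z\<bar> * exp (- 2 * (Re z + a))" unfolding nf using B by (intro mult_right_mono) auto
        also have "\<dots> \<le> B * exp (Re z + a) * exp (- 2 * (Re z + a))" using z1 B0 by (intro mult_right_mono mult_left_mono) auto
        also have "\<dots> = B * exp (- (L + a))" using 2 by (simp add: mult.assoc flip: exp_add)
        also have "\<dots> \<le> \<delta>"
        proof -
          have "B / \<delta> \<le> L + a" by (simp add: L_def)
          also have "\<dots> \<le> exp (L + a)" using exp_ge_add_one_self[of "L + a"] by linarith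
          finally have "B \<le> \<delta> * exp (L + a)" using d by (simp add: pos_divide_le_eq mult.commute)
          then show ?thesis unfolding exp_minus divide_inverse[symmetric] by (simp add: pos_divide_le_eq)
        qed
        finally show ?thesis using b0 by simp
      qed
    qed (rule bS)
  qed
  then have "cmod (f E0) \<le> b" by (rule field_le_epsilon)
  then have "cmod (G E0) * exp (- 2 * (Re E0 + a)) * exp (2 * (Re E0 + a)) \<le> b * exp (2 * (Re E0 + a))"
    unfolding nf by (rule mult_right_mono) simp
  then show ?thesis unfolding mult.assoc exp_add[symmetric] by simp
qed

text \<open>Differentiation under the integral turns the moments of \<open>g\<close> into
  derivatives at 0 of an entire function, to which Cauchy's inequality applies.\<close>

lemma laplace_higher_deriv:
  fixes g :: "real \<Rightarrow> complex"
  assumes g: "continuous_on {0..1} g"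
  defines "G \<equiv> \<lambda>E. integral {0..1} (\<lambda>t. exp (\<i> * complex_of_real t * E) * g t)"
  shows "G holomorphic_on UNIV" "(deriv ^^ n) G 0 = \<i> ^ n * integral {0..1} (\<lambda>t. complex_of_real (t ^ n) * g t)"
proof -
  let ?D = "\<lambda>n E. integral (cbox 0 1) (\<lambda>t. (\<i> * complex_of_real t) ^ n * exp (\<i> * complex_of_real t * E) * g t)"
  have g': "continuous_on (cbox 0 1) g" using g by simp
  have d: "(?D n has_field_derivative ?D (Suc n) E) (at E)" for n E
  proof (rule leibniz_rule_field_derivative[where U=UNIV])
    fix E t
    have "((\<lambda>E. exp (\<i> * complex_of_real t * E)) has_field_derivative exp (\<i> * complex_of_real t * E) * (\<i> * complex_of_real t)) (at E)"
      by (auto intro!: derivative_eq_intros)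
    then have "((\<lambda>E. (\<i> * complex_of_real t) ^ n * exp (\<i> * complex_of_real t * E) * g t) has_field_derivative
      (\<i> * complex_of_real t) ^ n * (exp (\<i> * complex_of_real t * E) * (\<i> * complex_of_real t)) * g t) (at E)"
      by (intro DERIV_cmult DERIV_cmult_right)
    then show "((\<lambda>E. (\<i> * complex_of_real t) ^ n * exp (\<i> * complex_of_real t * E) * g t) has_field_derivative
      (\<i> * complex_of_real t) ^ Suc n * exp (\<i> * complex_of_real t * E) * g t) (at E)" by (simp add: mult_ac)
  next
    fix E show "(\<lambda>t. (\<i> * complex_of_real t) ^ n * exp (\<i> * complex_of_real t * E) * g t) integrable_on cbox 0 1"
      by (intro integrable_continuous continuous_intros g')
  next
    have gs: "continuous_on (UNIV \<times> cbox 0 1) (\<lambda>p::complex \<times> real. g (snd p))"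
      by (rule continuous_on_compose2[OF g']) (auto intro!: continuous_intros)
    show "continuous_on (UNIV \<times> cbox 0 1) (\<lambda>(E, t). (\<i> * complex_of_real t) ^ Suc n * exp (\<i> * complex_of_real t * E) * g t)"
      unfolding case_prod_beta by (intro continuous_intros gs)
  qed auto
  have G: "G = ?D 0" by (simp add: G_def)
  then show "G holomorphic_on UNIV" using d[of 0] by (auto simp: holomorphic_on_def field_differentiable_def)
  have "(deriv ^^ n) G = ?D n" for n
  proof (induction n)
    case 0 show ?case using G by simp
  next
    case (Suc n)
    have "deriv (?D n) = ?D (Suc n)" using DERIV_imp_deriv[OF d] by blast
    then show ?case using Suc by simp
  qed
  then have "(deriv ^^ n) G 0 = integral {0..1} (\<lambda>t. \<i> ^ n * (complex_of_real (t ^ n) * g t))"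
    by (simp add: power_mult_distrib mult.assoc)
  then show "(deriv ^^ n) G 0 = \<i> ^ n * integral {0..1} (\<lambda>t. complex_of_real (t ^ n) * g t)" by simp
qed

lemma laplace_bound:
  fixes g :: "real \<Rightarrow> complex"
  assumes g: "continuous_on {0..1} g" and B: "\<And>t. t \<in> {0..1} \<Longrightarrow> cmod (g t) \<le> B"
  shows "cmod (integral {0..1} (\<lambda>t. exp (\<i> * complex_of_real t * E) * g t)) \<le> B * exp \<bar>Im E\<bar>"
proof -
  have "cmod (integral {0..1} (\<lambda>t. exp (\<i> * complex_of_real t * E) * g t)) \<le> B * exp \<bar>Im E\<bar> * (1 - 0)"
  proof (rule integral_bound)
    show "continuous_on {0..1} (\<lambda>t. exp (\<i> * complex_of_real t * E) * g t)" by (intro continuous_intros g)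
    fix t :: real assume t: "t \<in> {0..1}"
    have "- (t * Im E) \<le> t * \<bar>Im E\<bar>" using t by (cases "Im E \<ge> 0") (auto simp: abs_if mult_nonneg_nonneg)
    also have "\<dots> \<le> 1 * \<bar>Im E\<bar>" using t by (intro mult_right_mono) auto
    finally have "cmod (exp (\<i> * complex_of_real t * E)) \<le> exp \<bar>Im E\<bar>" by simp
    then have "cmod (exp (\<i> * complex_of_real t * E)) * cmod (g t) \<le> exp \<bar>Im E\<bar> * B" using B[OF t] by (intro mult_mono) auto
    then show "cmod (exp (\<i> * complex_of_real t * E) * g t) \<le> B * exp \<bar>Im E\<bar>" by (simp add: norm_mult mult.commute)
  qed simp
  then show ?thesis by simp
qed

lemma bil_weight_bound:
  assumes D: "integrable lborel (\<lambda>x. cmod (g x) * exp (c * \<bar>x\<bar>))" and w: "wbd \<omega> N \<phi>"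
    and \<omega>: "\<And>x. 0 < \<omega> x" "\<And>x. \<omega> x \<le> A * exp (c * \<bar>x\<bar>)"
  shows "cmod (bil g \<phi>) \<le> N * A * (LINT x|lborel. cmod (g x) * exp (c * \<bar>x\<bar>))"
proof -
  have N: "0 \<le> N" by (rule wbd_nonneg[OF w \<omega>(1)])
  have A: "0 \<le> A" using order_trans[OF less_imp_le[OF \<omega>(1)] \<omega>(2)[of 0]] by simp
  have "cmod (bil g \<phi>) \<le> (LINT x|lborel. cmod (g x * \<phi> x))" unfolding bil_def by (rule integral_norm_bound)
  also have "\<dots> \<le> (LINT x|lborel. N * A * (cmod (g x) * exp (c * \<bar>x\<bar>)))"
  proof (rule integral_mono')
    show "integrable lborel (\<lambda>x. N * A * (cmod (g x) * exp (c * \<bar>x\<bar>)))" using D by (rule integrable_mult_right)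
    fix x
    have "cmod (\<phi> x) \<le> N * (A * exp (c * \<bar>x\<bar>))"
      using wbd_le[OF w, of x] mult_left_mono[OF \<omega>(2) N] by (rule order_trans)
    then have "cmod (g x) * cmod (\<phi> x) \<le> cmod (g x) * (N * (A * exp (c * \<bar>x\<bar>)))" by (intro mult_left_mono) auto
    then show "cmod (g x * \<phi> x) \<le> N * A * (cmod (g x) * exp (c * \<bar>x\<bar>))" by (simp add: norm_mult mult_ac)
  qed (use N A in simp)
  finally show ?thesis by simp
qed

text \<open>By the triangle inequality, a pairing with a function centred at \<open>R\<close> gains
  \<open>exp (- \<nu> R)\<close> at the price of an exponential moment of the other factor.\<close>

lemma dw_le:
  assumes "\<nu> \<ge> 0" shows "dw \<nu> R x \<le> exp (- \<nu> * R) * exp (\<nu> * \<bar>x\<bar>)"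
proof -
  have "\<nu> * R \<le> \<nu> * (\<bar>x - R\<bar> + \<bar>x\<bar>)" using assms by (intro mult_left_mono) auto
  then show ?thesis unfolding dw_def exp_add[symmetric] by (simp add: distrib_left)
qed

lemma L2_bounded_mult:
  assumes "V \<in> borel_measurable borel" "\<And>x. \<bar>V x\<bar> \<le> v" "L2 \<phi>"
  shows "L2 (\<lambda>x. complex_of_real (V x) * \<phi> x)"
proof (rule L2_dominated)
  note [measurable] = assms(1) L2_measurable[OF assms(3)]
  show "(\<lambda>x. complex_of_real (V x) * \<phi> x) \<in> borel_measurable borel" by measurable
  show "integrable lborel (\<lambda>x. v^2 * (cmod (\<phi> x))^2)" using L2_square_integrable[OF assms(3)] by (rule integrable_mult_right)
  fix x
  have "\<bar>V x\<bar> * cmod (\<phi> x) \<le> v * cmod (\<phi> x)" using assms(2)[of x] by (intro mult_right_mono) auto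
  then have "(\<bar>V x\<bar> * cmod (\<phi> x))^2 \<le> (v * cmod (\<phi> x))^2" by (intro power_mono) auto
  then show "(cmod (complex_of_real (V x) * \<phi> x))^2 \<le> v^2 * (cmod (\<phi> x))^2" by (simp add: norm_mult power_mult_distrib)
qed

context
  fixes m :: nat and V W :: "real \<Rightarrow> real" and v :: real and U and f :: "real \<Rightarrow> complex"
  assumes m: "m \<ge> 1" and grp: "schr_group m V U" and W: "W \<in> borel_measurable borel" "\<And>x. \<bar>W x\<bar> \<le> v"
    and VW: "AE x in lborel. V x = W x" and f: "L2 f"
begin

text \<open>\<open>V\<close> is bounded only almost everywhere, whereas the weighted estimates are
  pointwise. The equation is therefore solved with an everywhere bounded version \<open>W\<close>;
  the generator sees functions only up to null sets.\<close>

lemma chain_derivative: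
  assumes L: "\<And>l. l \<le> 2*m \<Longrightarrow> L2 (d l)" and wd: "\<And>l. l < 2*m \<Longrightarrow> weak_deriv 1 (d l) (d (Suc l))"
    and h: "\<And>x. (-1)^m * d (2*m) x + complex_of_real (W x) * d 0 x = h x"
  shows "((\<lambda>t. bil (U t f) (d 0)) has_vector_derivative - \<i> * bil (U t f) h) (at t)"
proof (rule bil_U_derivative[OF grp f])
  have wl: "weak_deriv l (d 0) (d l)" if "l \<le> 2*m" for l
    by (rule weak_deriv_chain) (use wd that in auto)
  show "sobolev (2*m) (d 0)" unfolding sobolev_def using L wl by blast
  show "L2 (d (2*m))" "weak_deriv (2*m) (d 0) (d (2*m))" using L wl by auto
  show "ae_eq h (\<lambda>x. (-1)^m * d (2*m) x + complex_of_real (V x) * d 0 x)"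
    unfolding ae_eq_def using VW by eventually_elim (simp add: h)
  have "L2 (\<lambda>x. (-1)^m * d (2*m) x + complex_of_real (W x) * d 0 x)"
    using L by (intro L2_add L2_cmult L2_bounded_mult[OF W]) auto
  then show "L2 h" by (simp add: h)
qed

text \<open>On the boundary rays of a sector with vertex \<open>-a\<close> the resolvent makes
  \<open>G\<close> of order \<open>exp (- \<nu> R)\<close>. The maximum principle brings this bound
  to the unit circle, and Cauchy's inequality brings it to the \<open>n\<close>-th moment.\<close>

lemma moment_decay:
  assumes D0: "\<And>c. integrable lborel (\<lambda>x. cmod (U 0 f x) * exp (c * \<bar>x\<bar>))"
    and D1: "\<And>c. integrable lborel (\<lambda>x. cmod (U 1 f x) * exp (c * \<bar>x\<bar>))" and nu: "\<nu> > 0"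
  shows "\<exists>C\<ge>0. \<forall>R \<zeta>. wbd (dw \<nu> R) 1 \<zeta> \<longrightarrow>
    cmod (integral {0..1} (\<lambda>t. complex_of_real (t ^ n) * bil (U t f) \<zeta>)) \<le> C * exp (- \<nu> * R)"
proof -
  obtain a0 where a0: "a0 > 0" and res: "\<forall>E R \<zeta>. cmod E \<ge> a0 \<longrightarrow> Re E \<le> \<bar>Im E\<bar> \<longrightarrow> wbd (dw \<nu> R) 1 \<zeta> \<longrightarrow>
    (\<exists>d. wbd (dw \<nu> R) 2 (d 0) \<and> weak_sol m W E (dw \<nu> R) \<zeta> d)"
    using resolvent_exists[OF m W nu] by (elim exE conjE) (rule that)
  \<comment> \<open>\<open>a \<ge> 3\<close> puts the closed unit disc inside the sector, and
    \<open>a \<ge> 2 a0\<close> ensures \<open>|E| \<ge> a0\<close> on the boundary rays.\<close>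
  define a where "a = max 3 (2 * a0)"
  define K where "K = 2 * ((LINT x|lborel. cmod (U 1 f x) * exp (\<nu> * \<bar>x\<bar>)) + (LINT x|lborel. cmod (U 0 f x) * exp (\<nu> * \<bar>x\<bar>)))"
  have K: "K \<ge> 0" unfolding K_def by (intro mult_nonneg_nonneg add_nonneg_nonneg integral_nonneg_AE) auto
  show ?thesis
  proof (intro exI[of _ "fact n * (K * exp (2 * (1 + a)))"] conjI allI impI)
    show "0 \<le> fact n * (K * exp (2 * (1 + a)))" using K by simp
    fix R \<zeta> assume z: "wbd (dw \<nu> R) 1 \<zeta>"
    have z2: "L2 \<zeta>" by (rule dw_L2[OF nu z])
    define g where "g t = bil (U t f) \<zeta>" for t
    have g: "continuous_on S g" for S unfolding g_def by (rule bil_U_continuous[OF grp f z2])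
    define G where "G = (\<lambda>E. integral {0..1} (\<lambda>t. exp (\<i> * complex_of_real t * E) * g t))"
    note lap = laplace_higher_deriv[OF g, folded G_def]
    have gB: "cmod (g t) \<le> L2norm f * L2norm \<zeta>" for t
      unfolding g_def using bil_bound[OF U_L2[OF grp f] z2] by (simp add: U_norm[OF grp f])
    have GB: "cmod (G E) \<le> L2norm f * L2norm \<zeta> * exp \<bar>Im E\<bar>" for E
      unfolding G_def by (rule laplace_bound[OF g gB])
    have Gb: "cmod (G E) \<le> K * exp (- \<nu> * R) * exp \<bar>Im E\<bar>" if E: "\<bar>Im E\<bar> = Re E + a" for E
    proof -
      have E1: "a0 \<le> cmod E"
      proof (cases "\<bar>Im E\<bar> \<ge> a / 2")
        case True then show ?thesis using abs_Im_le_cmod[of E] by (auto simp: a_def)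
      next
        case False then show ?thesis using abs_Re_le_cmod[of E] E by (auto simp: a_def)
      qed
      have E2: "Re E \<le> \<bar>Im E\<bar>" using E a0 by (auto simp: a_def)
      from res[rule_format, OF E1 E2 z] obtain d where d': "wbd (dw \<nu> R) 2 (d 0)" "weak_sol m W E (dw \<nu> R) \<zeta> d"
        by (elim exE conjE) (rule that)
      note d = d'(1) d'(2)[unfolded weak_sol_def, THEN conjunct1, rule_format]
        d'(2)[unfolded weak_sol_def, THEN conjunct2, THEN conjunct1, rule_format]
        d'(2)[unfolded weak_sol_def, THEN conjunct2, THEN conjunct2, rule_format]
      have dL: "L2 (d l)" for l using d(2)[of l] dw_L2[OF nu] by blast
      define c where "c t = bil (U t f) (d 0)" for t
      have c': "(c has_vector_derivative - \<i> * (g t + E * c t)) (at t)" for t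
      proof -
        have "bil (U t f) (\<lambda>x. \<zeta> x + E * d 0 x) = g t + E * c t"
          using bil_lincomb[OF U_L2[OF grp f] z2 dL[of 0], of t 1 E] by (simp add: g_def c_def)
        then show ?thesis using chain_derivative[of d "\<lambda>x. \<zeta> x + E * d 0 x" t] dL d(3,4) by (simp add: c_def[abs_def])
      qed
      have e': "((\<lambda>t. exp (\<i> * complex_of_real t * E)) has_vector_derivative (\<i> * E) * exp (\<i> * complex_of_real t * E)) (at t)" for t
      proof -
        have "((\<lambda>z. exp (\<i> * z * E)) has_field_derivative (\<i> * E) * exp (\<i> * complex_of_real t * E)) (at (complex_of_real t))"
          by (auto intro!: derivative_eq_intros)
        from has_vector_derivative_real_field[OF this] show ?thesis by simp
      qed
      \<comment> \<open>The exponential is an integrating factor for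
        \<open>c' = - \<i> (g + E c)\<close>: the terms with \<open>E\<close> cancel.\<close>
      have "((\<lambda>t. exp (\<i> * complex_of_real t * E) * c t) has_vector_derivative (- \<i>) * (exp (\<i> * complex_of_real t * E) * g t)) (at t within {0..1})" for t
        using has_vector_derivative_mult[OF e' c', of t] by (rule_tac has_vector_derivative_at_within) (simp add: algebra_simps)
      then have "((\<lambda>t. (- \<i>) * (exp (\<i> * complex_of_real t * E) * g t)) has_integral exp (\<i> * complex_of_real 1 * E) * c 1 - exp (\<i> * complex_of_real 0 * E) * c 0) {0..1}"
        by (intro fundamental_theorem_of_calculus) auto
      from integral_unique[OF this] have "- \<i> * G E = exp (\<i> * complex_of_real 1 * E) * c 1 - exp (\<i> * complex_of_real 0 * E) * c 0"
        unfolding integral_mult_right G_def .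
      then have "- \<i> * G E = exp (\<i> * E) * c 1 - c 0" by simp
      then have "cmod (- \<i> * G E) \<le> cmod (exp (\<i> * E)) * cmod (c 1) + cmod (c 0)"
        using norm_triangle_ineq4[of "exp (\<i> * E) * c 1" "c 0"] by (simp only: norm_mult)
      then have "cmod (G E) \<le> exp (- Im E) * cmod (c 1) + cmod (c 0)" by (simp add: norm_mult)
      also have "\<dots> \<le> exp \<bar>Im E\<bar> * cmod (c 1) + exp \<bar>Im E\<bar> * cmod (c 0)"
        by (intro add_mono mult_right_mono) (auto simp: mult_le_cancel_right1 intro: mult_right_mono[of 1 _ "cmod (c 0)", simplified])
      also have "\<dots> = exp \<bar>Im E\<bar> * (cmod (c 1) + cmod (c 0))" by (simp add: distrib_left)
      also have "\<dots> \<le> exp \<bar>Im E\<bar> * (K * exp (- \<nu> * R))"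
        using bil_weight_bound[OF D1 d(1) dw_pos dw_le[OF less_imp_le[OF nu]]]
          bil_weight_bound[OF D0 d(1) dw_pos dw_le[OF less_imp_le[OF nu]]]
        by (intro mult_left_mono) (auto simp: K_def c_def algebra_simps)
      finally show ?thesis by (simp add: mult_ac)
    qed
    have "cmod (G E) \<le> K * exp (- \<nu> * R) * exp (2 * (1 + a))" if E: "cmod (0 - E) = 1" for E
    proof -
      have E1: "\<bar>Im E\<bar> \<le> 1" "\<bar>Re E\<bar> \<le> 1" using abs_Im_le_cmod[of E] abs_Re_le_cmod[of E] E by auto
      have "cmod (G E) \<le> K * exp (- \<nu> * R) * exp (2 * (Re E + a))"
        by (rule sector_maximum[OF lap(1) GB Gb]) (use K E1 in \<open>auto simp: a_def\<close>)
      also have "\<dots> \<le> K * exp (- \<nu> * R) * exp (2 * (1 + a))" using K E1 by (intro mult_left_mono) auto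
      finally show ?thesis .
    qed
    then have "cmod ((deriv ^^ n) G 0) \<le> fact n * (K * exp (- \<nu> * R) * exp (2 * (1 + a))) / 1 ^ n"
      by (intro Cauchy_inequality holomorphic_on_subset[OF lap(1)] continuous_on_subset[OF holomorphic_on_imp_continuous_on[OF lap(1)]]) auto
    then show "cmod (integral {0..1} (\<lambda>t. complex_of_real (t ^ n) * bil (U t f) \<zeta>)) \<le> fact n * (K * exp (2 * (1 + a))) * exp (- \<nu> * R)"
      unfolding lap(2) by (simp add: norm_mult norm_power g_def mult_ac)
  qed
qed

end

section \<open>The moment identity\<close>

lemma smooth_step_exists:
  "\<exists>s. smooth s \<and> (\<forall>x\<le>0. s x = 1) \<and> (\<forall>x\<ge>1. s x = 0)"
proof -
  let ?b = "bump 1 0 1"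
  \<comment> \<open>The step will be \<open>1 - F / F 1\<close>. The lower limit \<open>-1\<close>
    makes every \<open>x \<ge> 0\<close> interior to an interval of integration, while for
    \<open>x < 0\<close> the function \<open>F\<close> vanishes identically.\<close>
  define F where "F x = integral {-1..x} ?b" for x
  have cb: "continuous_on S ?b" for S by (rule smooth_continuous_on[OF smooth_bump])
  have F0: "F x = 0" if "x \<le> 0" for x
  proof -
    have "F x = integral {-1..x} (\<lambda>_. 0)" unfolding F_def
      by (rule integral_cong, rule bump_zero) (use that in auto)
    then show ?thesis by simp
  qed
  have dF: "(F has_real_derivative ?b x) (at x)" for x
  proof (cases "x < 0")
    case True
    have b0: "?b x = 0" by (rule bump_zero) (use True in auto)
    show ?thesis unfolding b0
    proof (rule has_field_derivative_transform_within_open[OF DERIV_const])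
      show "open {..<0::real}" by simp
      show "x \<in> {..<0}" using True by simp
      show "\<And>y. y \<in> {..<0} \<Longrightarrow> 0 = F y" using F0 by simp
    qed
  next
    case False
    have a: "at x within {-1..x+1} = at x" by (rule at_within_interior) (use False in simp)
    have "(F has_real_derivative ?b x) (at x within {-1..x+1})"
      unfolding F_def by (rule integral_has_real_derivative[OF cb]) (use False in auto)
    then show ?thesis unfolding a .
  qed
  \<comment> \<open>The derivative is positive inside the interval, so the mean value theorem gives
    \<open>F 1 > 0\<close>, which permits the division.\<close>
  have "\<exists>z>0. z < 1 \<and> F 1 - F 0 = (1 - 0) * ?b z"
    by (rule MVT2[OF zero_less_one dF])
  then obtain z where z: "0 < z" "z < 1" "F 1 - F 0 = (1 - 0) * ?b z" by blast
  then have F1: "F 1 > 0" using F0[of 0] bump_pos[of 1 0 z 1] by simp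
  have Fc: "F x = F 1" if "x \<ge> 1" for x
  proof (cases "x = 1")
    case False
    with that have x: "1 < x" by simp
    have "\<exists>z>1. z < x \<and> F x - F 1 = (x - 1) * ?b z" by (rule MVT2[OF x dF])
    then obtain z where z: "1 < z" "z < x" "F x - F 1 = (x - 1) * ?b z" by blast
    then show ?thesis using bump_zero[of 1 z 0 1] by simp
  qed simp
  have d: "((\<lambda>x. 1 - F x / F 1) has_real_derivative (- 1 / F 1) * ?b (0 + 1 * x)) (at x)" for x
    using DERIV_diff[OF DERIV_const DERIV_cdivide[OF dF], of 1 "F 1" x] by simp
  have "smooth (\<lambda>x. 1 - F x / F 1)"
    by (rule smooth_antideriv[OF d, OF smooth_affine[OF smooth_bump, of "- 1 / F 1" 1 0 1 0 1]])
  moreover have "1 - F x / F 1 = 1" if "x \<le> 0" for x using F0[OF that] by simp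
  moreover have "1 - F x / F 1 = 0" if "x \<ge> 1" for x using Fc[OF that] F1 by simp
  ultimately show ?thesis by (intro exI[of _ "\<lambda>x. 1 - F x / F 1"]) blast
qed

definition step :: "real \<Rightarrow> real" where
  "step = (SOME s. smooth s \<and> (\<forall>x\<le>0. s x = 1) \<and> (\<forall>x\<ge>1. s x = 0))"

lemma step: "smooth step" "x \<le> 0 \<Longrightarrow> step x = 1" "x \<ge> 1 \<Longrightarrow> step x = 0"
  using someI_ex[OF smooth_step_exists] unfolding step_def[symmetric] by blast+

lemma step_deriv_zero: assumes "x \<notin> {0..1}" shows "deriv step x = 0"
proof (cases "x < 0")
  case True
  show ?thesis by (rule deriv_zero_outside[of "{..<0}" step 1 x]) (use True step(2) in auto)
next
  case False
  show ?thesis by (rule deriv_zero_outside[of "{1<..}" step 0 x]) (use False assms step(3) in auto)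
qed

lemma step_higher_deriv_zero: "x \<notin> {0..1} \<Longrightarrow> (deriv ^^ Suc l) step x = 0"
proof (induction l arbitrary: x)
  case 0 then show ?case using step_deriv_zero by simp
next
  case (Suc l)
  have "deriv ((deriv ^^ Suc l) step) x = 0"
    by (rule deriv_zero_outside[where S="- {0..1}" and c=0]) (use Suc in auto)
  then show ?case by simp
qed

lemma step_bounded: "\<exists>M\<ge>1. \<forall>l\<le>n. \<forall>x. \<bar>(deriv ^^ l) step x\<bar> \<le> M"
proof -
  have b: "\<exists>M. \<forall>x. \<bar>(deriv ^^ l) step x\<bar> \<le> M" for l
  proof -
    obtain C where C: "\<forall>x\<in>{0..1}. \<bar>(deriv ^^ l) step x\<bar> \<le> C"
      by (rule continuous_on_Icc_bounded[OF smooth_continuous_on[OF smooth_higher_deriv[OF step(1)]]])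
    have "\<bar>(deriv ^^ l) step x\<bar> \<le> max C 1" for x
    proof (cases "x \<in> {0..1}")
      case True then show ?thesis using C by (auto simp: le_max_iff_disj)
    next
      case False
      then show ?thesis
      proof (cases l)
        case 0 then show ?thesis using False step(2)[of x] step(3)[of x] by (cases "x \<le> 0") (auto simp: le_max_iff_disj)
      next
        case (Suc k) then show ?thesis using step_higher_deriv_zero[OF False, of k] by (simp add: le_max_iff_disj)
      qed
    qed
    then show ?thesis by blast
  qed
  then obtain M where M: "\<And>l x. \<bar>(deriv ^^ l) step x\<bar> \<le> M l" by metis
  show ?thesis
  proof (intro exI[of _ "Max (insert 1 (M ` {..n}))"] conjI allI impI)
    fix l x assume "l \<le> n"
    then have "M l \<le> Max (insert 1 (M ` {..n}))" by (intro Max_ge) auto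
    then show "\<bar>(deriv ^^ l) step x\<bar> \<le> Max (insert 1 (M ` {..n}))" using M[of l x] by linarith
  qed (intro Max_ge; auto)
qed

text \<open>A cut-off on the right only: the functions to be truncated decay towards
  \<open>-\<infinity>\<close>.\<close>

definition cut :: "real \<Rightarrow> real \<Rightarrow> real" where "cut R x = step (x - R)"

lemma smooth_cut: "smooth (cut R)"
  using smooth_affine[OF step(1), of 1 "-R" 1] by (simp add: cut_def[abs_def])

lemma cut_higher_deriv: "(deriv ^^ l) (cut R) x = (deriv ^^ l) step (x - R)"
proof (induction l arbitrary: x)
  case (Suc l)
  have "((deriv ^^ l) (cut R) has_real_derivative deriv ((deriv ^^ l) step) (x - R) * 1) (at x)"
    unfolding ext[OF Suc.IH]
    by (rule DERIV_chain'[where f="\<lambda>x. x - R"])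
       (auto intro!: derivative_eq_intros smooth_DERIV smooth_higher_deriv step)
  then show ?case using DERIV_imp_deriv by fastforce
qed (simp add: cut_def)

lemma cut_simps: "x \<le> R \<Longrightarrow> cut R x = 1" "x \<ge> R + 1 \<Longrightarrow> cut R x = 0"
  by (auto simp: cut_def step)

text \<open>The factors of \<open>D\<^sup>2\<^sup>m\<close>, all with the fundamental solution on
  the positive half-line; \<open>cvs (ks0 m)\<close> is, up to sign, repeated integration from
  \<open>-\<infinity>\<close>.\<close>

definition ks0 :: "nat \<Rightarrow> (bool \<times> complex) list" where "ks0 m = replicate (2*m) (True, 0)"

text \<open>The inverse of \<open>D\<^sup>2\<^sup>m + W\<close> that integrates from \<open>-\<infinity>\<close>, and the iterates \<open>\<phi>\<^sub>j\<close>.\<close>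

definition Tinv :: "nat \<Rightarrow> (real \<Rightarrow> real) \<Rightarrow> (real \<Rightarrow> complex) \<Rightarrow> real \<Rightarrow> complex" where
  "Tinv m W \<zeta> = cvs (ks0 m) (neu (ks0 m) W \<zeta>)"

definition phs :: "nat \<Rightarrow> (real \<Rightarrow> real) \<Rightarrow> (real \<Rightarrow> complex) \<Rightarrow> nat \<Rightarrow> real \<Rightarrow> complex" where
  "phs m W \<eta> j = (Tinv m W ^^ j) \<eta>"

abbreviation (input) ew :: "real \<Rightarrow> real \<Rightarrow> real" where "ew \<kappa> \<equiv> \<lambda>x. exp (\<kappa> * x)"

lemma char_poly_ks0: "char_poly (ks0 m) = monom 1 (2*m) - [:0:]"
  by (simp add: char_poly_def ks0_def monom_altdef)

text \<open>Each of the \<open>2m\<close> integrations contributes \<open>1 / \<kappa>\<close>,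
  together \<open>1 / (2 r)\<close>. Thus \<open>v \<le> r\<close> is the convergence condition of
  the Neumann series, whose factor 2 leaves the norm \<open>1 / r\<close>.\<close>

lemma Tinv_solve:
  assumes m: "m \<ge> 1" and W: "W \<in> borel_measurable borel" "\<And>x. \<bar>W x\<bar> \<le> v"
    and k: "\<kappa> > 0" and r: "\<kappa> ^ (2*m) = 2 * r" "v \<le> r" and z: "wbd (ew \<kappa>) N \<zeta>"
  shows "wbd (ew \<kappa>) (N / r) (Tinv m W \<zeta>)"
    "\<exists>d. d 0 = Tinv m W \<zeta> \<and> weak_sol m W 0 (ew \<kappa>) \<zeta> d"
proof -
  have r0: "r > 0" using r(1) k zero_less_power[OF k, of "2*m"] by simp
  have len: "length (ks0 m) = 2*m" by (simp add: ks0_def)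
  have M: "(1 / \<kappa>) ^ (2*m) = 1 / (2 * r)" by (simp add: power_divide r(1))
  have v: "v * (1 / \<kappa>) ^ length (ks0 m) \<le> 1/2" unfolding len M using r(2) r0 by (simp add: field_simps)
  have p: "ew \<kappa> x > 0" for x by simp
  have c: "continuous_on UNIV (ew \<kappa>)" by (intro continuous_intros)
  have k1: "0 \<le> 1 / \<kappa>" using k by simp
  have a: "adm (ew \<kappa>) (1 / \<kappa>) (fst q) (snd q)" if "q \<in> set (ks0 m)" for q
    using that adm_exp[OF k] by (auto simp: ks0_def split: if_splits)
  note S = cvs_neu_solves[OF p c k1 a W v z m char_poly_ks0]
  have "wbd (ew \<kappa>) (2 * N * (1 / \<kappa>) ^ (2*m)) (Tinv m W \<zeta>)" unfolding Tinv_def by (rule S(1))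
  then show "wbd (ew \<kappa>) (N / r) (Tinv m W \<zeta>)" unfolding M by simp
  show "\<exists>d. d 0 = Tinv m W \<zeta> \<and> weak_sol m W 0 (ew \<kappa>) \<zeta> d"
    unfolding Tinv_def by (rule S(2))
qed

lemma phs_0 [simp]: "phs m W \<eta> 0 = \<eta>" and phs_Suc: "phs m W \<eta> (Suc j) = Tinv m W (phs m W \<eta> j)"
  by (simp_all add: phs_def)

text \<open>The functions \<open>phs m W \<eta> j\<close> do not depend on \<open>\<kappa>\<close>,
  so \<open>r\<close> may later be chosen separately for every \<open>j\<close>.\<close>

lemma phs_bound:
  assumes m: "m \<ge> 1" and W: "W \<in> borel_measurable borel" "\<And>x. \<bar>W x\<bar> \<le> v"
    and k: "\<kappa> > 0" and r: "\<kappa> ^ (2*m) = 2 * r" "v \<le> r" and e: "wbd (ew \<kappa>) N \<eta>"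
  shows "wbd (ew \<kappa>) (N / r ^ j) (phs m W \<eta> j)"
proof (induction j)
  case (Suc j)
  show ?case using Tinv_solve(1)[OF m W k r Suc] by (simp add: phs_Suc mult.commute)
qed (use e in simp)

text \<open>Left of \<open>R + 1\<close> the weight \<open>exp (\<kappa> x)\<close> is a multiple of
  \<open>dw \<kappa> (R + 1)\<close>, and to the right of it the cut-off vanishes.\<close>

lemma ew_cut_L2:
  assumes k: "\<kappa> > 0" and w: "wbd (ew \<kappa>) N f"
  shows "L2 (\<lambda>x. complex_of_real (cut R x) * f x)"
proof -
  obtain M where M: "M \<ge> 1" "\<forall>l\<le>0. \<forall>x. \<bar>(deriv ^^ l) step x\<bar> \<le> M" using step_bounded[of 0] by blast
  have N: "0 \<le> N" by (rule wbd_nonneg[OF w]) simp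
  show ?thesis
  proof (rule dw_L2[OF k, where R="R+1" and N="M * (N * exp (\<kappa> * (R + 1)))"])
    show "wbd (dw \<kappa> (R + 1)) (M * (N * exp (\<kappa> * (R + 1)))) (\<lambda>x. complex_of_real (cut R x) * f x)"
      unfolding wbd_def
    proof (intro conjI allI)
      note [measurable] = wbd_measurable[OF w] smooth_measurable[OF smooth_cut, of R]
      show "(\<lambda>x. complex_of_real (cut R x) * f x) \<in> borel_measurable borel" by measurable
      fix x
      show "cmod (complex_of_real (cut R x) * f x) \<le> M * (N * exp (\<kappa> * (R + 1))) * dw \<kappa> (R + 1) x"
      proof (cases "x \<ge> R + 1")
        case True then show ?thesis using N M by (simp add: cut_simps less_imp_le[OF dw_pos])
      next
        case False
        then have "exp (\<kappa> * (R + 1)) * dw \<kappa> (R + 1) x = exp (\<kappa> * x)"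
          unfolding dw_def exp_add[symmetric] by (simp add: algebra_simps)
        moreover have "\<bar>cut R x\<bar> * cmod (f x) \<le> M * (N * exp (\<kappa> * x))"
          using M(2)[rule_format, of 0 "x - R"] M(1) wbd_le[OF w, of x] by (intro mult_mono) (auto simp: cut_def)
        ultimately show ?thesis by (simp add: norm_mult mult.assoc)
      qed
    qed
  qed
qed

lemma eta_wbd:
  assumes \<eta>: "\<eta> \<in> borel_measurable borel" "\<And>x. cmod (\<eta> x) \<le> B" "\<And>x. \<bar>x\<bar> > L \<Longrightarrow> \<eta> x = 0" and c: "c > 0"
  shows "wbd (ew c) (B * exp (c * L)) \<eta>"
  unfolding wbd_def
proof (intro conjI allI \<eta>(1))
  fix x
  have B: "B \<ge> 0" using order_trans[OF norm_ge_zero \<eta>(2)] .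
  show "cmod (\<eta> x) \<le> B * exp (c * L) * exp (c * x)"
  proof (cases "\<bar>x\<bar> > L")
    case True then show ?thesis using \<eta>(3) B by simp
  next
    case False
    then have "0 \<le> c * (L + x)" using c by (intro mult_nonneg_nonneg) auto
    then have "1 \<le> exp (c * L) * exp (c * x)" by (simp add: distrib_left flip: exp_add)
    then have "B * 1 \<le> B * (exp (c * L) * exp (c * x))" using B by (intro mult_left_mono)
    then show ?thesis using \<eta>(2)[of x] by (simp add: mult.assoc)
  qed
qed

section \<open>Truncated pairings and integration by parts in time\<close>

context
  fixes m :: nat and V W :: "real \<Rightarrow> real" and v :: real and U and f :: "real \<Rightarrow> complex"
    and \<eta> :: "real \<Rightarrow> complex" and B L \<kappa> :: real
  assumes m: "m \<ge> 1" and grp: "schr_group m V U" and W: "W \<in> borel_measurable borel" "\<And>x. \<bar>W x\<bar> \<le> v"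
    and VW: "AE x in lborel. V x = W x" and f: "L2 f"
    and D0: "\<And>c. integrable lborel (\<lambda>x. cmod (U 0 f x) * exp (c * \<bar>x\<bar>))"
    and D1: "\<And>c. integrable lborel (\<lambda>x. cmod (U 1 f x) * exp (c * \<bar>x\<bar>))"
    and \<eta>: "\<eta> \<in> borel_measurable borel" "\<And>x. cmod (\<eta> x) \<le> B" "\<And>x. \<bar>x\<bar> > L \<Longrightarrow> \<eta> x = 0"
    and \<kappa>: "\<kappa> > 0" "\<kappa> ^ (2*m) = 2 * v"
begin

lemma phs_wbd: "\<exists>N. wbd (ew \<kappa>) N (phs m W \<eta> j)"
  using phs_bound[OF m W \<kappa> order_refl eta_wbd[OF \<eta> \<kappa>(1)]] by blast

definition cc :: "nat \<Rightarrow> nat \<Rightarrow> real \<Rightarrow> complex" where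
  "cc n j t = bil (U t f) (\<lambda>x. complex_of_real (cut (real n) x) * phs m W \<eta> j x)"

text \<open>Commuting the cut-off with \<open>D\<^sup>2\<^sup>m\<close> leaves an error
  \<open>e\<close> on \<open>[n, n + 1]\<close> of order \<open>exp (\<kappa> n)\<close>. It is
  measured with a weight of the larger rate \<open>\<kappa> + 1\<close>, so that the decay of its
  time moments outweighs this growth.\<close>

lemma cc_derivative:
  "\<exists>C>0. \<forall>n. \<exists>e. wbd (dw (\<kappa> + 1) (real n)) (C * exp (\<kappa> * real n)) e \<and>
     (\<forall>t. (cc n (Suc j) has_vector_derivative - \<i> * (cc n j t + bil (U t f) e)) (at t))"
proof -
  obtain N0 where N0: "wbd (ew \<kappa>) N0 (phs m W \<eta> j)" using phs_wbd by blast
  obtain d where d0: "d 0 = phs m W \<eta> (Suc j)" "weak_sol m W 0 (ew \<kappa>) (phs m W \<eta> j) d"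
    using Tinv_solve(2)[OF m W \<kappa> order_refl N0, folded phs_Suc] by (elim exE conjE) (rule that)
  then have d: "d 0 = phs m W \<eta> (Suc j)" "\<forall>l. \<exists>N. wbd (ew \<kappa>) N (d l)" "\<forall>l<2*m. weak_deriv 1 (d l) (d (Suc l))"
    "\<forall>x. (-1)^m * d (2*m) x + complex_of_real (W x) * d 0 x = phs m W \<eta> j x"
    by (simp_all add: weak_sol_def)
  obtain Nf where Nf: "\<And>l. wbd (ew \<kappa>) (Nf l) (d l)" using d(2) by metis
  obtain M where M: "M \<ge> 1" "\<forall>l\<le>2*m. \<forall>x. \<bar>(deriv ^^ l) step x\<bar> \<le> M" using step_bounded by blast
  define N where "N = Max (insert 1 (Nf ` {..2*m}))"
  have N: "N \<ge> 1" unfolding N_def by (intro Max_ge) auto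
  have NN: "wbd (ew \<kappa>) N (d l)" if "l \<le> 2*m" for l
  proof (rule wbd_mono[OF Nf])
    show "Nf l \<le> N" unfolding N_def by (rule Max_ge) (use that in auto)
  qed simp
  \<comment> \<open>The last factor makes up for the weight \<open>dw (\<kappa> + 1) n\<close>,
    which is at least \<open>exp (- (\<kappa> + 1))\<close> on \<open>[n, n + 1]\<close>.\<close>
  define C where "C = 2^(2*m) * (M * (N * exp \<kappa>)) * exp (\<kappa> + 1)"
  have C: "C > 0" unfolding C_def using M N by simp
  have contw: "continuous_on UNIV (ew \<kappa>)" by (intro continuous_intros)
  have ld: "lbd (d l)" for l by (rule wbd_lbd[OF Nf contw])
  have "\<exists>e. wbd (dw (\<kappa> + 1) (real n)) (C * exp (\<kappa> * real n)) e \<and>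
     (\<forall>t. (cc n (Suc j) has_vector_derivative - \<i> * (cc n j t + bil (U t f) e)) (at t))" for n
  proof -
    let ?R = "real n"
    \<comment> \<open>A bound for the chain on the transition interval, where the weight is largest
      at the right end \<open>n + 1\<close>.\<close>
    define K where "K = N * exp (\<kappa> * (?R + 1))"
    have K: "K \<ge> 0" using N by (simp add: K_def)
    have ex: "\<exists>e. lbd e \<and> weak_deriv k (\<lambda>x. complex_of_real (cut ?R x) * d 0 x) (\<lambda>x. complex_of_real (cut ?R x) * d k x + e x) \<and>
       (\<forall>x. cmod (e x) \<le> (2^k - 1) * (M * K)) \<and> (\<forall>x. x \<notin> {?R..?R+1} \<longrightarrow> e x = 0)" if k: "k \<le> 2*m" for k
    proof (rule weak_deriv_cutoff)
      show "smooth (cut ?R)" by (rule smooth_cut)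
      show "\<bar>(deriv ^^ l) (cut ?R) x\<bar> \<le> M" if "l \<le> k" for l x unfolding cut_higher_deriv using M that k by auto
      show "deriv (cut ?R) x = 0" if "x \<notin> {?R..?R+1}" for x
        using cut_higher_deriv[of 1 ?R x] step_deriv_zero[of "x - ?R"] that by auto
      show "cmod (d l x) \<le> K" if "l \<le> k" "x \<in> {?R..?R+1}" for l x
      proof -
        have "cmod (d l x) \<le> N * exp (\<kappa> * x)" by (rule wbd_le[OF NN]) (use that k in auto)
        also have "\<dots> \<le> K" unfolding K_def using that N \<kappa> by (intro mult_left_mono) auto
        finally show ?thesis .
      qed
      show "weak_deriv 1 (d l) (d (Suc l))" if "l < k" for l using d(3) that k by auto
    qed (use ld K M in auto)
    have eL2: "L2 e" if "lbd e" "\<forall>x. cmod (e x) \<le> A" "\<forall>x. x \<notin> {?R..?R+1} \<longrightarrow> e x = 0" for e A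
    proof (rule L2_bounded_compact[where B=A and L="?R+1"])
      show "e \<in> borel_measurable borel" using that lbd_def by blast
      show "cmod (e x) \<le> A * indicator {- (?R + 1)..?R + 1} x" for x
        using that(2)[rule_format, of x] that(3)[rule_format, of x] by (cases "x \<in> {?R..?R+1}") (auto simp: indicator_def)
    qed
    have cL2: "L2 (\<lambda>x. complex_of_real (cut ?R x) * d l x)" for l by (rule ew_cut_L2[OF \<kappa>(1) Nf])
    have cL2j: "L2 (\<lambda>x. complex_of_real (cut ?R x) * phs m W \<eta> j x)" by (rule ew_cut_L2[OF \<kappa>(1) N0])
    have sob: "sobolev (2*m) (\<lambda>x. complex_of_real (cut ?R x) * d 0 x)"
      unfolding sobolev_def
    proof (intro conjI allI impI cL2)
      fix k assume "k \<le> 2*m"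
      from ex[OF this] obtain e where e: "lbd e" "weak_deriv k (\<lambda>x. complex_of_real (cut ?R x) * d 0 x) (\<lambda>x. complex_of_real (cut ?R x) * d k x + e x)"
       "\<forall>x. cmod (e x) \<le> (2^k - 1) * (M * K)" "\<forall>x. x \<notin> {?R..?R+1} \<longrightarrow> e x = 0" by (elim exE conjE) (rule that)
      show "\<exists>g. L2 g \<and> weak_deriv k (\<lambda>x. complex_of_real (cut ?R x) * d 0 x) g"
        by (rule exI[of _ "\<lambda>x. complex_of_real (cut ?R x) * d k x + e x"]) (intro conjI L2_add cL2 eL2[OF e(1,3,4)] e(2))
    qed
    from ex[OF order_refl] obtain e where e: "lbd e" "weak_deriv (2*m) (\<lambda>x. complex_of_real (cut ?R x) * d 0 x) (\<lambda>x. complex_of_real (cut ?R x) * d (2*m) x + e x)"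
       "\<forall>x. cmod (e x) \<le> (2^(2*m) - 1) * (M * K)" "\<forall>x. x \<notin> {?R..?R+1} \<longrightarrow> e x = 0" by (elim exE conjE) (rule that)
    have e2: "L2 e" by (rule eL2[OF e(1,3,4)])
    define e' where "e' x = (-1)^m * e x" for x
    have e'2: "L2 e'" unfolding e'_def by (rule L2_cmult[OF e2])
    have "((\<lambda>t. bil (U t f) (\<lambda>x. complex_of_real (cut ?R x) * d 0 x)) has_vector_derivative
       - \<i> * bil (U t f) (\<lambda>x. complex_of_real (cut ?R x) * phs m W \<eta> j x + e' x)) (at t)" for t
    proof (rule bil_U_derivative[OF grp f sob L2_add[OF cL2 e2] e(2) _ L2_add[OF cL2j e'2]])
      show "ae_eq (\<lambda>x. complex_of_real (cut ?R x) * phs m W \<eta> j x + e' x)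
        (\<lambda>x. (-1)^m * (complex_of_real (cut ?R x) * d (2*m) x + e x) + complex_of_real (V x) * (complex_of_real (cut ?R x) * d 0 x))"
        unfolding ae_eq_def using VW
        by eventually_elim (simp add: d(4)[rule_format, symmetric] e'_def algebra_simps)
    qed
    moreover have "bil (U t f) (\<lambda>x. complex_of_real (cut ?R x) * phs m W \<eta> j x + e' x) = cc n j t + bil (U t f) e'" for t
      using bil_lincomb[OF U_L2[OF grp f] cL2j e'2, of t 1 1] by (simp add: cc_def)
    ultimately have "\<forall>t. (cc n (Suc j) has_vector_derivative - \<i> * (cc n j t + bil (U t f) e')) (at t)"
      by (simp add: cc_def[abs_def] d(1))
    moreover have "wbd (dw (\<kappa> + 1) ?R) (C * exp (\<kappa> * ?R)) e'"
      unfolding wbd_def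
    proof (intro conjI allI)
      show "e' \<in> borel_measurable borel" by (rule L2_measurable[OF e'2])
      fix x
      show "cmod (e' x) \<le> C * exp (\<kappa> * ?R) * dw (\<kappa> + 1) ?R x"
      proof (cases "x \<in> {?R..?R+1}")
        case False then show ?thesis using e(4) C by (simp add: e'_def less_imp_le[OF dw_pos])
      next
        case True
        have "cmod (e' x) \<le> (2^(2*m) - 1) * (M * K)" using e(3) by (simp add: e'_def norm_mult norm_power)
        also have "\<dots> \<le> 2^(2*m) * (M * K)" using M K by (intro mult_right_mono) auto
        also have "\<dots> = 2^(2*m) * (M * (N * exp \<kappa>)) * exp (\<kappa> * ?R) * 1"
          by (simp add: K_def distrib_left exp_add)
        also have "\<dots> \<le> 2^(2*m) * (M * (N * exp \<kappa>)) * exp (\<kappa> * ?R) * (exp (\<kappa> + 1) * dw (\<kappa> + 1) ?R x)"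
        proof (rule mult_left_mono)
          have "(\<kappa> + 1) * \<bar>x - ?R\<bar> \<le> (\<kappa> + 1) * 1" using True \<kappa> by (intro mult_left_mono) auto
          then show "1 \<le> exp (\<kappa> + 1) * dw (\<kappa> + 1) ?R x" unfolding dw_def exp_add[symmetric] by (simp add: algebra_simps)
        qed (use M N in auto)
        also have "\<dots> = C * exp (\<kappa> * ?R) * dw (\<kappa> + 1) ?R x" by (simp add: C_def)
        finally show ?thesis .
      qed
    qed
    ultimately show ?thesis by blast
  qed
  then show ?thesis using C by blast
qed

lemma cc_continuous: "continuous_on S (cc n j)"
proof -
  obtain N where "wbd (ew \<kappa>) N (phs m W \<eta> j)" using phs_wbd by blast
  then show ?thesis unfolding cc_def by (intro bil_U_continuous[OF grp f] ew_cut_L2[OF \<kappa>(1)])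
qed

lemma bil_cut_tendsto:
  assumes D: "\<And>c. integrable lborel (\<lambda>x. cmod (g x) * exp (c * \<bar>x\<bar>))" and g: "g \<in> borel_measurable borel"
  shows "(\<lambda>n. bil g (\<lambda>x. complex_of_real (cut (real n) x) * phs m W \<eta> j x)) \<longlonglongrightarrow> bil g (phs m W \<eta> j)"
proof -
  obtain N where N: "wbd (ew \<kappa>) N (phs m W \<eta> j)" using phs_wbd by blast
  have N0: "0 \<le> N" by (rule wbd_nonneg[OF N]) simp
  obtain M where M: "M \<ge> 1" "\<forall>l\<le>0. \<forall>x. \<bar>(deriv ^^ l) step x\<bar> \<le> M" using step_bounded[of 0] by blast
  note [measurable] = g wbd_measurable[OF N] smooth_measurable[OF smooth_cut]
  show ?thesis unfolding bil_def
  proof (rule integral_dominated_convergence[where w="\<lambda>x. (M * N) * (cmod (g x) * exp (\<kappa> * \<bar>x\<bar>))"])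
    show "integrable lborel (\<lambda>x. (M * N) * (cmod (g x) * exp (\<kappa> * \<bar>x\<bar>)))" using D by (intro integrable_mult_right)
    show "AE x in lborel. (\<lambda>n. g x * (complex_of_real (cut (real n) x) * phs m W \<eta> j x)) \<longlonglongrightarrow> g x * phs m W \<eta> j x"
    proof (rule AE_I2)
      fix x :: real
      obtain k :: nat where k: "x \<le> real k" using real_arch_simple by blast
      have "eventually (\<lambda>n. g x * phs m W \<eta> j x = g x * (complex_of_real (cut (real n) x) * phs m W \<eta> j x)) sequentially"
        by (rule eventually_sequentiallyI[of k]) (use k in \<open>simp add: cut_simps\<close>)
      then show "(\<lambda>n. g x * (complex_of_real (cut (real n) x) * phs m W \<eta> j x)) \<longlonglongrightarrow> g x * phs m W \<eta> j x"
        by (rule Lim_transform_eventually[OF tendsto_const])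
    qed
    fix n
    show "AE x in lborel. norm (g x * (complex_of_real (cut (real n) x) * phs m W \<eta> j x)) \<le> (M * N) * (cmod (g x) * exp (\<kappa> * \<bar>x\<bar>))"
    proof (rule AE_I2)
      fix x
      have "cmod (phs m W \<eta> j x) \<le> N * exp (\<kappa> * \<bar>x\<bar>)"
        using wbd_le[OF N, of x] N0 \<kappa>(1) by (elim order_trans) (intro mult_left_mono; simp)
      then have "\<bar>cut (real n) x\<bar> * cmod (phs m W \<eta> j x) \<le> M * (N * exp (\<kappa> * \<bar>x\<bar>))"
        using M(2)[rule_format, of 0 "x - real n"] M(1) by (intro mult_mono) (auto simp: cut_def)
      then have "cmod (g x) * (\<bar>cut (real n) x\<bar> * cmod (phs m W \<eta> j x)) \<le> cmod (g x) * (M * (N * exp (\<kappa> * \<bar>x\<bar>)))"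
        by (rule mult_left_mono) simp
      then show "norm (g x * (complex_of_real (cut (real n) x) * phs m W \<eta> j x)) \<le> (M * N) * (cmod (g x) * exp (\<kappa> * \<bar>x\<bar>))"
        by (simp add: norm_mult mult_ac)
    qed
  qed measurable
qed

lemma cc_tendsto:
  "(\<lambda>n. cc n j 0) \<longlonglongrightarrow> bil (U 0 f) (phs m W \<eta> j)" "(\<lambda>n. cc n j 1) \<longlonglongrightarrow> bil (U 1 f) (phs m W \<eta> j)"
  unfolding cc_def by (intro bil_cut_tendsto D0 D1 L2_measurable[OF U_L2[OF grp f]])+

text \<open>The errors grow like \<open>exp (\<kappa> n)\<close>, but every time moment gains
  \<open>exp (- (\<kappa> + 1) n)\<close>, so \<open>exp (- n)\<close> remains; a polynomial
  combines finitely many moments.\<close>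

lemma error_tendsto:
  assumes C: "C > 0" and e: "\<And>n. wbd (dw (\<kappa> + 1) (real n)) (C * exp (\<kappa> * real n)) (e n)"
  shows "(\<lambda>n. integral {0..1} (\<lambda>t. poly p (complex_of_real t) * bil (U t f) (e n))) \<longlonglongrightarrow> 0"
proof -
  have nu: "\<kappa> + 1 > 0" using \<kappa> by simp
  have eL: "L2 (e n)" for n by (rule dw_L2[OF nu e])
  have mono: "(\<lambda>n. integral {0..1} (\<lambda>t. complex_of_real (t ^ k) * bil (U t f) (e n))) \<longlonglongrightarrow> 0" for k
  proof -
    obtain A where A: "A \<ge> 0" "\<forall>R \<zeta>. wbd (dw (\<kappa> + 1) R) 1 \<zeta> \<longrightarrow>
      cmod (integral {0..1} (\<lambda>t. complex_of_real (t ^ k) * bil (U t f) \<zeta>)) \<le> A * exp (- (\<kappa> + 1) * R)"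
      using moment_decay[OF m grp W VW f D0 D1 nu, of k] by (elim exE conjE) (rule that)
    have bd: "cmod (integral {0..1} (\<lambda>t. complex_of_real (t ^ k) * bil (U t f) (e n))) \<le> (A * C) * exp (- real n)" for n
    proof -
      define c where "c = C * exp (\<kappa> * real n)"
      have c: "c > 0" using C by (simp add: c_def)
      define \<zeta> where "\<zeta> x = complex_of_real (1 / c) * e n x" for x
      have z: "wbd (dw (\<kappa> + 1) (real n)) 1 \<zeta>"
        using wbd_lincomb[OF e[of n] e[of n], of "complex_of_real (1 / c)" 0] c
        by (simp add: \<zeta>_def[abs_def] norm_divide c_def[symmetric])
      have "bil (U t f) (e n) = complex_of_real c * bil (U t f) \<zeta>" for t
        using bil_lincomb[OF U_L2[OF grp f] eL eL, of t "complex_of_real (1 / c)" n 0 n] c by (simp add: \<zeta>_def[abs_def])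
      then have "integral {0..1} (\<lambda>t. complex_of_real (t ^ k) * bil (U t f) (e n)) = integral {0..1} (\<lambda>t. complex_of_real c * (complex_of_real (t ^ k) * bil (U t f) \<zeta>))"
        by (simp only: mult.left_commute)
      also have "\<dots> = complex_of_real c * integral {0..1} (\<lambda>t. complex_of_real (t ^ k) * bil (U t f) \<zeta>)" by (rule integral_mult_right)
      finally have "cmod (integral {0..1} (\<lambda>t. complex_of_real (t ^ k) * bil (U t f) (e n))) = c * cmod (integral {0..1} (\<lambda>t. complex_of_real (t ^ k) * bil (U t f) \<zeta>))"
        using c by (simp only: norm_mult norm_of_real abs_of_pos)
      also have "\<dots> \<le> c * (A * exp (- (\<kappa> + 1) * real n))" using A(2) z c by (intro mult_left_mono) auto
      also have "\<dots> = (A * C) * (exp (\<kappa> * real n) * exp (- (\<kappa> + 1) * real n))" by (simp add: c_def)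
      also have "exp (\<kappa> * real n) * exp (- (\<kappa> + 1) * real n) = exp (- real n)" unfolding exp_add[symmetric] by (simp add: algebra_simps)
      finally show ?thesis .
    qed
    have "(\<lambda>n. exp (- real n)) \<longlonglongrightarrow> 0"
      by (rule filterlim_compose[OF exp_at_bot]) (simp add: filterlim_uminus_at_bot filterlim_real_sequentially)
    then have "(\<lambda>n. (A * C) * exp (- real n)) \<longlonglongrightarrow> 0" by (rule tendsto_mult_right_zero)
    then show ?thesis by (rule Lim_null_comparison[OF always_eventually[OF allI[OF bd]]])
  qed
  have "integral {0..1} (\<lambda>t. poly p (complex_of_real t) * bil (U t f) (e n)) =
    (\<Sum>k\<le>degree p. coeff p k * integral {0..1} (\<lambda>t. complex_of_real (t ^ k) * bil (U t f) (e n)))" for n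
  proof -
    have "integral {0..1} (\<lambda>t. poly p (complex_of_real t) * bil (U t f) (e n)) =
       integral {0..1} (\<lambda>t. \<Sum>k\<le>degree p. coeff p k * (complex_of_real (t ^ k) * bil (U t f) (e n)))"
      by (simp add: poly_altdef sum_distrib_right mult.assoc)
    also have "\<dots> = (\<Sum>k\<le>degree p. integral {0..1} (\<lambda>t. coeff p k * (complex_of_real (t ^ k) * bil (U t f) (e n))))"
      by (rule integral_sum) (auto intro!: integrable_continuous_real continuous_intros bil_U_continuous[OF grp f eL])
    finally show ?thesis by simp
  qed
  moreover have "(\<lambda>n. \<Sum>k\<le>degree p. coeff p k * integral {0..1} (\<lambda>t. complex_of_real (t ^ k) * bil (U t f) (e n))) \<longlonglongrightarrow> (\<Sum>k\<le>degree p. coeff p k * 0)"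
    by (intro tendsto_sum tendsto_mult tendsto_const mono)
  ultimately show ?thesis by simp
qed

abbreviation (input) al :: "nat \<Rightarrow> complex" where "al j \<equiv> bil (U 0 f) (phs m W \<eta> j)"
abbreviation (input) be :: "nat \<Rightarrow> complex" where "be j \<equiv> bil (U 1 f) (phs m W \<eta> j)"

text \<open>Each integration by parts in time trades one derivative of \<open>p\<close> for one more
  application of \<open>Tinv\<close>. The cut-off errors vanish in the limit, and the process ends
  when the derivative of \<open>p\<close> is 0.\<close>

lemma moment_limit:
  "degree p \<le> k \<Longrightarrow> (\<lambda>n. integral {0..1} (\<lambda>t. poly p (complex_of_real t) * cc n j t)) \<longlonglongrightarrow>
    (\<Sum>l\<le>k. \<i> * (- \<i>)^l * (poly ((pderiv ^^ l) p) 1 * be (Suc (j + l)) - poly ((pderiv ^^ l) p) 0 * al (Suc (j + l))))"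
proof (induction k arbitrary: p j)
  \<comment> \<open>A single integration by parts; \<open>X\<close> is the limit for
    \<open>pderiv p\<close> and the next iterate.\<close>
  have rec: "(\<lambda>n. integral {0..1} (\<lambda>t. poly p (complex_of_real t) * cc n j t)) \<longlonglongrightarrow>
      \<i> * (poly p 1 * be (Suc j) - poly p 0 * al (Suc j)) - \<i> * X"
    if X: "(\<lambda>n. integral {0..1} (\<lambda>t. poly (pderiv p) (complex_of_real t) * cc n (Suc j) t)) \<longlonglongrightarrow> X" for p j X
  proof -
    obtain C where C: "C > 0" "\<forall>n. \<exists>e. wbd (dw (\<kappa> + 1) (real n)) (C * exp (\<kappa> * real n)) e \<and>
       (\<forall>t. (cc n (Suc j) has_vector_derivative - \<i> * (cc n j t + bil (U t f) e)) (at t))"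
      using cc_derivative[of j] by (elim exE conjE) (rule that)
    then obtain e where e: "\<And>n. wbd (dw (\<kappa> + 1) (real n)) (C * exp (\<kappa> * real n)) (e n)"
      "\<And>n t. (cc n (Suc j) has_vector_derivative - \<i> * (cc n j t + bil (U t f) (e n))) (at t)" by metis
    have nu: "\<kappa> + 1 > 0" using \<kappa> by simp
    have eL: "L2 (e n)" for n by (rule dw_L2[OF nu e(1)])
    let ?I = "\<lambda>n. integral {0..1} (\<lambda>t. poly p (complex_of_real t) * cc n j t)"
    let ?J = "\<lambda>n. integral {0..1} (\<lambda>t. poly (pderiv p) (complex_of_real t) * cc n (Suc j) t)"
    let ?E = "\<lambda>n. integral {0..1} (\<lambda>t. poly p (complex_of_real t) * bil (U t f) (e n))"
    have "?I n = \<i> * (poly p 1 * cc n (Suc j) 1 - poly p 0 * cc n (Suc j) 0) - \<i> * ?J n - ?E n" for n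
    proof -
      let ?a = "\<lambda>t. poly p (complex_of_real t) * cc n j t" and ?b = "\<lambda>t. poly (pderiv p) (complex_of_real t) * cc n (Suc j) t"
        and ?c = "\<lambda>t. poly p (complex_of_real t) * bil (U t f) (e n)"
      have ia: "?a integrable_on {0..1}" "?b integrable_on {0..1}" "?c integrable_on {0..1}"
        by (auto intro!: integrable_continuous_real continuous_intros cc_continuous bil_U_continuous[OF grp f eL])
      have p': "((\<lambda>t. poly p (complex_of_real t)) has_vector_derivative poly (pderiv p) (complex_of_real t)) (at t)" for t
        by (rule has_vector_derivative_real_field[OF poly_DERIV])
      have "((\<lambda>t. poly p (complex_of_real t) * cc n (Suc j) t) has_vector_derivative ?b t + (- \<i>) * (?a t + ?c t)) (at t within {0..1})" for t
        by (rule has_vector_derivative_at_within) (use has_vector_derivative_mult[OF p' e(2), of n t] in \<open>simp add: algebra_simps\<close>)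
      then have A: "((\<lambda>t. ?b t + (- \<i>) * (?a t + ?c t)) has_integral poly p (complex_of_real 1) * cc n (Suc j) 1 - poly p (complex_of_real 0) * cc n (Suc j) 0) {0..1}"
        by (intro fundamental_theorem_of_calculus) auto
      have "((\<lambda>t. ?b t + (- \<i>) * (?a t + ?c t)) has_integral ?J n + (- \<i>) * (?I n + ?E n)) {0..1}"
        by (intro has_integral_add has_integral_mult_right integrable_integral ia)
      from has_integral_unique[OF this A] have "?J n + (- \<i>) * (?I n + ?E n) = poly p 1 * cc n (Suc j) 1 - poly p 0 * cc n (Suc j) 0"
        by simp
      moreover have "I = \<i> * D - \<i> * J - E" if "J + (- \<i>) * (I + E) = D" for I J E D :: complex
        unfolding that[symmetric] by (simp add: algebra_simps)
      ultimately show ?thesis by blast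
    qed
    moreover have "(\<lambda>n. \<i> * (poly p 1 * cc n (Suc j) 1 - poly p 0 * cc n (Suc j) 0) - \<i> * ?J n - ?E n) \<longlonglongrightarrow>
       \<i> * (poly p 1 * be (Suc j) - poly p 0 * al (Suc j)) - \<i> * X - 0"
      by (intro tendsto_intros cc_tendsto X error_tendsto[OF C(1) e(1)])
    ultimately show ?thesis by simp
  qed
  {
    case 0
    then have "pderiv p = 0" by (simp add: pderiv_eq_0_iff)
    then show ?case using rec[of p j 0] by simp
  next
    case (Suc k)
    have "degree (pderiv p) \<le> k" using Suc.prems by (simp add: degree_pderiv)
    from rec[OF Suc.IH[OF this, of "Suc j"]] show ?case
      unfolding sum.atMost_Suc_shift[of _ k] funpow_Suc_right o_apply sum_distrib_left
      by (simp del: funpow.simps add: sum_negf mult.assoc)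
  }
qed

text \<open>For \<open>n \<ge> L\<close> the cut-off is 1 on the support of \<open>\<eta>\<close>,
  so at \<open>j = 0\<close> the sequence of \<open>moment_limit\<close> is eventually
  constant.\<close>

lemma moment_identity:
  "integral {0..1} (\<lambda>t. poly p (complex_of_real t) * bil (U t f) \<eta>) =
    (\<Sum>l\<le>degree p. \<i> * (- \<i>)^l * (poly ((pderiv ^^ l) p) 1 * be (Suc l) - poly ((pderiv ^^ l) p) 0 * al (Suc l)))"
proof -
  obtain k :: nat where k: "L \<le> real k" using real_arch_simple by blast
  have "(\<lambda>x. complex_of_real (cut (real n) x) * \<eta> x) = \<eta>" if "n \<ge> k" for n
  proof
    fix x show "complex_of_real (cut (real n) x) * \<eta> x = \<eta> x"
      using \<eta>(3)[of x] cut_simps(1)[of x "real n"] k that by (cases "\<bar>x\<bar> > L") auto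
  qed
  then have "eventually (\<lambda>n. integral {0..1} (\<lambda>t. poly p (complex_of_real t) * cc n 0 t) = integral {0..1} (\<lambda>t. poly p (complex_of_real t) * bil (U t f) \<eta>)) sequentially"
    by (intro eventually_sequentiallyI[of k]) (simp add: cc_def)
  from Lim_transform_eventually[OF moment_limit[OF order_refl, of p 0] this] show ?thesis
    by (simp add: LIMSEQ_const_iff)
qed

end

section \<open>Conclusion\<close>

text \<open>
  The integrals of the humps over \<open>[1/2 - d/2, 1/2 + d/2]\<close> decay only like \<open>(1 - d\<^sup>2/4)\<^sup>N\<close>, which for
  small \<open>d\<close> is slower than \<open>(9/10)\<^sup>N\<close>.
\<close>

lemma concentration_at_half:
  fixes g :: "real \<Rightarrow> complex"
  assumes g: "continuous_on {0..1} g"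
    and b: "\<And>N. cmod (integral {0..1} (\<lambda>t. complex_of_real ((1 - (t - 1/2)^2) ^ N) * g t)) \<le> C * (9/10) ^ N"
  shows "g (1/2) = 0"
proof (rule ccontr)
  assume nz: "g (1/2) \<noteq> 0"
  define a where "a = cnj (g (1/2))"
  define A where "A = (cmod (g (1/2)))^2"
  have A: "A > 0" using nz by (simp add: A_def)
  have gA: "Re (a * g (1/2)) = A" by (simp add: a_def A_def cmod_power2) (simp add: power2_eq_square)
  define h where "h t = Re (a * g t)" for t
  have h: "continuous_on {0..1} h" unfolding h_def by (intro continuous_intros g)
  obtain H where H: "\<forall>t\<in>{0..1}. \<bar>h t\<bar> \<le> H" by (rule continuous_on_Icc_bounded[OF h])
  have H0: "H \<ge> 0" using H[rule_format, of 0] by auto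
  have cont: "\<forall>x\<in>{0..1}. \<forall>e>0. \<exists>d>0. \<forall>t\<in>{0..1}. dist t x < d \<longrightarrow> dist (h t) (h x) < e"
    using h unfolding continuous_on_iff .
  have "\<exists>d>0. \<forall>t\<in>{0..1}. dist t (1/2) < d \<longrightarrow> dist (h t) (h (1/2)) < A / 2"
    by (rule cont[rule_format]) (use A in auto)
  then obtain d0 where d0: "d0 > 0" "\<forall>t\<in>{0..1}. dist t (1/2) < d0 \<longrightarrow> dist (h t) (h (1/2)) < A / 2"
    by (elim exE conjE) (rule that)
  define d where "d = min (d0 / 2) (1/4)"
  have d: "d > 0" "d \<le> 1/4" "d < d0" using d0(1) by (auto simp: d_def)
  have hd: "h t \<ge> A / 2" if "\<bar>t - 1/2\<bar> \<le> d" "t \<in> {0..1}" for t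
  proof -
    have "dist t (1/2) < d0" using that d by (simp add: dist_real_def)
    then have "dist (h t) (h (1/2)) < A / 2" using d0(2) that by blast
    then show ?thesis using gA unfolding h_def[of "1/2"] dist_real_def by linarith
  qed
  let ?q = "\<lambda>t. 1 - (t - 1/2)^2 :: real"
  have q0: "0 \<le> ?q t" if "t \<in> {0..1}" for t
  proof -
    have "\<bar>t - 1/2\<bar> \<le> 1" using that by auto
    then have "(t - 1/2)^2 \<le> 1" by (simp add: abs_square_le_1)
    then show ?thesis by simp
  qed
  have key: "d * (A / 2 * (1 - d^2/4) ^ N) \<le> cmod a * C * (9/10)^N + H * (1 - d^2) ^ N" for N
  proof -
    \<comment> \<open>The added constant outweighs negative values outside
      \<open>[1/2 - d, 1/2 + d]\<close>. Hence \<open>F \<ge> 0\<close>, and its integral may be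
      restricted to the concentric interval of half the width.\<close>
    define F where "F t = ?q t ^ N * h t + H * (1 - d^2) ^ N" for t
    have d2: "d^2 \<le> 1" using d by (simp add: power_le_one)
    have F: "continuous_on {0..1} F" unfolding F_def by (intro continuous_intros h)
    have Fpos: "0 \<le> F t" if t: "t \<in> {0..1}" for t
    proof (cases "\<bar>t - 1/2\<bar> \<le> d")
      case True
      then show ?thesis unfolding F_def using hd[OF True t] q0[OF t] A H0 d2 by (intro add_nonneg_nonneg mult_nonneg_nonneg) auto
    next
      case False
      then have "d^2 \<le> \<bar>t - 1/2\<bar>^2" using d by (intro power_mono) auto
      then have "?q t ^ N \<le> (1 - d^2) ^ N" using q0[OF t] by (intro power_mono) auto
      moreover have "\<bar>?q t ^ N * h t\<bar> \<le> ?q t ^ N * H"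
        using H t q0[OF t] by (auto simp: abs_mult power_abs intro!: mult_left_mono)
      ultimately have "\<bar>?q t ^ N * h t\<bar> \<le> (1 - d^2) ^ N * H" using H0 by (meson mult_right_mono order_trans)
      then show ?thesis unfolding F_def by (simp add: mult.commute)
    qed
    let ?l = "1/2 - d/2" and ?u = "1/2 + d/2"
    have sub: "{?l..?u} \<subseteq> {0..1}" using d by auto
    have Fi: "F integrable_on {0..1}" "F integrable_on {?l..?u}"
      using integrable_continuous_real[OF F] integrable_continuous_real[OF continuous_on_subset[OF F sub]] by auto
    have "d * (A / 2 * (1 - d^2/4) ^ N) = integral {?l..?u} (\<lambda>_. A / 2 * (1 - d^2/4) ^ N)" using d by simp
    also have "\<dots> \<le> integral {?l..?u} F"
    proof (rule integral_le[OF _ Fi(2)])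
      show "(\<lambda>_. A / 2 * (1 - d^2/4) ^ N) integrable_on {?l..?u}" by (rule integrable_continuous_real) (rule continuous_on_const)
      fix t assume t: "t \<in> {?l..?u}"
      then have t1: "t \<in> {0..1}" using sub by blast
      have t2: "\<bar>t - 1/2\<bar> \<le> d / 2" using t unfolding atLeastAtMost_iff abs_le_iff by linarith
      then have "\<bar>t - 1/2\<bar>^2 \<le> (d/2)^2" by (intro power_mono) auto
      then have "1 - d^2/4 \<le> ?q t" by (simp add: power_divide)
      moreover have "0 \<le> 1 - d^2/4" using d2 by simp
      ultimately have "(1 - d^2/4) ^ N \<le> ?q t ^ N" by (intro power_mono)
      moreover have "A / 2 \<le> h t" using t2 d t1 by (intro hd) auto
      ultimately have "A / 2 * (1 - d^2/4) ^ N \<le> h t * ?q t ^ N" using A \<open>0 \<le> 1 - d^2/4\<close> by (intro mult_mono) auto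
      moreover have "0 \<le> H * (1 - d^2) ^ N" using H0 d2 by simp
      ultimately show "A / 2 * (1 - d^2/4) ^ N \<le> F t" unfolding F_def by (simp add: mult.commute)
    qed
    also have "\<dots> \<le> integral {0..1} F" by (rule integral_subset_le[OF sub Fi(2,1)]) (use Fpos in auto)
    also have "\<dots> = integral {0..1} (\<lambda>t. ?q t ^ N * h t) + integral {0..1} (\<lambda>_::real. H * (1 - d^2) ^ N)"
      unfolding F_def by (rule Henstock_Kurzweil_Integration.integral_add) (auto intro!: integrable_continuous_real continuous_intros h)
    also have "integral {0..1} (\<lambda>_::real. H * (1 - d^2) ^ N) = H * (1 - d^2) ^ N" by simp
    also have "integral {0..1} (\<lambda>t. ?q t ^ N * h t) = Re (a * integral {0..1} (\<lambda>t. complex_of_real (?q t ^ N) * g t))"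
    proof -
      have i: "(\<lambda>t. complex_of_real (?q t ^ N) * g t) integrable_on {0..1}"
        by (intro integrable_continuous_real continuous_intros g)
      have hi: "((\<lambda>t. Re (a * (complex_of_real (?q t ^ N) * g t))) has_integral Re (a * integral {0..1} (\<lambda>t. complex_of_real (?q t ^ N) * g t))) {0..1}"
        by (intro has_integral_Re has_integral_mult_right integrable_integral i)
      have "Re (a * (complex_of_real c * z)) = c * Re (a * z)" for c z by (simp add: algebra_simps)
      then show ?thesis using integral_unique[OF hi] by (simp only: h_def)
    qed
    also have "\<dots> \<le> cmod (a * integral {0..1} (\<lambda>t. complex_of_real (?q t ^ N) * g t))" by (rule complex_Re_le_cmod)
    also have "\<dots> \<le> cmod a * (C * (9/10)^N)" unfolding norm_mult by (intro mult_left_mono b) auto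
    finally show ?thesis by simp
  qed
  \<comment> \<open>As \<open>d \<le> 1/4\<close>, \<open>D\<close> exceeds both \<open>9/10\<close>
    and \<open>1 - d^2\<close>; after division by \<open>D ^ N\<close> the right-hand side of
    \<open>key\<close> tends to 0 while the left-hand side stays fixed.\<close>
  define D where "D = 1 - d^2/4"
  have dd: "d^2 \<le> 1/16" "d^2 > 0" using power_mono[of d "1/4" 2] d by (auto simp: power2_eq_square)
  have D: "D > 0" "9/10 < D" "1 - d^2 < D" "0 \<le> 1 - d^2" using dd by (auto simp: D_def)
  have "(\<lambda>N. cmod a * C * ((9/10) / D)^N + H * ((1 - d^2) / D)^N) \<longlonglongrightarrow> cmod a * C * 0 + H * 0"
    using D by (intro tendsto_intros LIMSEQ_power_zero) (auto simp: abs_mult)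
  moreover have "d * (A / 2) \<le> cmod a * C * ((9/10) / D)^N + H * ((1 - d^2) / D)^N" for N
    using key[of N] D(1) unfolding D_def[symmetric] by (simp add: power_divide field_simps)
  ultimately have "d * (A / 2) \<le> 0" by (intro LIMSEQ_le_const[of _ "cmod a * C * 0 + H * 0", simplified]) auto
  then show False using d A by (simp add: mult_le_0_iff)
qed

text \<open>Young's inequality for the conjugate exponents \<open>2m / (2m - 1)\<close> and
  \<open>2m\<close> with simple constants. On either side of
  \<open>y = (2 \<kappa> / \<gamma>) ^ (2m - 1)\<close> one of the two terms alone suffices.\<close>

lemma young_type:
  fixes y \<kappa> \<gamma> :: real
  assumes m: "m \<ge> 1" and y: "y \<ge> 0" and k: "\<kappa> \<ge> 0" and g: "\<gamma> > 0"
  shows "\<kappa> * y \<le> \<gamma> / 2 * y powr (real (2*m) / real (2*m - 1)) + (2 / \<gamma>) ^ (2*m - 1) * \<kappa> ^ (2*m)"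
proof -
  define q where "q = 2*m - 1"
  have q: "q \<ge> 1" "2*m = Suc q" using m by (auto simp: q_def)
  have p: "real (2*m) / real (2*m - 1) = 1 + 1 / real q" unfolding q_def[symmetric] q(2) using q(1) by (simp add: field_simps)
  show ?thesis
  proof (cases "y \<le> (2 * \<kappa> / \<gamma>) ^ q")
    case True
    have "\<kappa> * y \<le> \<kappa> * (2 * \<kappa> / \<gamma>) ^ q" using True k by (intro mult_left_mono)
    also have "\<dots> = (2 / \<gamma>) ^ q * \<kappa> ^ Suc q" by (simp add: power_divide power_mult_distrib)
    finally show ?thesis unfolding q_def[symmetric] q(2) using g by (simp add: add_increasing)
  next
    case False
    have pos: "0 \<le> 2 * \<kappa> / \<gamma>" using k g by simp
    have y0: "y > 0" using False zero_le_power[OF pos, of q] by linarith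
    have "2 * \<kappa> / \<gamma> \<le> y powr (1 / real q)"
    proof (cases "\<kappa> = 0")
      case False
      then have pp: "0 < 2 * \<kappa> / \<gamma>" using k g by simp
      have "z = (z ^ q) powr (1 / real q)" if "z > 0" for z :: real
        using that q(1) by (simp add: powr_powr flip: powr_realpow)
      from this[OF pp] have "2 * \<kappa> / \<gamma> = ((2 * \<kappa> / \<gamma>) ^ q) powr (1 / real q)" .
      also have "\<dots> \<le> y powr (1 / real q)" using \<open>\<not> y \<le> (2 * \<kappa> / \<gamma>) ^ q\<close> pp by (intro powr_mono2) auto
      finally show ?thesis .
    qed simp
    then have "\<gamma> / 2 * y * (2 * \<kappa> / \<gamma>) \<le> \<gamma> / 2 * y * y powr (1 / real q)" using g y0 by (intro mult_left_mono) auto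
    moreover have "\<gamma> / 2 * y * (2 * \<kappa> / \<gamma>) = \<kappa> * y" using g by simp
    moreover have "y * y powr (1 / real q) = y powr (1 + 1 / real q)" using y0 by (simp add: powr_add)
    moreover have "0 \<le> (2 / \<gamma>) ^ (2*m - 1) * \<kappa> ^ (2*m)" using g k by simp
    ultimately show ?thesis unfolding p by (simp add: mult.assoc)
  qed
qed

text \<open>Half of the weight pays for passing from square integrability to integrability:
  \<open>exp (- \<gamma>/2 |x|^p)\<close> is itself square integrable, and products of such
  functions are integrable.\<close>

lemma weighted_integrable:
  assumes m: "m \<ge> 1" and g: "\<gamma> > 0" and u: "u \<in> borel_measurable borel"
    and w: "L2 (\<lambda>x. complex_of_real (exp (\<gamma> * \<bar>x\<bar> powr (real (2*m) / real (2*m - 1)))) * u x)"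
  shows "integrable lborel (\<lambda>x. cmod (u x) * exp (\<gamma> / 2 * \<bar>x\<bar> powr (real (2*m) / real (2*m - 1))))"
proof -
  let ?p = "real (2*m) / real (2*m - 1)"
  have p: "?p \<ge> 1" using m by simp
  let ?e = "\<lambda>x. complex_of_real (exp (- (\<gamma> / 2) * \<bar>x\<bar> powr ?p))"
  have "L2 ?e"
  proof (rule L2_dominated)
    show "?e \<in> borel_measurable borel" by measurable
    show "integrable lborel (\<lambda>x. exp \<gamma> * exp (- \<gamma> * \<bar>0 - x\<bar>))" using exp_abs_integral(1)[OF g, of 0] by (rule integrable_mult_right)
    fix x :: real
    have "\<bar>x\<bar> - 1 \<le> \<bar>x\<bar> powr ?p"
    proof (cases "\<bar>x\<bar> \<ge> 1")
      case True
      then have "\<bar>x\<bar> powr 1 \<le> \<bar>x\<bar> powr ?p" using p by (intro powr_mono)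
      then show ?thesis using True by simp
    next
      case False then show ?thesis using powr_ge_zero[of "\<bar>x\<bar>" ?p] by linarith
    qed
    then have "\<gamma> * (\<bar>x\<bar> - 1) \<le> \<gamma> * \<bar>x\<bar> powr ?p" using g by (intro mult_left_mono) auto
    then have "2 * (- (\<gamma> / 2) * \<bar>x\<bar> powr ?p) \<le> \<gamma> + - \<gamma> * \<bar>0 - x\<bar>" by (simp add: algebra_simps)
    then have "exp (2 * (- (\<gamma> / 2) * \<bar>x\<bar> powr ?p)) \<le> exp (\<gamma> + - \<gamma> * \<bar>0 - x\<bar>)" by (simp only: exp_le_cancel_iff)
    then show "(cmod (?e x))^2 \<le> exp \<gamma> * exp (- \<gamma> * \<bar>0 - x\<bar>)"
      unfolding exp_double exp_add by (simp only: norm_of_real abs_exp_cancel)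
  qed
  from L2_mult_integrable[OF w this]
  have "integrable lborel (\<lambda>x. cmod (complex_of_real (exp (\<gamma> * \<bar>x\<bar> powr ?p)) * u x * ?e x))" by (rule integrable_norm)
  moreover have "cmod (complex_of_real (exp (\<gamma> * \<bar>x\<bar> powr ?p)) * u x * ?e x) = cmod (u x) * exp (\<gamma> / 2 * \<bar>x\<bar> powr ?p)" for x
  proof -
    have "exp (\<gamma> * \<bar>x\<bar> powr ?p) * exp (- (\<gamma> / 2) * \<bar>x\<bar> powr ?p) = exp (\<gamma> / 2 * \<bar>x\<bar> powr ?p)"
      unfolding exp_add[symmetric] by (simp add: algebra_simps)
    then show ?thesis by (simp only: norm_mult norm_of_real abs_exp_cancel) (simp only: mult_ac)
  qed
  ultimately show ?thesis by simp
qed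

text \<open>Young's inequality trades \<open>exp (c |x|)\<close> for the remaining half of the
  weight, at the cost of a constant factor.\<close>

lemma exp_weight_integral:
  assumes m: "m \<ge> 1" and g: "\<gamma> > 0" and u: "u \<in> borel_measurable borel"
    and I: "integrable lborel (\<lambda>x. cmod (u x) * exp (\<gamma> / 2 * \<bar>x\<bar> powr (real (2*m) / real (2*m - 1))))"
  shows "integrable lborel (\<lambda>x. cmod (u x) * exp (c * \<bar>x\<bar>))"
    "c \<ge> 0 \<Longrightarrow> (LINT x|lborel. cmod (u x) * exp (c * \<bar>x\<bar>)) \<le>
       exp ((2 / \<gamma>) ^ (2*m - 1) * c ^ (2*m)) * (LINT x|lborel. cmod (u x) * exp (\<gamma> / 2 * \<bar>x\<bar> powr (real (2*m) / real (2*m - 1))))"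
proof -
  let ?p = "real (2*m) / real (2*m - 1)"
  let ?w = "\<lambda>x. cmod (u x) * exp (\<gamma> / 2 * \<bar>x\<bar> powr ?p)" and ?K = "\<lambda>c. exp ((2 / \<gamma>) ^ (2*m - 1) * (max c 0) ^ (2*m))"
  have le: "cmod (u x) * exp (c * \<bar>x\<bar>) \<le> ?K c * ?w x" for c x
  proof -
    have "c * \<bar>x\<bar> \<le> max c 0 * \<bar>x\<bar>" by (intro mult_right_mono) auto
    also have "\<dots> \<le> \<gamma> / 2 * \<bar>x\<bar> powr ?p + (2 / \<gamma>) ^ (2*m - 1) * (max c 0) ^ (2*m)"
      by (rule young_type[OF m _ _ g]) auto
    finally have "exp (c * \<bar>x\<bar>) \<le> exp (\<gamma> / 2 * \<bar>x\<bar> powr ?p) * ?K c"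
      by (simp only: exp_le_cancel_iff exp_add[symmetric])
    then have "cmod (u x) * exp (c * \<bar>x\<bar>) \<le> cmod (u x) * (exp (\<gamma> / 2 * \<bar>x\<bar> powr ?p) * ?K c)"
      by (intro mult_left_mono) auto
    then show ?thesis by (simp only: mult_ac)
  qed
  have i: "integrable lborel (\<lambda>x. ?K c * ?w x)" for c
    using I by (rule integrable_mult_right)
  note [measurable] = u
  show 1: "integrable lborel (\<lambda>x. cmod (u x) * exp (c * \<bar>x\<bar>))" for c
  proof (rule Bochner_Integration.integrable_bound[OF i[of c]])
    show "AE x in lborel. norm (cmod (u x) * exp (c * \<bar>x\<bar>)) \<le> norm (?K c * ?w x)"
    proof (rule AE_I2)
      fix x show "norm (cmod (u x) * exp (c * \<bar>x\<bar>)) \<le> norm (?K c * ?w x)"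
        using le[of x c] by (simp add: abs_mult)
    qed
  qed measurable
  assume c: "c \<ge> 0"
  have "(LINT x|lborel. cmod (u x) * exp (c * \<bar>x\<bar>)) \<le> (LINT x|lborel. ?K c * ?w x)"
    by (rule integral_mono[OF 1 i le])
  then show "(LINT x|lborel. cmod (u x) * exp (c * \<bar>x\<bar>)) \<le>
       exp ((2 / \<gamma>) ^ (2*m - 1) * c ^ (2*m)) * (LINT x|lborel. cmod (u x) * exp (\<gamma> / 2 * \<bar>x\<bar> powr ?p))"
    using c by (simp only: Bochner_Integration.integral_mult_right_zero max_absorb1)
qed

text \<open>The iterates are bounded by a multiple of \<open>r^-j exp (\<kappa> x)\<close>, and
  pairing with \<open>g\<close> costs a factor \<open>exp \<epsilon>\<close> with
  \<open>\<epsilon>\<close> a small multiple of \<open>r\<close>. Taking \<open>r\<close>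
  proportional to \<open>j\<close> leaves \<open>j^-j\<close>, which absorbs
  \<open>fact j\<close>.\<close>

lemma pairing_factorial_decay:
  assumes m: "m \<ge> 1" and W: "W \<in> borel_measurable borel" "\<And>x. \<bar>W x\<bar> \<le> v"
    and \<eta>: "\<eta> \<in> borel_measurable borel" "\<And>x. cmod (\<eta> x) \<le> B" "\<And>x. \<bar>x\<bar> > L \<Longrightarrow> \<eta> x = 0" and L: "L \<ge> 0"
    and \<gamma>: "\<gamma> > 384" and g: "g \<in> borel_measurable borel"
    and I: "integrable lborel (\<lambda>x. cmod (g x) * exp (\<gamma> / 2 * \<bar>x\<bar> powr (real (2*m) / real (2*m - 1))))"
  shows "\<exists>K\<ge>0. \<forall>j\<ge>1. cmod (bil g (phs m W \<eta> j)) * fact j \<le> K / 16 ^ j"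
proof -
  let ?p = "real (2*m) / real (2*m - 1)"
  define A where "A = (LINT x|lborel. cmod (g x) * exp (\<gamma> / 2 * \<bar>x\<bar> powr ?p))"
  have A: "A \<ge> 0" unfolding A_def by (rule integral_nonneg_AE) auto
  have B: "B \<ge> 0" using order_trans[OF norm_ge_zero \<eta>(2)] .
  have v: "v \<ge> 0" using W(2)[of 0] by linarith
  have g0: "\<gamma> > 0" using \<gamma> by simp
  define K where "K = B * exp (\<gamma> / 2 * L powr ?p) * A * exp (v / 48)"
  have K: "K \<ge> 0" unfolding K_def using A B by simp
  have "cmod (bil g (phs m W \<eta> j)) * fact j \<le> K / 16 ^ j" if j: "j \<ge> 1" for j
  proof -
    \<comment> \<open>minimises \<open>r\<^sup>-\<^sup>j exp (r / 48)\<close> up to the shift by \<open>v\<close>\<close>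
    define r where "r = 48 * real j + v"
    have r: "r > 0" "v \<le> r" using j v by (auto simp: r_def)
    define \<kappa> where "\<kappa> = root (2*m) (2 * r)"
    have k: "\<kappa> > 0" unfolding \<kappa>_def using r m by (intro real_root_gt_zero) auto
    have kr: "\<kappa> ^ (2*m) = 2 * r" unfolding \<kappa>_def using r m by (intro real_root_pow_pos) auto
    define \<epsilon> where "\<epsilon> = (2 / \<gamma>) ^ (2*m - 1) * \<kappa> ^ (2*m)"
    \<comment> \<open>From \<open>\<gamma> > 384\<close> the coefficient is at most
      \<open>1/192\<close>, and \<open>\<kappa>\<^sup>2\<^sup>m = 2 r\<close>. The factor 2 is there
      because \<open>exp \<epsilon>\<close> arises twice: from the integral of \<open>g\<close> and
      from the support of \<open>\<eta>\<close>.\<close>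
    have eps: "2 * \<epsilon> \<le> r / 48"
    proof -
      have a: "2 / \<gamma> \<le> 1 / 192" "0 \<le> 2 / \<gamma>" "2 / \<gamma> \<le> 1" using \<gamma> by (auto simp: field_simps)
      have "(2 / \<gamma>) ^ (2*m - 1) \<le> (2 / \<gamma>) ^ 1" by (rule power_decreasing) (use a m in auto)
      then have "(2 / \<gamma>) ^ (2*m - 1) \<le> 1 / 192" using a by simp
      then have "\<epsilon> \<le> 1 / 192 * (2 * r)" unfolding \<epsilon>_def kr using r by (intro mult_right_mono) auto
      then show ?thesis by simp
    qed
    have w: "wbd (ew \<kappa>) (B * exp (\<kappa> * L) / r ^ j) (phs m W \<eta> j)"
      by (rule phs_bound[OF m W k kr r(2) eta_wbd[OF \<eta> k]])
    note E = exp_weight_integral[OF m g0 g I]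
    have "cmod (bil g (phs m W \<eta> j)) \<le> B * exp (\<kappa> * L) / r ^ j * (LINT x|lborel. cmod (g x) * exp (\<kappa> * \<bar>x\<bar>))"
      using bil_weight_bound[OF E(1) w, of 1 \<kappa>] k by simp
    also have "\<dots> \<le> B * exp (\<kappa> * L) / r ^ j * (exp \<epsilon> * A)"
      using E(2)[of \<kappa>] k B r unfolding \<epsilon>_def A_def by (intro mult_left_mono) auto
    also have "\<dots> \<le> B * (exp (\<gamma> / 2 * L powr ?p) * exp \<epsilon>) / r ^ j * (exp \<epsilon> * A)"
    proof -
      have "\<kappa> * L \<le> \<gamma> / 2 * L powr ?p + \<epsilon>" unfolding \<epsilon>_def by (rule young_type[OF m L _ g0]) (use k in simp)
      then have "exp (\<kappa> * L) \<le> exp (\<gamma> / 2 * L powr ?p) * exp \<epsilon>" by (simp only: exp_le_cancel_iff exp_add[symmetric])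
      then show ?thesis using A B r by (intro mult_right_mono divide_right_mono mult_left_mono) auto
    qed
    also have "\<dots> = B * exp (\<gamma> / 2 * L powr ?p) * A * (exp \<epsilon> * exp \<epsilon>) / r ^ j" by simp
    also have "\<dots> \<le> B * exp (\<gamma> / 2 * L powr ?p) * A * (exp (v / 48) * 3 ^ j) / (48 * real j) ^ j"
    proof (rule frac_le)
      \<comment> \<open>By the choice of \<open>r\<close>, \<open>r / 48\<close> is
        \<open>j + v / 48\<close>; with \<open>exp 1 \<le> 3\<close> the dependence on
        \<open>j\<close> becomes \<open>3^j / (48 j)^j = 1 / (16 j)^j\<close>.\<close>
      have "exp \<epsilon> * exp \<epsilon> \<le> exp (v / 48 + real j)" unfolding exp_add[symmetric] using eps by (simp add: r_def)
      also have "\<dots> = exp (v / 48) * exp 1 ^ j" by (simp add: exp_add exp_of_nat_mult[symmetric])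
      also have "\<dots> \<le> exp (v / 48) * 3 ^ j" using exp_le by (intro mult_left_mono power_mono) auto
      finally show "B * exp (\<gamma> / 2 * L powr ?p) * A * (exp \<epsilon> * exp \<epsilon>) \<le> B * exp (\<gamma> / 2 * L powr ?p) * A * (exp (v / 48) * 3 ^ j)"
        using A B by (intro mult_left_mono) auto
      show "(48 * real j) ^ j \<le> r ^ j" using v by (intro power_mono) (auto simp: r_def)
    qed (use A B j in auto)
    also have "\<dots> = K * (3 ^ j / (48 * real j) ^ j)" by (simp add: K_def)
    also have "3 ^ j / (48 * real j) ^ j = 1 / (16 ^ j * real j ^ j)"
    proof -
      have "(3::real) / (48 * real j) = 1 / (16 * real j)" by simp
      then show ?thesis by (simp only: power_divide[symmetric] power_mult_distrib[symmetric]) (simp add: power_divide)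
    qed
    finally have "cmod (bil g (phs m W \<eta> j)) * fact j \<le> K * (1 / (16 ^ j * real j ^ j)) * fact j" by (intro mult_right_mono) auto
    also have "\<dots> \<le> K * (1 / (16 ^ j * real j ^ j)) * real j ^ j"
    proof (rule mult_left_mono)
      show "fact j \<le> real j ^ j" using fact_le_power[of j, where 'a=real] by simp
    qed (use K in simp)
    also have "\<dots> = K / 16 ^ j" using j by simp
    finally show ?thesis .
  qed
  then show ?thesis using K by blast
qed

section \<open>Polynomials concentrated at 1/2 and the vanishing of the pairings\<close>

lemma poly_higher_deriv: "(deriv ^^ l) (poly p) = poly ((pderiv ^^ l) p)" for p :: "complex poly"
proof (induction l)
  case (Suc l)
  then show ?case using DERIV_imp_deriv[OF poly_DERIV] by auto
qed simp

text \<open>Cauchy's inequality on a circle of radius \<open>1/8\<close>: small enough for the humps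
  to stay small there, large enough for \<open>8 ^ l\<close> to be beaten by the
  \<open>16 ^ l\<close> of the pairings.\<close>

lemma poly_higher_pderiv_bound:
  fixes p :: "complex poly"
  assumes "\<And>x. cmod (z - x) = 1/8 \<Longrightarrow> cmod (poly p x) \<le> b"
  shows "cmod (poly ((pderiv ^^ l) p) z) \<le> fact l * 8 ^ l * b"
proof -
  have "cmod ((deriv ^^ l) (poly p) z) \<le> fact l * b / (1/8) ^ l"
    by (rule Cauchy_inequality[OF _ _ _ assms]) (auto intro!: holomorphic_intros continuous_intros)
  then show ?thesis by (simp add: poly_higher_deriv power_divide mult_ac)
qed

definition hump :: "nat \<Rightarrow> complex poly" where "hump N = [:3/4, 1, -1:] ^ N"

lemma poly_hump: "poly (hump N) (complex_of_real t) = complex_of_real ((1 - (t - 1/2)^2) ^ N)"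
proof -
  have "poly [:3/4, 1, -1:] (complex_of_real t) = complex_of_real (1 - (t - 1/2)^2)"
    by (simp add: power2_eq_square field_simps)
  then show ?thesis by (simp add: hump_def poly_power)
qed

text \<open>The quadratic is symmetric about \<open>1/2\<close>. In terms of the offset
  \<open>w\<close> from either endpoint it is \<open>3/4 + w (1 - w)\<close>, of modulus at most
  \<open>3/4 + 1/8 * 9/8 = 57/64\<close>.\<close>

lemma hump_bound:
  assumes "cmod (z - x) = 1/8" "z = 0 \<or> z = 1"
  shows "cmod (poly (hump N) x) \<le> (9/10) ^ N"
proof -
  have *: "cmod (poly [:3/4, 1, -1:] x) \<le> 9/10"
  proof -
    define w where "w = (if z = 0 then x else 1 - x)"
    have w: "cmod w = 1/8" using assms by (auto simp: w_def)
    have "poly [:3/4, 1, -1:] x = 3/4 + w * (1 - w)" using assms(2) by (auto simp: w_def algebra_simps)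
    also have "cmod \<dots> \<le> 3/4 + cmod w * cmod (1 - w)"
      using norm_triangle_ineq[of "3/4" "w * (1 - w)"] by (simp add: norm_mult)
    also have "cmod (1 - w) \<le> 1 + cmod w" using norm_triangle_ineq4[of 1 w] by simp
    finally show ?thesis using w by simp
  qed
  then show ?thesis unfolding hump_def poly_power norm_power by (intro power_mono) auto
qed

text \<open>In the moment identity for \<open>hump N\<close>, the factors \<open>l!\<close> and
  \<open>8 ^ l\<close> of the derivatives meet the factorial decay of the pairings. The sum is
  bounded by a multiple of \<open>(9/10) ^ N\<close> whatever the degree, which forces the value at
  \<open>1/2\<close> to be 0.\<close>

lemma pairing_vanishes_at_half:
  assumes m: "m \<ge> 1" and grp: "schr_group m V U" and W: "W \<in> borel_measurable borel" "\<And>x. \<bar>W x\<bar> \<le> v"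
    and VW: "AE x in lborel. V x = W x" and v: "v > 0" and f: "L2 f" and \<gamma>: "\<gamma> > 384"
    and I0: "integrable lborel (\<lambda>x. cmod (U 0 f x) * exp (\<gamma> / 2 * \<bar>x\<bar> powr (real (2*m) / real (2*m - 1))))"
    and I1: "integrable lborel (\<lambda>x. cmod (U 1 f x) * exp (\<gamma> / 2 * \<bar>x\<bar> powr (real (2*m) / real (2*m - 1))))"
    and \<eta>: "\<eta> \<in> borel_measurable borel" "\<And>x. cmod (\<eta> x) \<le> B" "\<And>x. \<bar>x\<bar> > L \<Longrightarrow> \<eta> x = 0" and L: "L \<ge> 0"
  shows "bil (U (1/2) f) \<eta> = 0"
proof -
  have g0: "\<gamma> > 0" using \<gamma> by simp
  have U: "U t f \<in> borel_measurable borel" for t by (rule L2_measurable[OF U_L2[OF grp f]])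
  note D0 = exp_weight_integral(1)[OF m g0 U I0] and D1 = exp_weight_integral(1)[OF m g0 U I1]
  define \<kappa> where "\<kappa> = root (2*m) (2 * v)"
  have k: "\<kappa> > 0" "\<kappa> ^ (2*m) = 2 * v" unfolding \<kappa>_def using v m by (auto intro!: real_root_gt_zero real_root_pow_pos)
  have mom: "integral {0..1} (\<lambda>t. poly p (complex_of_real t) * bil (U t f) \<eta>) =
    (\<Sum>l\<le>degree p. \<i> * (- \<i>)^l * (poly ((pderiv ^^ l) p) 1 * bil (U 1 f) (phs m W \<eta> (Suc l))
       - poly ((pderiv ^^ l) p) 0 * bil (U 0 f) (phs m W \<eta> (Suc l))))" for p
    by (rule moment_identity[OF m grp W VW f D0 D1 \<eta> k])
  have "\<exists>K\<ge>0. \<forall>j\<ge>1. cmod (bil (U 0 f) (phs m W \<eta> j)) * fact j \<le> K / 16 ^ j"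
    by (rule pairing_factorial_decay[OF m W \<eta> L \<gamma> U I0])
  then obtain K0 where K0: "K0 \<ge> 0" "\<forall>j\<ge>1. cmod (bil (U 0 f) (phs m W \<eta> j)) * fact j \<le> K0 / 16 ^ j"
    by (elim exE conjE) (rule that)
  have "\<exists>K\<ge>0. \<forall>j\<ge>1. cmod (bil (U 1 f) (phs m W \<eta> j)) * fact j \<le> K / 16 ^ j"
    by (rule pairing_factorial_decay[OF m W \<eta> L \<gamma> U I1])
  then obtain K1 where K1: "K1 \<ge> 0" "\<forall>j\<ge>1. cmod (bil (U 1 f) (phs m W \<eta> j)) * fact j \<le> K1 / 16 ^ j"
    by (elim exE conjE) (rule that)
  have \<eta>L: "L2 \<eta>"
    by (rule L2_bounded_compact[where B=B and L=L, OF \<eta>(1)]) (use \<eta>(2,3) in \<open>auto simp: indicator_def not_le abs_le_iff\<close>)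
  have term_bound: "cmod (poly ((pderiv ^^ l) (hump N)) z) * cmod c \<le> K * (9/10)^N * (1/2)^l"
    if z: "z = 0 \<or> z = 1" and c: "cmod c * fact (Suc l) \<le> K / 16 ^ Suc l" and K: "K \<ge> 0" for z c K l N
  proof -
    have "cmod (poly ((pderiv ^^ l) (hump N)) z) \<le> fact l * 8 ^ l * (9/10)^N"
      by (rule poly_higher_pderiv_bound) (rule hump_bound[OF _ z])
    then have "cmod (poly ((pderiv ^^ l) (hump N)) z) * cmod c \<le> fact l * 8 ^ l * (9/10)^N * cmod c" by (rule mult_right_mono) simp
    also have "\<dots> = 8 ^ l * (9/10)^N * (cmod c * fact l)" by simp
    also have "\<dots> \<le> 8 ^ l * (9/10)^N * (cmod c * fact (Suc l))"
      by (intro mult_left_mono fact_mono) auto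
    also have "\<dots> \<le> 8 ^ l * (9/10)^N * (K / 16 ^ Suc l)" using c by (intro mult_left_mono) auto
    also have "\<dots> = (9/10)^N * K * ((8 / 16) ^ l / 16)" by (simp only: power_divide) (simp add: mult_ac)
    also have "\<dots> \<le> (9/10)^N * K * (1/2)^l" using K by (intro mult_left_mono) auto
    finally show ?thesis by (simp add: mult_ac)
  qed
  have geo: "(\<Sum>l\<le>n. (1/2)^l) \<le> (2::real)" for n
  proof -
    have "(\<Sum>l\<le>n. (1/2)^l) = (2::real) - (1/2)^n" by (induction n) (auto simp: field_simps)
    then show ?thesis by simp
  qed
  show ?thesis
  proof (rule concentration_at_half[where g="\<lambda>t. bil (U t f) \<eta>" and C="2 * (K0 + K1)"])
    show "continuous_on {0..1} (\<lambda>t. bil (U t f) \<eta>)" by (rule bil_U_continuous[OF grp f \<eta>L])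
    fix N
    let ?be = "\<lambda>l. bil (U 1 f) (phs m W \<eta> (Suc l))" and ?al = "\<lambda>l. bil (U 0 f) (phs m W \<eta> (Suc l))"
    let ?P = "\<lambda>l z. poly ((pderiv ^^ l) (hump N)) z"
    have "cmod (integral {0..1} (\<lambda>t. complex_of_real ((1 - (t - 1/2)^2) ^ N) * bil (U t f) \<eta>)) =
       cmod (\<Sum>l\<le>degree (hump N). \<i> * (- \<i>)^l * (?P l 1 * ?be l - ?P l 0 * ?al l))"
      unfolding poly_hump[symmetric] mom ..
    also have "\<dots> \<le> (\<Sum>l\<le>degree (hump N). (K0 + K1) * (9/10)^N * (1/2)^l)"
    proof (rule sum_norm_le)
      fix l
      have "cmod (\<i> * (- \<i>)^l * (?P l 1 * ?be l - ?P l 0 * ?al l)) = cmod (?P l 1 * ?be l - ?P l 0 * ?al l)"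
        by (simp add: norm_mult norm_power)
      also have "\<dots> \<le> cmod (?P l 1) * cmod (?be l) + cmod (?P l 0) * cmod (?al l)"
        using norm_triangle_ineq4[of "?P l 1 * ?be l" "?P l 0 * ?al l"] by (simp only: norm_mult)
      also have "\<dots> \<le> K1 * (9/10)^N * (1/2)^l + K0 * (9/10)^N * (1/2)^l"
        using K0 K1 by (intro add_mono term_bound) auto
      finally show "cmod (\<i> * (- \<i>)^l * (?P l 1 * ?be l - ?P l 0 * ?al l)) \<le> (K0 + K1) * (9/10)^N * (1/2)^l"
        by (simp add: algebra_simps)
    qed
    also have "\<dots> = (K0 + K1) * (9/10)^N * (\<Sum>l\<le>degree (hump N). (1/2)^l)" by (rule sum_distrib_left[symmetric])
    also have "\<dots> \<le> (K0 + K1) * (9/10)^N * 2" using K0 K1 geo by (intro mult_left_mono) auto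
    finally show "cmod (integral {0..1} (\<lambda>t. complex_of_real ((1 - (t - 1/2)^2) ^ N) * bil (U t f) \<eta>)) \<le> 2 * (K0 + K1) * (9/10)^N"
      by (simp only: mult_ac)
  qed
qed

text \<open>Test with the conjugate of \<open>u\<close>, truncated in position and in size to be
  admissible; the truncations exhaust \<open>u\<close>.\<close>

lemma bil_zero_imp_AE_zero:
  assumes u: "u \<in> borel_measurable borel"
    and z: "\<And>\<eta> B L. \<eta> \<in> borel_measurable borel \<Longrightarrow> (\<And>x. cmod (\<eta> x) \<le> B) \<Longrightarrow> (\<And>x. \<bar>x\<bar> > L \<Longrightarrow> \<eta> x = 0) \<Longrightarrow> L \<ge> 0 \<Longrightarrow> bil u \<eta> = 0"
  shows "AE x in lborel. u x = 0"
proof -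
  note [measurable] = u borel_measurable_compose_cnj[OF u]
  have "AE x in lborel. (if \<bar>x\<bar> \<le> real n \<and> cmod (u x) \<le> real n then (cmod (u x))^2 else 0) = 0" for n
  proof -
    define \<eta> where "\<eta> x = (if \<bar>x\<bar> \<le> real n \<and> cmod (u x) \<le> real n then cnj (u x) else 0)" for x
    define q where "q x = (if \<bar>x\<bar> \<le> real n \<and> cmod (u x) \<le> real n then (cmod (u x))^2 else 0)" for x
    have [measurable]: "\<eta> \<in> borel_measurable borel" unfolding \<eta>_def by measurable
    have [measurable]: "q \<in> borel_measurable borel" unfolding q_def by measurable
    have "bil u \<eta> = 0" by (rule z[of \<eta> "real n" "real n"]) (auto simp: \<eta>_def)
    moreover have uq: "u x * \<eta> x = complex_of_real (q x)" for x
      unfolding \<eta>_def q_def using complex_norm_square[of "u x"] by auto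
    ultimately have "(LINT x|lborel. q x) = 0" by (simp add: bil_def)
    moreover have "integrable lborel q"
    proof (rule Bochner_Integration.integrable_bound)
      show "integrable lborel (\<lambda>x. (real n)^2 * indicator {-real n..real n} x)" by (simp add: integrable_indicator_Icc)
      show "AE x in lborel. norm (q x) \<le> norm ((real n)^2 * indicator {-real n..real n} x)"
        by (rule AE_I2) (auto simp: q_def indicator_def abs_le_iff intro!: power_mono)
    qed simp
    moreover have "AE x in lborel. 0 \<le> q x" by (rule AE_I2) (simp add: q_def)
    ultimately have "AE x in lborel. q x = 0"
      using integral_nonneg_eq_0_iff_AE[of lborel q] by simp
    then show ?thesis by (simp add: q_def)
  qed
  then have "AE x in lborel. \<forall>n. (if \<bar>x\<bar> \<le> real n \<and> cmod (u x) \<le> real n then (cmod (u x))^2 else 0) = 0"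
    unfolding AE_all_countable by blast
  then show ?thesis
  proof eventually_elim
    case (elim x)
    obtain n :: nat where "max \<bar>x\<bar> (cmod (u x)) \<le> real n" using real_arch_simple by blast
    then show ?case using elim[rule_format, of n] by simp
  qed
qed

theorem theorem1p1:
  fixes m :: nat
  assumes "m \<ge> 1"
  shows "\<exists>\<gamma>0 :: real. \<gamma>0 > 0 \<and>
    (\<forall>V U (u :: real \<Rightarrow> real \<Rightarrow> complex) (\<gamma> :: real).
       Linf_real V \<longrightarrow> schr_group m V U \<longrightarrow> C01_L2 u \<longrightarrow>
       (\<forall>t\<in>{0..1}. ae_eq (u t) (U t (u 0))) \<longrightarrow>
       \<gamma> > \<gamma>0 \<longrightarrow>
       L2 (\<lambda>x. complex_of_real (exp (\<gamma> * \<bar>x\<bar> powr (real (2*m) / real (2*m - 1)))) * u 0 x) \<longrightarrow>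
       L2 (\<lambda>x. complex_of_real (exp (\<gamma> * \<bar>x\<bar> powr (real (2*m) / real (2*m - 1)))) * u 1 x) \<longrightarrow>
       (\<forall>t\<in>{0..1}. AE x in lborel. u t x = 0))"
proof (intro exI[of _ 384] conjI allI impI ballI)
  \<comment> \<open>The threshold of \<open>pairing_factorial_decay\<close>. It serves for every
    \<open>m\<close>, since \<open>2 / \<gamma> < 1\<close> and so its power \<open>2m - 1\<close>
    is at most \<open>2 / \<gamma>\<close>.\<close>
  show "(384::real) > 0" by simp
  fix V U and u :: "real \<Rightarrow> real \<Rightarrow> complex" and \<gamma> :: real and t :: real
  let ?p = "real (2*m) / real (2*m - 1)"
  assume V: "Linf_real V" and grp: "schr_group m V U" and C: "C01_L2 u" and uU: "\<forall>t\<in>{0..1}. ae_eq (u t) (U t (u 0))"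
    and \<gamma>: "\<gamma> > 384" and w0: "L2 (\<lambda>x. complex_of_real (exp (\<gamma> * \<bar>x\<bar> powr ?p)) * u 0 x)"
    and w1: "L2 (\<lambda>x. complex_of_real (exp (\<gamma> * \<bar>x\<bar> powr ?p)) * u 1 x)" and t: "t \<in> {0..1}"
  have g0: "\<gamma> > 0" using \<gamma> by simp
  obtain A where Vm: "V \<in> borel_measurable borel" and A: "AE x in lborel. \<bar>V x\<bar> \<le> A"
    using V by (auto simp: Linf_real_def)
  \<comment> \<open>The maximum with 1 makes \<open>v\<close> positive, so that a rate
    \<open>\<kappa> > 0\<close> with \<open>\<kappa>\<^sup>2\<^sup>m = 2 v\<close> exists.\<close>
  define v where "v = max A 1"
  define W where "W x = (if \<bar>V x\<bar> \<le> v then V x else 0)" for x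
  have W: "W \<in> borel_measurable borel" unfolding W_def using Vm by measurable
  have Wv: "\<bar>W x\<bar> \<le> v" for x by (auto simp: W_def v_def)
  have VW: "AE x in lborel. V x = W x" using A by eventually_elim (auto simp: W_def v_def)
  have v: "v > 0" by (simp add: v_def)
  have uL: "L2 (u s)" if "s \<in> {0..1}" for s using C that by (auto simp: C01_L2_def)
  have f: "L2 (u 0)" by (rule uL) simp
  have I: "integrable lborel (\<lambda>x. cmod (U s (u 0) x) * exp (\<gamma> / 2 * \<bar>x\<bar> powr ?p))"
    if s: "s \<in> {0..1}" and w: "L2 (\<lambda>x. complex_of_real (exp (\<gamma> * \<bar>x\<bar> powr ?p)) * u s x)" for s
  proof -
    note [measurable] = L2_measurable[OF uL[OF s]] L2_measurable[OF U_L2[OF grp f, of s]]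
    have "integrable lborel (\<lambda>x. cmod (u s x) * exp (\<gamma> / 2 * \<bar>x\<bar> powr ?p))"
      by (rule weighted_integrable[OF assms g0 _ w]) measurable
    moreover have "AE x in lborel. cmod (u s x) * exp (\<gamma> / 2 * \<bar>x\<bar> powr ?p) = cmod (U s (u 0) x) * exp (\<gamma> / 2 * \<bar>x\<bar> powr ?p)"
      using uU[rule_format, OF s] unfolding ae_eq_def by eventually_elim simp
    ultimately show ?thesis by (subst (asm) integrable_cong_AE) auto
  qed
  have "AE x in lborel. U (1/2) (u 0) x = 0"
  proof (rule bil_zero_imp_AE_zero)
    show "U (1/2) (u 0) \<in> borel_measurable borel" by (rule L2_measurable[OF U_L2[OF grp f]])
    fix \<eta> :: "real \<Rightarrow> complex" and B L :: real
    assume e: "\<eta> \<in> borel_measurable borel" "\<And>x. cmod (\<eta> x) \<le> B" "\<And>x. \<bar>x\<bar> > L \<Longrightarrow> \<eta> x = 0" "L \<ge> 0"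
    show "bil (U (1/2) (u 0)) \<eta> = 0"
      by (rule pairing_vanishes_at_half[OF assms grp W Wv VW v f \<gamma> I[OF _ w0] I[OF _ w1] e]) auto
  qed
  then have "L2norm (U (1/2) (u 0)) = L2norm (\<lambda>x. 0)"
    by (intro L2norm_cong_ae U_L2[OF grp f]) (auto simp: ae_eq_def)
  moreover have "L2norm (\<lambda>x. 0) = 0" by (simp add: L2norm_def)
  \<comment> \<open>The group preserves the norm, so vanishing at time \<open>1/2\<close> spreads to
    every \<open>t\<close>.\<close>
  ultimately have "L2norm (U t (u 0)) = 0" unfolding U_norm[OF grp f] by simp
  then have "AE x in lborel. U t (u 0) x = 0" by (rule L2norm_zero_AE[OF U_L2[OF grp f]])
  then show "AE x in lborel. u t x = 0"
    using uU[rule_format, OF t] unfolding ae_eq_def by eventually_elim simp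
qed

end
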